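(* Let $n\ge 9$ be an odd integer that is not square-free, and assume that every prime factor of $n$ is greater than $5$. Assume that $(x_0,\dots,x_4)\in G^5$ satisfies $(\tan x_0)^2=(\tan x_1)(\tan x_2)(\tan x_3)(\tan x_4)$ with $0<x_i<\frac{\pi}{2}$ and $\operatorname{den}(x_i)\in\{n,2n\}$ for each $0\le i\le 4$. Then there exist a permutation $\sigma$ of $\{1,2,3,4\}$ and rationals $s,t$ with $0<s<\frac12$, $0<t\le\frac14$ such that $x_0=x_{\sigma(1)}=x_{\sigma(2)}=s\pi$, $x_{\sigma(3)}=t\pi$ and $x_{\sigma(4)}=(\frac12-t)\pi$.
   Context: $G:=\mathbb{Q}\pi$; for nonzero $g\in G$, $\operatorname{den}(g)$ is the denominator of $g/\pi$ in lowest terms. *)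

theory Defs
  imports "HOL-Analysis.Analysis" "HOL-Computational_Algebra.Computational_Algebra"
    "HOL-Combinatorics.Permutations"
begin

definition G :: "real set" where
  "G = {g. \<exists>q::rat. g = of_rat q * pi}"

text \<open>The rational \<open>g / \<pi>\<close> is unique for \<open>g \<in> G\<close>, and \<open>quotient_of\<close> returns it in lowest terms
  with a positive denominator. Outside \<open>G\<close> the value is unspecified.\<close>

definition den :: "real \<Rightarrow> int" where
  "den g = snd (quotient_of (THE q. g / pi = of_rat q))"

end

theory Submission
  imports Defs "HOL-Number_Theory.Number_Theory"
begin

text \<open>
  Put \<open>\<omega> = e^{2\<pi>i/n}\<close>. Then \<open>e^{2ix_j} = \<epsilon>_j \<omega>^{a_j}\<close> with \<open>\<epsilon>_j = \<plusminus>1\<close> and \<open>a_j\<close> coprime to \<open>n\<close>, and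
  \<open>i tan x = (e^{2ix} - 1)/(e^{2ix} + 1)\<close>. Conjugating the tangent relation over \<open>\<rat>\<close> and taking logarithms of
  absolute values gives, for every unit \<open>s\<close> modulo \<open>n\<close>, a relation \<open>\<Sum> c(a) log |1 - \<omega>^{as}| = 0\<close>, where the
  even function \<open>c\<close> on the units is supported on the at most five classes \<open>\<plusminus>a_j\<close>; the factor between
  \<open>(1 - y)/(1 + y)\<close> and \<open>1 - y\<close> is removed by \<open>1 + y = (1 - y^2)/(1 - y)\<close> and the finite order of 2.

  Suppose \<open>c \<noteq> 0\<close>. For each prime \<open>q\<close> dividing \<open>n\<close>, replace \<open>c(a)\<close> by \<open>c(a) - c(ha)\<close> for a unit
  \<open>h \<equiv> 1\<close> modulo \<open>n/q\<close>. There are at least \<open>q - 1 \<ge> 6\<close> choices of \<open>h\<close>, so the five classes cannot prevent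
  keeping \<open>c \<noteq> 0\<close>. Afterwards the finite Fourier transform \<open>K\<close> of \<open>c\<close> is supported on the units and has sum 0, and
  the Fourier series of \<open>log |1 - e^{i\<theta>}|\<close> turns the relations into \<open>\<Sum> K(ls)/l = 0\<close> for all units \<open>s\<close>. The
  functions with these properties form a translation-invariant space; if it is nonzero it contains a nonprincipal
  Dirichlet character \<open>\<phi>\<close> with \<open>L(1, \<phi>) = 0\<close>, which is impossible. So \<open>c = 0\<close>, which means that the angles cancel in
  the way claimed.
\<close>

section \<open>Summation by parts and Euler products\<close>

text \<open>The obstacle is that the numbers \<open>1 - \<omega>^a\<close>, with \<open>a\<close> a
  unit modulo \<open>n\<close>, may satisfy genuine multiplicative relations: the component of
  \<open>c\<close> at an imprimitive character chi is weighted by Euler factors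
  \<open>1 - chi(q)\<close>, which can be 0, so the logarithmic relations may not see it. Passing to
  \<open>c(a) - c(ha)\<close> with \<open>h \<equiv> 1\<close> modulo \<open>n/q\<close> annihilates
  every component whose character factors through \<open>n/q\<close>. After all primes
  \<open>q\<close> only primitive characters are left, and this is what the support of
  \<open>K\<close> on the units expresses.

  Absolute values control only the real part of \<open>\<Sum> K(ls)/l\<close>; since
  \<open>c\<close> is even, \<open>K\<close> is real, which settles the imaginary part.

  For \<open>L(1, \<phi>) \<noteq> 0\<close> no complex variable is needed. If \<phi> has a nonreal
  value, the 3-4-1 inequality at real points \<open>1 + e\<close> suffices. It fails for real
  \<phi>, because the square of \<phi> is then principal and its series has a pole; there a Lambert
  series takes over.\<close>

lemma partial_summation:
  fixes a b :: "nat \<Rightarrow> 'a::comm_ring_1"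
  shows "(\<Sum>k<m. a k * b k) = sum a {..<m} * b m + (\<Sum>k<m. sum a {..<Suc k} * (b k - b (Suc k)))"
  by (induction m) (simp_all add: algebra_simps)

text \<open>After Abel summation the weights \<open>b m\<close> and \<open>b k - b (Suc k)\<close>
  are nonnegative and add up to \<open>b 0\<close>.\<close>

lemma norm_sum_mult_decreasing_le:
  fixes a :: "nat \<Rightarrow> complex" and b :: "nat \<Rightarrow> real"
  assumes B: "\<And>m. norm (sum a {..<m}) \<le> B"
    and b: "\<And>k. b (Suc k) \<le> b k" "\<And>k. 0 \<le> b k"
  shows "norm (\<Sum>k<m. a k * of_real (b k)) \<le> B * b 0"
proof -
  have "norm (\<Sum>k<m. a k * of_real (b k)) \<le> norm (sum a {..<m} * of_real (b m)) +
      norm (\<Sum>k<m. sum a {..<Suc k} * of_real (b k - b (Suc k)))"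
    unfolding partial_summation[of a _ m] of_real_diff[symmetric] by (rule norm_triangle_ineq)
  also have "\<dots> \<le> B * b m + (\<Sum>k<m. B * (b k - b (Suc k)))"
  proof (intro add_mono sum_norm_le)
    show "norm (sum a {..<m} * of_real (b m)) \<le> B * b m"
      using B[of m] b(2)[of m] by (simp add: norm_mult mult_right_mono)
    show "norm (sum a {..<Suc k} * of_real (b k - b (Suc k))) \<le> B * (b k - b (Suc k))" for k
      unfolding norm_mult norm_of_real using B[of "Suc k"] b(1)[of k] by (simp add: mult_right_mono del: sum.lessThan_Suc)
  qed
  also have "(\<Sum>k<m. B * (b k - b (Suc k))) = B * (b 0 - b m)"
    by (simp add: sum_distrib_left[symmetric] sum_lessThan_telescope')
  finally show ?thesis by (simp add: algebra_simps)
qed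

text \<open>Dirichlet's test in quantitative form. The bound depends on \<open>b\<close> only
  through \<open>b 0\<close>, so it is uniform in any parameter that \<open>b\<close> carries; later
  this parameter is the distance to the point 1.\<close>

lemma
  fixes a :: "nat \<Rightarrow> complex" and b :: "nat \<Rightarrow> real"
  assumes B: "\<And>m. norm (sum a {..<m}) \<le> B"
    and b: "\<And>k. b (Suc k) \<le> b k" "b \<longlonglongrightarrow> 0"
  shows summable_mult_decreasing: "summable (\<lambda>k. a k * of_real (b k))"
    and norm_suminf_mult_decreasing_le: "norm (\<Sum>k. a k * of_real (b k)) \<le> B * b 0"
proof -
  have dec: "decseq b" using b(1) by (simp add: decseq_Suc_iff)
  have b0: "0 \<le> b k" for k using decseq_ge[OF dec b(2)] by simp
  have B0: "B \<ge> 0" using B[of 0] by simp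
  \<comment> \<open>A block of \<open>a\<close> is a difference of two initial sums, hence the
    factor 2.\<close>
  have tail: "norm (\<Sum>k=i..<j. a k * of_real (b k)) \<le> (2 * B) * b i" for i j
  proof (cases "i \<le> j")
    case True
    have "(\<Sum>k=i..<j. a k * of_real (b k)) = (\<Sum>k<j-i. a (k + i) * of_real (b (k + i)))"
      by (rule sum.reindex_bij_witness[of _ "\<lambda>k. k + i" "\<lambda>k. k - i"]) auto
    also have "norm \<dots> \<le> (2 * B) * b (0 + i)"
    proof (rule norm_sum_mult_decreasing_le)
      fix m
      have "sum a {..<m+i} = sum a {..<i} + (\<Sum>k<m. a (k + i))"
        by (induction m) (simp_all add: algebra_simps)
      then have "(\<Sum>k<m. a (k + i)) = sum a {..<m+i} - sum a {..<i}" by simp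
      then show "norm (\<Sum>k<m. a (k + i)) \<le> 2 * B"
        using norm_triangle_ineq4[of "sum a {..<m+i}" "sum a {..<i}"] B[of "m+i"] B[of i] by simp
    qed (use b b0 in auto)
    finally show ?thesis by simp
  qed (use B0 b0 in auto)
  show S: "summable (\<lambda>k. a k * of_real (b k))"
  proof (subst summable_Cauchy, intro allI impI)
    fix e :: real assume "e > 0"
    have "(\<lambda>k. (2 * B) * b k) \<longlonglongrightarrow> (2 * B) * 0" by (intro tendsto_intros b(2))
    then have "\<forall>\<^sub>F k in sequentially. (2 * B) * b k < e"
      using \<open>e > 0\<close> by (intro order_tendstoD(2)) auto
    then obtain M where "\<And>i. i \<ge> M \<Longrightarrow> (2 * B) * b i < e"
      by (auto simp: eventually_sequentially)
    then show "\<exists>M. \<forall>i\<ge>M. \<forall>j. norm (\<Sum>k=i..<j. a k * of_real (b k)) < e"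
      using tail le_less_trans by blast
  qed
  then have "(\<lambda>m. norm (\<Sum>k<m. a k * of_real (b k))) \<longlonglongrightarrow> norm (\<Sum>k. a k * of_real (b k))"
    by (intro tendsto_norm summable_LIMSEQ)
  then show "norm (\<Sum>k. a k * of_real (b k)) \<le> B * b 0"
    by (rule LIMSEQ_le_const2) (use norm_sum_mult_decreasing_le[of a B b] B b b0 in auto)
qed

text \<open>Mean value bounds for the function \<open>x powr (-e)\<close> on an interval of length
  1. The upper bound controls the weights in Abel summation, the lower bound makes a series of
  powers telescope.\<close>

lemma powr_diff_bounds:
  fixes x e :: real
  assumes "x > 0" "e > 0"
  shows "x powr (-e) - (x + 1) powr (-e) \<le> e * x powr (-e - 1)"
    and "e * (x + 1) powr (-e - 1) \<le> x powr (-e) - (x + 1) powr (-e)"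
proof -
  have "1 + 1 / x \<noteq> 0" using assms by (simp add: field_simps)
  then have "1 - e * ln (1 + 1 / x) \<le> (1 + 1 / x) powr (-e)"
    using exp_ge_add_one_self[of "- e * ln (1 + 1/x)"] by (simp add: powr_def)
  moreover have "ln (1 + 1 / x) \<le> 1 / x" using assms by (intro ln_add_one_self_le_self) auto
  ultimately have "1 - e * (1 / x) \<le> (1 + 1 / x) powr (-e)"
    using assms mult_left_mono[of "ln (1 + 1/x)" "1/x" e] by linarith
  then have "x powr (-e) * (1 - e * (1 / x)) \<le> x powr (-e) * (1 + 1 / x) powr (-e)"
    by (intro mult_left_mono) auto
  also have "x powr (-e) * (1 + 1 / x) powr (-e) = (x + 1) powr (-e)"
    unfolding powr_mult[symmetric] using assms by (simp add: distrib_left add.commute)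
  finally show "x powr (-e) - (x + 1) powr (-e) \<le> e * x powr (-e - 1)"
    using assms by (simp add: powr_diff algebra_simps)
next
  define y where "y = x + 1"
  have y: "y > 1" using assms by (simp add: y_def)
  have "1 - e * ln (1 - 1 / y) \<le> (1 - 1 / y) powr (-e)"
    using exp_ge_add_one_self[of "- e * ln (1 - 1/y)"] y by (simp add: powr_def)
  moreover have "ln (1 - 1 / y) \<le> - (1 / y)" using ln_le_minus_one[of "1 - 1/y"] y by simp
  ultimately have "1 + e * (1 / y) \<le> (1 - 1 / y) powr (-e)"
    using assms mult_left_mono[of "ln (1 - 1/y)" "- (1/y)" e] by linarith
  then have "y powr (-e) * (1 + e * (1 / y)) \<le> y powr (-e) * (1 - 1 / y) powr (-e)"
    by (intro mult_left_mono) auto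
  also have "y powr (-e) * (1 - 1 / y) powr (-e) = (y - 1) powr (-e)"
    unfolding powr_mult[symmetric] using y by (simp add: right_diff_distrib)
  finally show "e * (x + 1) powr (-e - 1) \<le> x powr (-e) - (x + 1) powr (-e)"
    using y by (simp add: powr_diff algebra_simps y_def)
qed

text \<open>Taking logarithms, this is \<open>3 + 4 cos \<theta> + cos 2\<theta> = 2 (1 + cos \<theta>)\<^sup>2 \<ge> 0\<close>.\<close>

lemma mertens_factor_le_1:
  fixes z :: complex and x :: real
  assumes z: "norm z = 1 \<or> z = 0" and x: "0 < x" "x < 1"
  shows "norm (1 - of_real x :: complex) ^ 3 * norm (1 - z * of_real x) ^ 4 * norm (1 - z\<^sup>2 * of_real x) \<le> 1"
proof -
  \<comment> \<open>The term at \<open>k = 0\<close> is 0 because division by 0 gives 0, so the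
    series effectively starts at \<open>k = 1\<close>.\<close>
  have ln_series: "(\<lambda>k. Re (w ^ k) / real k * x ^ k) sums (- ln (norm (1 - w * of_real x)))"
    and pos: "norm (1 - w * of_real x) > 0"
    if w: "norm w \<le> 1" for w :: complex
  proof -
    have wx: "norm (w * of_real x) < 1"
    proof -
      have "norm w * x \<le> 1 * x" using w x by (intro mult_right_mono) auto
      then have "norm w * x < 1" using x by linarith
      then show ?thesis using x by (simp add: norm_mult)
    qed
    then have nz: "1 - w * of_real x \<noteq> 0" by auto
    then show "norm (1 - w * of_real x) > 0" by simp
    have "(\<lambda>k. - ((w * of_real x) ^ k) / of_nat k) sums Ln (1 + - (w * of_real x))"
      using Ln_series'[of "- (w * of_real x)"] wx by simp
    then have "(\<lambda>k. Re (- (- ((w * of_real x) ^ k) / of_nat k))) sums Re (- Ln (1 - w * of_real x))"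
      by (intro sums_Re sums_minus) simp
    then show "(\<lambda>k. Re (w ^ k) / real k * x ^ k) sums (- ln (norm (1 - w * of_real x)))"
      using nz by (simp add: power_mult_distrib Re_divide_of_nat field_simps flip: of_real_power)
  qed
  have n: "norm z \<le> 1" "norm (z\<^sup>2) \<le> 1" using z by (auto simp: norm_power)
  have S: "(\<lambda>k. 3 * (Re (1 ^ k) / real k * x ^ k) + 4 * (Re (z ^ k) / real k * x ^ k)
      + Re ((z\<^sup>2) ^ k) / real k * x ^ k) sums
    (3 * - ln (norm (1 - 1 * of_real x :: complex)) + 4 * - ln (norm (1 - z * of_real x))
      + - ln (norm (1 - z\<^sup>2 * of_real x)))"
    by (intro sums_add sums_mult ln_series n) simp
  have P: "0 \<le> 3 * (Re (1 ^ k) / real k * x ^ k) + 4 * (Re (z ^ k) / real k * x ^ k)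
      + Re ((z\<^sup>2) ^ k) / real k * x ^ k" for k
  proof -
    define u where "u = z ^ k"
    have "0 \<le> 3 + 4 * Re u + Re (u\<^sup>2)"
    proof (cases "u = 0")
      case False
      then have "norm u = 1" using z by (auto simp: u_def norm_power power_0_left split: if_splits)
      then have "(Re u)\<^sup>2 + (Im u)\<^sup>2 = 1" by (simp add: cmod_def)
      then have "3 + 4 * Re u + Re (u\<^sup>2) = 2 * (1 + Re u)\<^sup>2"
        by (simp add: power2_eq_square algebra_simps)
      then show ?thesis by simp
    qed simp
    then have "0 \<le> (3 + 4 * Re u + Re (u\<^sup>2)) * (x ^ k / real k)" using x by simp
    moreover have "u\<^sup>2 = (z\<^sup>2) ^ k" by (simp add: u_def power_mult[symmetric] mult.commute)
    ultimately show ?thesis by (simp add: u_def algebra_simps add_divide_distrib)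
  qed
  have "0 \<le> 3 * - ln (norm (1 - 1 * of_real x :: complex)) + 4 * - ln (norm (1 - z * of_real x))
      + - ln (norm (1 - z\<^sup>2 * of_real x))"
    by (rule sums_le[OF P sums_zero S])
  also have "\<dots> = - ln (norm (1 - of_real x :: complex) ^ 3 * norm (1 - z * of_real x) ^ 4 * norm (1 - z\<^sup>2 * of_real x))"
    using pos[of 1] pos[of z] pos[of "z\<^sup>2"] n by (simp add: ln_mult ln_realpow)
  finally show ?thesis
    using pos[of 1] pos[of z] pos[of "z\<^sup>2"] n by (simp add: ln_le_zero_iff)
qed

text \<open>Sieving one prime at a time: by complete multiplicativity, \<open>g p\<close> times the
  sum over a set \<open>T\<close> is the sum over \<open>p T\<close>, which consists of the
  multiples of \<open>p\<close> in \<open>T\<close>.\<close>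

lemma euler_product_finite:
  fixes g :: "nat \<Rightarrow> complex"
  assumes mult: "\<And>a b. g (a * b) = g a * g b" and sm: "g summable_on {0<..}"
    and S: "finite S" "\<And>p. p \<in> S \<Longrightarrow> prime p"
  shows "(\<Prod>p\<in>S. 1 - g p) * infsum g {0<..} = infsum g {n. 0 < n \<and> (\<forall>p\<in>S. \<not> p dvd n)}"
  using S
proof (induction S rule: finite_induct)
  case empty
  then show ?case by (simp add: greaterThan_def)
next
  case (insert p S)
  define T where "T = {n::nat. 0 < n \<and> (\<forall>q\<in>S. \<not> q dvd n)}"
  have smT: "g summable_on A" if "A \<subseteq> {0<..}" for A
    using sm that summable_on_subset_banach by blast
  have p: "prime p" "p > 0" using insert.prems prime_gt_0_nat by auto
  have "q dvd p * n \<longleftrightarrow> q dvd n" if "q \<in> S" for q n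
  proof -
    have "q \<noteq> p" "prime q" using that insert by auto
    then show ?thesis using p(1) by (metis prime_dvd_mult_iff primes_dvd_imp_eq)
  qed
  then have img: "(\<lambda>n. p * n) ` T = {n \<in> T. p dvd n}"
    using p by (auto simp: T_def)
  have "g p * infsum g T = infsum (\<lambda>n. g (p * n)) T"
    by (simp add: mult infsum_cmult_right')
  also have "\<dots> = infsum g ((\<lambda>n. p * n) ` T)"
    using p by (subst infsum_reindex) (auto simp: inj_on_def o_def)
  finally have gp: "g p * infsum g T = infsum g {n \<in> T. p dvd n}" by (simp add: img)
  have "infsum g T = infsum g ({n \<in> T. p dvd n} \<union> {n \<in> T. \<not> p dvd n})"
    by (rule arg_cong[where f = "infsum g"]) auto
  also have "\<dots> = infsum g {n \<in> T. p dvd n} + infsum g {n \<in> T. \<not> p dvd n}"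
    by (intro infsum_Un_disjoint smT) (auto simp: T_def)
  finally have split: "infsum g T = \<dots>" .
  have "(1 - g p) * infsum g T = infsum g T - g p * infsum g T" by (simp add: left_diff_distrib)
  also have "\<dots> = infsum g {n \<in> T. \<not> p dvd n}" unfolding gp using split by simp
  finally have "(1 - g p) * infsum g T = infsum g {n \<in> T. \<not> p dvd n}" .
  moreover have "{n \<in> T. \<not> p dvd n} = {n. 0 < n \<and> (\<forall>q\<in>insert p S. \<not> q dvd n)}"
    by (auto simp: T_def)
  moreover have "(\<Prod>q\<in>S. 1 - g q) * infsum g {0<..} = infsum g T"
    unfolding T_def using insert by auto
  ultimately show ?case using insert.hyps by (simp add: mult.assoc)
qed

text \<open>A number other than 1 without prime factors up to \<open>M\<close> exceeds
  \<open>M\<close>, so what the sieve leaves is \<open>g 1\<close> plus part of a convergent tail.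
  Keeping the factors \<open>1 - g p\<close> on the side of the sum avoids inverting them.\<close>

lemma euler_product_tendsto:
  fixes g :: "nat \<Rightarrow> complex"
  assumes mult: "\<And>a b. g (a * b) = g a * g b" "g 1 = 1"
    and sm: "(\<lambda>n. norm (g n)) summable_on {0<..}"
  shows "(\<lambda>M. (\<Prod>p | prime p \<and> p \<le> M. 1 - g p) * infsum g {0<..}) \<longlonglongrightarrow> 1"
proof -
  have sg: "g summable_on {0<..}" using sm abs_summable_summable by blast
  define T where "T = (\<lambda>M. {n::nat. 0 < n \<and> (\<forall>p\<in>{p. prime p \<and> p \<le> M}. \<not> p dvd n)})"
  have eq: "(\<Prod>p | prime p \<and> p \<le> M. 1 - g p) * infsum g {0<..} = infsum g (T M)" for M
    unfolding T_def using sg by (intro euler_product_finite mult) auto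
  have T: "1 \<in> T M" "T M - {1} \<subseteq> {M<..}" for M
  proof -
    show "1 \<in> T M" by (auto simp: T_def)
    show "T M - {1} \<subseteq> {M<..}"
    proof
      fix n assume n: "n \<in> T M - {1}"
      then have "n \<noteq> 1" by auto
      then obtain p where "prime p" "p dvd n" using prime_factor_nat by blast
      then show "n \<in> {M<..}" using n dvd_imp_le[of p n] by (auto simp: T_def)
    qed
  qed
  have smN: "(\<lambda>n. norm (g n)) summable_on A" if "A \<subseteq> {0<..}" for A
    using sm that summable_on_subset_banach by blast
  have bound: "norm (infsum g (T M) - 1) \<le> infsum (\<lambda>n. norm (g n)) {M<..}" for M
  proof -
    have "T M = {1} \<union> (T M - {1})" using T[of M] by auto
    then have "infsum g (T M) = infsum g ({1} \<union> (T M - {1}))" by simp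
    also have "\<dots> = infsum g {1} + infsum g (T M - {1})"
      using sg T[of M] by (intro infsum_Un_disjoint) (auto intro: summable_on_subset_banach)
    finally have "infsum g (T M) - 1 = infsum g (T M - {1})" using mult by simp
    also have "norm \<dots> \<le> infsum (\<lambda>n. norm (g n)) (T M - {1})"
      using T(2)[of M] by (intro norm_infsum_bound smN) auto
    also have "\<dots> \<le> infsum (\<lambda>n. norm (g n)) {M<..}"
      using T(2)[of M] by (intro infsum_mono_neutral smN) auto
    finally show ?thesis .
  qed
  have tail: "(\<lambda>M. infsum (\<lambda>n. norm (g n)) {M<..}) \<longlonglongrightarrow> 0"
  proof -
    have tail_eq: "infsum (\<lambda>n. norm (g n)) {M<..} = infsum (\<lambda>n. norm (g n)) {0<..} - (\<Sum>n\<in>{0<..M}. norm (g n))" for M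
    proof -
      have "{0<..} = {0<..M} \<union> {M<..}" by auto
      then have "infsum (\<lambda>n. norm (g n)) {0<..} = infsum (\<lambda>n. norm (g n)) ({0<..M} \<union> {M<..})" by simp
      also have "\<dots> = infsum (\<lambda>n. norm (g n)) {0<..M} + infsum (\<lambda>n. norm (g n)) {M<..}"
        by (intro infsum_Un_disjoint smN) auto
      finally show ?thesis by simp
    qed
    have "(\<lambda>M. \<Sum>n\<in>{0<..M}. norm (g n)) \<longlonglongrightarrow> infsum (\<lambda>n. norm (g n)) {0<..}"
    proof -
      have "((\<lambda>n. norm (g n)) has_sum infsum (\<lambda>n. norm (g n)) {0<..}) {0<..}" using sm by simp
      then have "(sum (\<lambda>n. norm (g n)) \<longlongrightarrow> infsum (\<lambda>n. norm (g n)) {0<..}) (finite_subsets_at_top {0<..})"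
        by (simp add: has_sum_def)
      moreover have "filterlim (\<lambda>M. {0<..M}) (finite_subsets_at_top {0<..}) sequentially"
        unfolding filterlim_finite_subsets_at_top
      proof (intro allI impI)
        fix X :: "nat set" assume X: "finite X \<and> X \<subseteq> {0<..}"
        then have "\<forall>M\<ge>Max (insert 0 X). X \<subseteq> {0<..M}" by auto
        then show "\<forall>\<^sub>F M in sequentially. finite {0<..M} \<and> X \<subseteq> {0<..M} \<and> {0<..M} \<subseteq> {0<..}"
          unfolding eventually_sequentially by (intro exI[of _ "Max (insert 0 X)"]) auto
      qed
      ultimately show ?thesis by (rule filterlim_compose)
    qed
    then have "(\<lambda>M. infsum (\<lambda>n. norm (g n)) {0<..} - (\<Sum>n\<in>{0<..M}. norm (g n))) \<longlonglongrightarrow>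
        infsum (\<lambda>n. norm (g n)) {0<..} - infsum (\<lambda>n. norm (g n)) {0<..}"
      by (intro tendsto_intros)
    moreover have "(\<lambda>M. infsum (\<lambda>n. norm (g n)) {M<..}) =
        (\<lambda>M. infsum (\<lambda>n. norm (g n)) {0<..} - (\<Sum>n\<in>{0<..M}. norm (g n)))"
      by (rule ext) (rule tail_eq)
    ultimately show ?thesis by (simp only: diff_self)
  qed
  have "(\<lambda>M. infsum g (T M) - 1) \<longlonglongrightarrow> 0"
    by (rule Lim_null_comparison[OF _ tail]) (use bound in auto)
  then show ?thesis unfolding eq by (simp add: LIM_zero_iff)
qed

section \<open>Nonvanishing of \<open>L(1, \<phi>)\<close>\<close>

lemma periodic_mod_eq:
  fixes K :: "nat \<Rightarrow> 'a"
  assumes "\<And>a. K (a + N) = K a"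
  shows "K (a mod N) = K a"
proof -
  have "K (b + N * k) = K b" for b k
  proof (induction k)
    case (Suc k)
    then show ?case using assms[of "b + N * k"] by (simp add: add_ac)
  qed simp
  from this[of "a mod N" "a div N"] show ?thesis by simp
qed

lemma periodic_cong:
  fixes K :: "nat \<Rightarrow> 'a"
  assumes "\<And>a. K (a + N) = K a" "[a = b] (mod N)"
  shows "K a = K b"
  using periodic_mod_eq[of K N a] periodic_mod_eq[of K N b] assms by (simp add: cong_def)

lemma mult_mod_bij_betw:
  fixes N a :: nat
  assumes "N > 0" "coprime a N"
  shows "bij_betw (\<lambda>k. a * k mod N) {..<N} {..<N}"
proof -
  have "inj_on (\<lambda>k. a * k mod N) {..<N}"
  proof (rule inj_onI)
    fix x y assume "x \<in> {..<N}" "y \<in> {..<N}" "a * x mod N = a * y mod N"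
    then show "x = y"
      using cong_mult_lcancel_nat[of a N x y] assms(2) by (simp add: cong_def)
  qed
  moreover have "(\<lambda>k. a * k mod N) ` {..<N} \<subseteq> {..<N}" using assms(1) by auto
  ultimately show ?thesis
    by (simp add: bij_betw_def endo_inj_surj)
qed

lemma sum_mult_reindex:
  fixes f :: "nat \<Rightarrow> 'a::comm_monoid_add"
  assumes "N > 0" "coprime h N" "\<And>a. f (a + N) = f a"
  shows "(\<Sum>a<N. f (h * a)) = (\<Sum>a<N. f a)"
proof -
  have "(\<Sum>a<N. f a) = (\<Sum>a<N. f (h * a mod N))"
    by (intro sum.reindex_bij_betw[OF mult_mod_bij_betw, symmetric] assms)
  then show ?thesis by (simp add: periodic_mod_eq[of f N, OF assms(3)])
qed

locale nonprincipal_char =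
  fixes N :: nat and \<phi> :: "nat \<Rightarrow> complex"
  assumes N: "N > 1"
    and mult: "\<And>a b. \<phi> (a * b) = \<phi> a * \<phi> b"
    and one: "\<phi> 1 = 1"
    and periodic: "\<And>a. \<phi> (a + N) = \<phi> a"
    and zero: "\<And>a. \<not> coprime a N \<Longrightarrow> \<phi> a = 0"
    and nonprincipal: "\<exists>a. coprime a N \<and> \<phi> a \<noteq> 1"
begin

lemma periodic_mod: "\<phi> (a mod N) = \<phi> a"
  using periodic by (rule periodic_mod_eq)

lemma power: "\<phi> (a ^ k) = \<phi> a ^ k"
  using one by (induction k) (simp_all add: mult)

lemma norm_coprime:
  assumes "coprime a N"
  shows "norm (\<phi> a) = 1"
proof -
  have "[a ^ totient N = 1] (mod N)" using assms by (rule euler_theorem)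
  then have "\<phi> a ^ totient N = 1"
    using periodic_mod[of "a ^ totient N"] periodic_mod[of 1] one
    by (simp add: power cong_def)
  then show ?thesis
    using N by (metis norm_power norm_one power_eq_1_iff norm_ge_zero totient_gt_0_iff not_gr_zero less_imp_le zero_less_one less_trans real_norm_def abs_norm_cancel)
qed

lemma norm_le_1: "norm (\<phi> a) \<le> 1"
  using norm_coprime[of a] zero[of a] by (cases "coprime a N") auto

lemma sum_period: "(\<Sum>k<N. \<phi> k) = 0"
proof -
  obtain a where a: "coprime a N" "\<phi> a \<noteq> 1" using nonprincipal by blast
  have "(\<Sum>k<N. \<phi> k) = (\<Sum>k<N. \<phi> (a * k))"
    using N a periodic by (intro sum_mult_reindex[symmetric]) auto
  also have "\<dots> = \<phi> a * (\<Sum>k<N. \<phi> k)"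
    by (simp add: mult sum_distrib_left)
  finally show ?thesis using a(2) by auto
qed

text \<open>Initial sums depend only on their length modulo \<open>N\<close> and are at most
  \<open>N\<close>; a block starting at \<open>j\<close> is a difference of two of them.\<close>

lemma norm_partial_sum_le: "norm (\<Sum>k<m. \<phi> (k + j)) \<le> 2 * real N"
proof -
  have shift: "(\<Sum>k<m+N. \<phi> k) = (\<Sum>k<m. \<phi> k)" for m
    by (induction m) (simp_all add: sum_period periodic)
  have shift': "(\<Sum>k<m+N*i. \<phi> k) = (\<Sum>k<m. \<phi> k)" for m i
  proof (induction i)
    case (Suc i)
    then show ?case using shift[of "m + N * i"] by (simp add: add_ac)
  qed simp
  have "norm (\<Sum>k<m. \<phi> k) \<le> real N" for m
  proof -
    have "(\<Sum>k<m. \<phi> k) = (\<Sum>k<m mod N. \<phi> k)"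
      using shift'[of "m mod N" "m div N"] by simp
    also have "norm \<dots> \<le> (\<Sum>k<m mod N. 1)" by (intro sum_norm_le norm_le_1)
    also have "\<dots> \<le> real N" using N by (simp add: less_imp_le)
    finally show ?thesis .
  qed note bound = this
  have "(\<Sum>k<m+j. \<phi> k) = (\<Sum>k<j. \<phi> k) + (\<Sum>k<m. \<phi> (k + j))"
    by (induction m) (simp_all add: algebra_simps)
  then have "(\<Sum>k<m. \<phi> (k + j)) = (\<Sum>k<m+j. \<phi> k) - (\<Sum>k<j. \<phi> k)" by simp
  then show ?thesis
    using norm_triangle_ineq4[of "\<Sum>k<m+j. \<phi> k" "\<Sum>k<j. \<phi> k"] bound[of "m+j"] bound[of j] by simp
qed

lemma norm_partial_sum_Suc_le: "norm (\<Sum>k<m. \<phi> (Suc k)) \<le> 2 * real N"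
  using norm_partial_sum_le[where j = 1] by simp

text \<open>The terms of \<open>L(1, \<phi>)\<close>, shifted to start at index 0. Convergence is
  only guaranteed in the given order, so the value is taken as \<open>suminf\<close>.\<close>

definition L_coeff :: "nat \<Rightarrow> complex" where
  "L_coeff k = \<phi> (Suc k) / of_nat (Suc k)"

lemma summable_L_coeff: "summable L_coeff"
proof -
  have "summable (\<lambda>k. \<phi> (Suc k) * of_real (1 / real (Suc k)))"
  proof (rule summable_mult_decreasing[OF norm_partial_sum_Suc_le])
    show "(\<lambda>k. 1 / real (Suc k)) \<longlonglongrightarrow> 0" by (intro LIMSEQ_Suc lim_1_over_n)
  qed (simp add: field_simps)
  then show ?thesis by (simp add: L_coeff_def[abs_def])
qed

text \<open>When the whole series is 0, an initial sum is minus a tail, and Dirichlet's test makes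
  tails small.\<close>

lemma norm_L_coeff_partial_sum:
  assumes "suminf L_coeff = 0"
  shows "norm (\<Sum>k<m. L_coeff k) \<le> 2 * real N / real (Suc m)"
proof -
  have "(\<Sum>k<m. L_coeff k) = - (\<Sum>k. L_coeff (k + m))"
    using suminf_split_initial_segment[OF summable_L_coeff, of m] assms by (simp add: eq_neg_iff_add_eq_0 add.commute)
  also have "(\<lambda>k. L_coeff (k + m)) = (\<lambda>k. \<phi> (k + Suc m) * of_real (1 / real (Suc (k + m))))"
    by (simp add: L_coeff_def fun_eq_iff)
  also have "norm (- (\<Sum>k. \<phi> (k + Suc m) * of_real (1 / real (Suc (k + m))))) \<le>
      2 * real N * (1 / real (Suc (0 + m)))"
    unfolding norm_minus_cancel
  proof (rule norm_suminf_mult_decreasing_le)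
    have "(\<lambda>k. 1 / real (k + Suc m)) \<longlonglongrightarrow> 0"
      by (rule LIMSEQ_ignore_initial_segment) (rule lim_1_over_n)
    then show "(\<lambda>k. 1 / real (Suc (k + m))) \<longlonglongrightarrow> 0" by simp
  qed (use norm_partial_sum_le[where j = "Suc m"] in \<open>auto simp: field_simps\<close>)
  finally show ?thesis by simp
qed

end

section \<open>Nonvanishing for characters with a nonreal value: Dirichlet series at
  \<open>1 + e\<close>\<close>

lemma powr_series:
  fixes e :: real
  assumes e: "e > 0"
  shows "summable (\<lambda>k. real (Suc k) powr (- e - 1))"
    and "(\<Sum>k. real (Suc k) powr (- e - 1)) \<le> 1 + 1 / e"
proof -
  show sm: "summable (\<lambda>k. real (Suc k) powr (- e - 1))"
    unfolding summable_Suc_iff[of "\<lambda>k. real k powr (- e - 1)"] summable_real_powr_iff using e by simp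
  \<comment> \<open>Comparison with the integral of \<open>x powr (- e - 1)\<close>, carried out as
    a telescoping sum. It bounds the pole of the zeta function at 1.\<close>
  have "(\<Sum>k<Suc m. real (Suc k) powr (- e - 1)) \<le> 1 + (1 - real (Suc m) powr (-e)) / e" for m
  proof (induction m)
    case (Suc m)
    have "e * real (Suc (Suc m)) powr (- e - 1) \<le> real (Suc m) powr (-e) - real (Suc (Suc m)) powr (-e)"
      using powr_diff_bounds(2)[of "real (Suc m)" e] e by (simp add: add.commute)
    then have "real (Suc (Suc m)) powr (- e - 1) \<le> (real (Suc m) powr (-e) - real (Suc (Suc m)) powr (-e)) / e"
      using e by (simp add: field_simps)
    then show ?case using Suc by (simp add: diff_divide_distrib)
  qed simp
  moreover have "1 + (1 - real (Suc m) powr (-e)) / e \<le> 1 + 1 / e" for m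
    using e by (simp add: field_simps)
  ultimately have "(\<Sum>k<Suc m. real (Suc k) powr (- e - 1)) \<le> 1 + 1 / e" for m
    using order_trans by blast
  moreover have "(\<lambda>m. \<Sum>k<Suc m. real (Suc k) powr (- e - 1)) \<longlonglongrightarrow> (\<Sum>k. real (Suc k) powr (- e - 1))"
    by (intro LIMSEQ_Suc summable_LIMSEQ sm)
  ultimately show "(\<Sum>k. real (Suc k) powr (- e - 1)) \<le> 1 + 1 / e"
    by (intro LIMSEQ_le_const2) auto
qed

text \<open>The exponent is written so that \<open>e\<close> is the distance of the argument
  \<open>1 + e\<close> from 1.\<close>

definition dirichlet_term :: "(nat \<Rightarrow> complex) \<Rightarrow> real \<Rightarrow> nat \<Rightarrow> complex" where
  "dirichlet_term \<psi> e n = \<psi> n * of_real (real n powr (- e - 1))"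

text \<open>Euler products work with the unordered sum over the positive integers, Abel summation
  with the ordered series; the last clause passes between them.\<close>

lemma dirichlet_term_summable:
  assumes "\<And>n. norm (\<psi> n) \<le> 1" "e > 0"
  shows "(\<lambda>n. norm (dirichlet_term \<psi> e n)) summable_on {0<..}"
    and "summable (\<lambda>k. dirichlet_term \<psi> e (Suc k))"
    and "infsum (dirichlet_term \<psi> e) {0<..} = (\<Sum>k. dirichlet_term \<psi> e (Suc k))"
proof -
  have sm: "summable (\<lambda>k. norm (dirichlet_term \<psi> e (Suc k)))"
    by (rule summable_comparison_test'[OF powr_series(1)[OF assms(2)], of 0])
      (use assms(1) in \<open>simp add: dirichlet_term_def norm_mult mult_left_le_one_le\<close>)
  then show sm': "summable (\<lambda>k. dirichlet_term \<psi> e (Suc k))" by (rule summable_norm_cancel)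
  have img: "{0<..} = Suc ` UNIV" by (auto simp: image_iff gr0_conv_Suc)
  show "(\<lambda>n. norm (dirichlet_term \<psi> e n)) summable_on {0<..}"
    unfolding img using sm
    by (subst summable_on_reindex) (auto simp: o_def intro!: norm_summable_imp_summable_on)
  have "infsum (dirichlet_term \<psi> e) {0<..} = infsum (\<lambda>k. dirichlet_term \<psi> e (Suc k)) UNIV"
    unfolding img by (subst infsum_reindex) (auto simp: o_def)
  also have "\<dots> = (\<Sum>k. dirichlet_term \<psi> e (Suc k))"
    by (intro infsumI norm_summable_imp_has_sum sm summable_sums sm')
  finally show "infsum (dirichlet_term \<psi> e) {0<..} = (\<Sum>k. dirichlet_term \<psi> e (Suc k))" .
qed

text \<open>Multiplying the three series by their finite Euler products \<open>P\<close> makes the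
  combination tend to 1. The same combination of the \<open>P\<close> alone is a product of factors
  at most 1, by \<open>mertens_factor_le_1\<close>.\<close>

lemma mertens_product_ge_1:
  fixes \<phi> :: "nat \<Rightarrow> complex"
  assumes mult: "\<And>a b. \<phi> (a * b) = \<phi> a * \<phi> b" "\<phi> 1 = 1"
    and norm: "\<And>n. norm (\<phi> n) = 1 \<or> \<phi> n = 0" and e: "e > 0"
  shows "1 \<le> norm (\<Sum>k. dirichlet_term (\<lambda>_. 1) e (Suc k)) ^ 3 *
    norm (\<Sum>k. dirichlet_term \<phi> e (Suc k)) ^ 4 * norm (\<Sum>k. dirichlet_term (\<lambda>n. (\<phi> n)\<^sup>2) e (Suc k))"
proof -
  have le: "norm (\<phi> n) \<le> 1" "norm ((\<phi> n)\<^sup>2) \<le> 1" for n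
    using norm[of n] by (auto simp: norm_power)
  define P where "P = (\<lambda>\<psi> M. \<Prod>p | prime p \<and> p \<le> M. 1 - dirichlet_term \<psi> e p)"
  define Z where "Z = (\<lambda>\<psi>. \<Sum>k. dirichlet_term \<psi> e (Suc k))"
  have euler: "(\<lambda>M. P \<psi> M * Z \<psi>) \<longlonglongrightarrow> 1"
    if "\<And>a b. \<psi> (a * b) = \<psi> a * \<psi> b" "\<psi> 1 = 1" "\<And>n. norm (\<psi> n) \<le> 1" for \<psi>
    using euler_product_tendsto[of "dirichlet_term \<psi> e"] dirichlet_term_summable[of \<psi> e] that e
    by (simp add: P_def Z_def dirichlet_term_def powr_mult)
  have "(\<lambda>M. norm (P (\<lambda>_. 1) M * Z (\<lambda>_. 1)) ^ 3 * norm (P \<phi> M * Z \<phi>) ^ 4 *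
      norm (P (\<lambda>n. (\<phi> n)\<^sup>2) M * Z (\<lambda>n. (\<phi> n)\<^sup>2))) \<longlonglongrightarrow> norm (1::complex) ^ 3 * norm (1::complex) ^ 4 * norm (1::complex)"
    by (intro tendsto_intros euler) (use mult le in \<open>auto simp: power_mult_distrib\<close>)
  moreover have "norm (P (\<lambda>_. 1) M * Z (\<lambda>_. 1)) ^ 3 * norm (P \<phi> M * Z \<phi>) ^ 4 *
      norm (P (\<lambda>n. (\<phi> n)\<^sup>2) M * Z (\<lambda>n. (\<phi> n)\<^sup>2)) \<le>
      norm (Z (\<lambda>_. 1)) ^ 3 * norm (Z \<phi>) ^ 4 * norm (Z (\<lambda>n. (\<phi> n)\<^sup>2))" (is "_ \<le> ?R") for M
  proof -
    have "norm (P (\<lambda>_. 1) M) ^ 3 * norm (P \<phi> M) ^ 4 * norm (P (\<lambda>n. (\<phi> n)\<^sup>2) M) =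
        (\<Prod>p | prime p \<and> p \<le> M. norm (1 - dirichlet_term (\<lambda>_. 1) e p) ^ 3 *
          norm (1 - dirichlet_term \<phi> e p) ^ 4 * norm (1 - dirichlet_term (\<lambda>n. (\<phi> n)\<^sup>2) e p))"
      by (simp add: P_def prod_norm prod_power_distrib prod.distrib flip: prod_norm)
    also have "\<dots> \<le> 1"
    proof (intro prod_le_1 conjI)
      fix p assume "p \<in> {p. prime p \<and> p \<le> M}"
      then have p: "p > 1" using prime_gt_1_nat by auto
      then have "real p powr (- e - 1) < 1" using e by (simp add: powr_less_one)
      then show "norm (1 - dirichlet_term (\<lambda>_. 1) e p) ^ 3 *
          norm (1 - dirichlet_term \<phi> e p) ^ 4 * norm (1 - dirichlet_term (\<lambda>n. (\<phi> n)\<^sup>2) e p) \<le> 1"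
        unfolding dirichlet_term_def mult_1
        using mertens_factor_le_1[of "\<phi> p" "real p powr (- e - 1)"] norm p by simp
    qed auto
    finally have "(norm (P (\<lambda>_. 1) M) ^ 3 * norm (P \<phi> M) ^ 4 * norm (P (\<lambda>n. (\<phi> n)\<^sup>2) M)) * ?R \<le> 1 * ?R"
      by (intro mult_right_mono) auto
    then show ?thesis by (simp add: norm_mult power_mult_distrib mult_ac)
  qed
  ultimately have "norm (1::complex) ^ 3 * norm (1::complex) ^ 4 * norm (1::complex) \<le>
      norm (Z (\<lambda>_. 1)) ^ 3 * norm (Z \<phi>) ^ 4 * norm (Z (\<lambda>n. (\<phi> n)\<^sup>2))"
    by (intro LIMSEQ_le_const2) auto
  then show ?thesis by (simp add: Z_def)
qed

context nonprincipal_char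
begin

lemma norm_dirichlet_series_le:
  assumes e: "e > 0"
  shows "norm (\<Sum>k. dirichlet_term \<phi> e (Suc k)) \<le> 2 * real N"
proof -
  have "norm (\<Sum>k. \<phi> (Suc k) * of_real (real (Suc k) powr (- e - 1))) \<le> 2 * real N * real (Suc 0) powr (- e - 1)"
  proof (rule norm_suminf_mult_decreasing_le[OF norm_partial_sum_Suc_le])
    show "real (Suc (Suc k)) powr (- e - 1) \<le> real (Suc k) powr (- e - 1)" for k
      using e by (intro powr_mono2') auto
    show "(\<lambda>k. real (Suc k) powr (- e - 1)) \<longlonglongrightarrow> 0"
      using powr_series(1)[OF e] by (rule summable_LIMSEQ_zero)
  qed
  then show ?thesis by (simp add: dirichlet_term_def)
qed

text \<open>A zero at 1 of order at least one, without analytic continuation. In Abel summation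
  against \<open>k powr (-e)\<close> the initial sums are of size \<open>1/k\<close> and the weight
  differences at most \<open>e/k\<close>; the sum of \<open>1/(k(k+1))\<close> converges.\<close>

lemma norm_dirichlet_series_le_if_L_zero:
  assumes L: "suminf L_coeff = 0" and e: "e > 0"
  shows "norm (\<Sum>k. dirichlet_term \<phi> e (Suc k)) \<le> 2 * real N * e"
proof -
  define b where "b = (\<lambda>k. real (Suc k) powr (-e))"
  have term_eq: "dirichlet_term \<phi> e (Suc k) = L_coeff k * of_real (b k)" for k
    by (simp add: dirichlet_term_def L_coeff_def b_def powr_diff)
  have b1: "b k \<le> 1" "b k \<ge> 0" for k
    using e powr_mono2'[of "-e" 1 "real (Suc k)"] by (auto simp: b_def)
  have bd: "0 \<le> b k - b (Suc k)" "b k - b (Suc k) \<le> e / real (Suc k)" for k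
  proof -
    show "0 \<le> b k - b (Suc k)" using e by (auto simp: b_def intro: powr_mono2')
    have "b k - b (Suc k) \<le> e * real (Suc k) powr (- e - 1)"
      using powr_diff_bounds(1)[of "real (Suc k)" e] e by (simp add: b_def add.commute)
    also have "\<dots> = e * (b k / real (Suc k))" by (simp add: b_def powr_diff)
    also have "\<dots> \<le> e * (1 / real (Suc k))"
      using e b1[of k] by (intro mult_left_mono divide_right_mono) auto
    finally show "b k - b (Suc k) \<le> e / real (Suc k)" by simp
  qed
  have bound: "norm (\<Sum>k<m. L_coeff k * of_real (b k)) \<le> 2 * real N / real (Suc m) + 2 * real N * e" for m
  proof -
    have "norm (\<Sum>k<m. L_coeff k * of_real (b k)) \<le> norm (sum L_coeff {..<m} * of_real (b m)) +
        norm (\<Sum>k<m. sum L_coeff {..<Suc k} * of_real (b k - b (Suc k)))"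
      unfolding partial_summation[of L_coeff _ m] of_real_diff[symmetric] by (rule norm_triangle_ineq)
    also have "\<dots> \<le> 2 * real N / real (Suc m) +
        (\<Sum>k<m. (2 * real N * e) * (1 / real (Suc k) - 1 / real (Suc (Suc k))))"
    proof (intro add_mono sum_norm_le)
      have "norm (sum L_coeff {..<m} * of_real (b m)) \<le> 2 * real N / real (Suc m) * 1"
        unfolding norm_mult norm_of_real using b1[of m]
        by (intro mult_mono norm_L_coeff_partial_sum L) auto
      then show "norm (sum L_coeff {..<m} * of_real (b m)) \<le> 2 * real N / real (Suc m)" by simp
      fix k
      have "norm (sum L_coeff {..<Suc k} * of_real (b k - b (Suc k))) \<le>
          2 * real N / real (Suc (Suc k)) * (e / real (Suc k))"
        unfolding norm_mult norm_of_real using bd[of k]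
        by (intro mult_mono norm_L_coeff_partial_sum L) auto
      also have "\<dots> = (2 * real N * e) * (1 / real (Suc k) - 1 / real (Suc (Suc k)))"
        by (simp add: field_simps)
      finally show "norm (sum L_coeff {..<Suc k} * of_real (b k - b (Suc k))) \<le>
          (2 * real N * e) * (1 / real (Suc k) - 1 / real (Suc (Suc k)))" .
    qed
    also have "(\<Sum>k<m. (2 * real N * e) * (1 / real (Suc k) - 1 / real (Suc (Suc k)))) =
        (2 * real N * e) * (1 - 1 / real (Suc m))"
      unfolding sum_distrib_left[symmetric] by (subst sum_lessThan_telescope') simp
    also have "\<dots> \<le> 2 * real N * e" using e by (simp add: mult_left_le)
    finally show ?thesis by simp
  qed
  have "summable (\<lambda>k. dirichlet_term \<phi> e (Suc k))"
    using norm_le_1 e by (rule dirichlet_term_summable(2))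
  then have "(\<lambda>m. norm (\<Sum>k<m. L_coeff k * of_real (b k))) \<longlonglongrightarrow> norm (\<Sum>k. dirichlet_term \<phi> e (Suc k))"
    unfolding term_eq by (intro tendsto_norm summable_LIMSEQ)
  moreover have "(\<lambda>m. 2 * real N * (1 / real (Suc m)) + 2 * real N * e) \<longlonglongrightarrow> 2 * real N * 0 + 2 * real N * e"
    by (intro tendsto_intros LIMSEQ_Suc lim_1_over_n)
  ultimately have "norm (\<Sum>k. dirichlet_term \<phi> e (Suc k)) \<le> 2 * real N * 0 + 2 * real N * e"
    by (rule LIMSEQ_le) (use bound in auto)
  then show ?thesis by simp
qed

text \<open>A zero at 1 would contribute the fourth power of \<open>e\<close>, the pole only the
  inverse third power, and the series of the square of \<phi> stays bounded since that square is
  nonprincipal. For small \<open>e\<close> the product drops below 1.\<close>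

lemma L_nonzero_complex:
  assumes "\<exists>a. coprime a N \<and> (\<phi> a)\<^sup>2 \<noteq> 1"
  shows "suminf L_coeff \<noteq> 0"
proof
  assume L: "suminf L_coeff = 0"
  interpret sq: nonprincipal_char N "\<lambda>n. (\<phi> n)\<^sup>2"
    by unfold_locales (use N mult one periodic zero assms in \<open>auto simp: power_mult_distrib\<close>)
  define C where "C = 2 * real N"
  have C: "C \<ge> 2" using N by (simp add: C_def)
  \<comment> \<open>Chosen so that the final bound \<open>8 * C ^ 5 * e\<close> equals 1/2.\<close>
  define e where "e = 1 / (16 * C ^ 5)"
  have "C ^ 5 \<ge> 1" using C by (intro one_le_power) auto
  then have "16 * C ^ 5 \<ge> 1" by simp
  then have e: "e > 0" "e \<le> 1" using C by (simp_all add: e_def divide_le_eq)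
  have "norm (\<Sum>k. dirichlet_term (\<lambda>_. 1) e (Suc k)) \<le> 2 / e"
  proof -
    have "(\<Sum>k. dirichlet_term (\<lambda>_. 1) e (Suc k)) = of_real (\<Sum>k. real (Suc k) powr (- e - 1))"
      using powr_series(1)[OF e(1)] by (simp add: dirichlet_term_def suminf_of_real)
    moreover have "0 \<le> (\<Sum>k. real (Suc k) powr (- e - 1))"
      by (intro suminf_nonneg powr_series e) auto
    moreover have "1 + 1 / e \<le> 2 / e" using e by (simp add: field_simps)
    ultimately show ?thesis using powr_series(2)[OF e(1)] by simp
  qed
  then have "norm (\<Sum>k. dirichlet_term (\<lambda>_. 1) e (Suc k)) ^ 3 *
      norm (\<Sum>k. dirichlet_term \<phi> e (Suc k)) ^ 4 * norm (\<Sum>k. dirichlet_term (\<lambda>n. (\<phi> n)\<^sup>2) e (Suc k))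
    \<le> (2 / e) ^ 3 * (C * e) ^ 4 * C"
    unfolding C_def using norm_dirichlet_series_le_if_L_zero[OF L e(1)] sq.norm_dirichlet_series_le[OF e(1)] e
    by (intro mult_mono power_mono) auto
  moreover have "1 \<le> norm (\<Sum>k. dirichlet_term (\<lambda>_. 1) e (Suc k)) ^ 3 *
      norm (\<Sum>k. dirichlet_term \<phi> e (Suc k)) ^ 4 * norm (\<Sum>k. dirichlet_term (\<lambda>n. (\<phi> n)\<^sup>2) e (Suc k))"
    using mult one norm_coprime zero e(1) by (intro mertens_product_ge_1) blast+
  moreover have "(2 / e) ^ 3 * (C * e) ^ 4 * C = 8 * C ^ 5 * e"
    using e by (simp add: field_simps power_numeral_reduce)
  moreover have "8 * C ^ 5 * e = 1 / 2" using C by (simp add: e_def)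
  ultimately show False by simp
qed

end

section \<open>Nonvanishing for real characters: Lambert series\<close>

lemma geometric_sum_ge:
  fixes s :: real
  assumes "0 < s"
  shows "real n * s ^ (n - 1) \<le> (\<Sum>i<n. (s\<^sup>2) ^ i)"
proof -
  \<comment> \<open>Terms with indices \<open>i\<close> and \<open>n - 1 - i\<close> are paired, and
    the inequality of arithmetic and geometric means is applied to each pair.\<close>
  have "2 * s ^ (n - 1) \<le> (s\<^sup>2) ^ i + (s\<^sup>2) ^ (n - Suc i)" if "i < n" for i
  proof -
    have "n - 1 = i + (n - Suc i)" using that by simp
    then have "s ^ (n - 1) = s ^ i * s ^ (n - Suc i)" by (metis power_add)
    moreover have "0 \<le> (s ^ i - s ^ (n - Suc i))\<^sup>2" by simp
    ultimately show ?thesis by (simp add: power2_diff power_mult[symmetric] mult_ac)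
  qed
  then have "(\<Sum>i<n. 2 * s ^ (n - 1)) \<le> (\<Sum>i<n. (s\<^sup>2) ^ i + (s\<^sup>2) ^ (n - Suc i))"
    by (intro sum_mono) auto
  also have "\<dots> = 2 * (\<Sum>i<n. (s\<^sup>2) ^ i)"
    by (simp add: sum.distrib sum.nat_diff_reindex)
  finally show ?thesis by simp
qed

text \<open>Monsky's argument for real characters. If \<open>\<Sum>\<phi>(k)/k = 0\<close>, then \<open>\<Sum>\<phi>(k) t^k/(1 - t^k)\<close> is, up to
  sign, the sum of \<open>\<phi>(k)\<close> against the weights below. They decrease from 1 to 0, so the sum stays
  bounded as \<open>t \<rightarrow> 1\<close>; but the Lambert series equals \<open>\<Sum>r(n) t^n\<close> with \<open>r(n) = \<Sum>\<phi>(d)\<close> over the divisors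
  \<open>d\<close> of \<open>n\<close>, where \<open>r \<ge> 0\<close> and \<open>r \<ge> 1\<close> on squares.\<close>

definition lambert_weight :: "real \<Rightarrow> nat \<Rightarrow> real" where
  "lambert_weight t n = 1 / (real n * (1 - t)) - t ^ n / (1 - t ^ n)"

text \<open>With \<open>A n = (1 - t^n)/(1 - t)\<close> the claim becomes
  \<open>n (n+1) t^n \<le> A n * A (n+1)\<close>, which follows from \<open>geometric_sum_ge\<close>
  for \<open>n\<close> and \<open>n + 1\<close>. Writing \<open>t\<close> as the square of
  \<open>s\<close> keeps half-integral powers of \<open>t\<close> polynomial.\<close>

lemma lambert_weight_decreasing:
  assumes s: "0 < s" "s < 1" and n: "n > 0"
  shows "lambert_weight (s\<^sup>2) (Suc n) \<le> lambert_weight (s\<^sup>2) n"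
proof -
  define t where "t = s\<^sup>2"
  define A where "A = (\<lambda>n. \<Sum>i<n. t ^ i)"
  have t: "0 < t" "t < 1" using s by (auto simp: t_def power_less_one_iff)
  have A: "1 - t ^ k = (1 - t) * A k" for k
    using one_diff_power_eq[of t k] by (simp add: A_def)
  have Apos: "A k > 0" if "k > 0" for k
    unfolding A_def using that t by (intro sum_pos) auto
  have "(real n * s ^ (n - 1)) * (real (Suc n) * s ^ n) \<le> A n * A (Suc n)"
    using geometric_sum_ge[OF s(1), of n] geometric_sum_ge[OF s(1), of "Suc n"] s Apos[of n] n
    unfolding A_def t_def by (intro mult_mono) auto
  moreover have "(real n * real (Suc n)) * t ^ n \<le> (real n * real (Suc n)) * (s ^ (n - 1) * s ^ n)"
  proof (rule mult_left_mono)
    have "t ^ n = s ^ (n + n)" by (simp add: t_def power_mult[symmetric] mult_2)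
    also have "\<dots> \<le> s ^ ((n - 1) + n)" using s by (intro power_decreasing) auto
    finally show "t ^ n \<le> s ^ (n - 1) * s ^ n" by (simp add: power_add)
  qed simp
  ultimately have le: "real n * real (Suc n) * t ^ n \<le> A n * A (Suc n)"
    by (simp add: mult_ac)
  have pos: "A n > 0" "A (Suc n) > 0" "1 - t > 0" "real n > 0" using Apos t n by auto
  have "t ^ n / (1 - t ^ n) - t ^ Suc n / (1 - t ^ Suc n) = t ^ n / (A n * A (Suc n)) / (1 - t)"
  proof -
    have "t ^ n / (1 - t ^ n) - t ^ Suc n / (1 - t ^ Suc n) =
        (t ^ n * (1 - t ^ Suc n) - t ^ Suc n * (1 - t ^ n)) / ((1 - t ^ n) * (1 - t ^ Suc n))"
      by (rule diff_frac_eq) (use pos in \<open>simp_all only: A, simp_all\<close>)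
    also have "t ^ n * (1 - t ^ Suc n) - t ^ Suc n * (1 - t ^ n) = t ^ n * (1 - t)"
      by (simp add: algebra_simps)
    also have "t ^ n * (1 - t) / ((1 - t ^ n) * (1 - t ^ Suc n)) = t ^ n / (A n * A (Suc n)) / (1 - t)"
      unfolding A using pos(3) by (simp add: divide_simps)
    finally show ?thesis .
  qed
  also have "\<dots> \<le> 1 / (real n * real (Suc n)) / (1 - t)"
  proof (rule divide_right_mono)
    show "t ^ n / (A n * A (Suc n)) \<le> 1 / (real n * real (Suc n))"
      using le pos by (simp add: divide_le_eq le_divide_eq mult_ac)
  qed (use pos in simp)
  also have "\<dots> = 1 / (real n * (1 - t)) - 1 / (real (Suc n) * (1 - t))"
    unfolding of_nat_Suc using pos(3,4) by (simp add: divide_simps)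
  finally show ?thesis unfolding lambert_weight_def t_def[symmetric] by linarith
qed

lemma lambert_weight_tendsto_0:
  assumes "0 < t" "t < 1"
  shows "lambert_weight t \<longlonglongrightarrow> 0"
proof -
  have "(\<lambda>n. 1 / real n * (1 / (1 - t)) - t ^ n / (1 - t ^ n)) \<longlonglongrightarrow> 0 * (1 / (1 - t)) - 0 / (1 - 0)"
    using assms by (intro tendsto_intros lim_1_over_n LIMSEQ_power_zero) auto
  then show ?thesis by (simp add: lambert_weight_def[abs_def])
qed

locale sign_function =
  fixes c :: "nat \<Rightarrow> real"
  assumes c_mult: "\<And>a b. c (a * b) = c a * c b" and c_1: "c 1 = 1"
    and c_values: "\<And>a. c a \<in> {-1, 0, 1}"
begin

lemma c_power: "c (a ^ k) = c a ^ k"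
  using c_1 by (induction k) (simp_all add: c_mult)

definition divisor_sum :: "nat \<Rightarrow> real" where
  "divisor_sum n = (\<Sum>d | d dvd n. c d)"

text \<open>Splitting off one prime at a time is all the multiplicativity that the inductions below
  require.\<close>

lemma divisor_sum_prime_power:
  assumes p: "prime p" and m: "\<not> p dvd m" and m0: "m > 0"
  shows "divisor_sum (p ^ k * m) = (\<Sum>i\<le>k. c p ^ i) * divisor_sum m"
proof -
  have p0: "p > 0" using p prime_gt_0_nat by blast
  have "bij_betw (\<lambda>(i, d). p ^ i * d) ({..k} \<times> {d. d dvd m}) {d. d dvd p ^ k * m}"
  proof (rule bij_betwI')
    fix x y assume x: "x \<in> {..k} \<times> {d. d dvd m}" and y: "y \<in> {..k} \<times> {d. d dvd m}"
    obtain i d j e where xy: "x = (i, d)" "y = (j, e)" by (cases x, cases y) auto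
    have nd: "\<not> p dvd d" "\<not> p dvd e" "d > 0" "e > 0"
      using x y m m0 unfolding xy by (auto intro: dvd_trans Nat.gr0I)
    have "i = j \<and> d = e" if eq: "p ^ i * d = p ^ j * e"
    proof -
      have "multiplicity p (p ^ i * d) = i" "multiplicity p (p ^ j * e) = j"
        using p nd p0 by (auto simp: prime_elem_multiplicity_mult_distrib not_dvd_imp_multiplicity_0)
      then have "i = j" using eq by simp
      then show ?thesis using eq p0 by simp
    qed
    then show "((case x of (i, d) \<Rightarrow> p ^ i * d) = (case y of (i, d) \<Rightarrow> p ^ i * d)) = (x = y)"
      unfolding xy by auto
  next
    fix x assume "x \<in> {..k} \<times> {d. d dvd m}"
    then show "(case x of (i, d) \<Rightarrow> p ^ i * d) \<in> {d. d dvd p ^ k * m}"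
      by (auto intro: mult_dvd_mono le_imp_power_dvd)
  next
    fix y assume "y \<in> {d. d dvd p ^ k * m}"
    then obtain a b where ab: "y = a * b" "a dvd p ^ k" "b dvd m"
      using division_decomp[of y "p ^ k" m] by auto
    obtain i where "i \<le> k" "a = p ^ i"
      using ab(2) divides_primepow_nat[OF p] by auto
    then show "\<exists>x\<in>{..k} \<times> {d. d dvd m}. y = (case x of (i, d) \<Rightarrow> p ^ i * d)"
      using ab by (intro bexI[of _ "(i, b)"]) auto
  qed
  then have "divisor_sum (p ^ k * m) = (\<Sum>(i, d)\<in>{..k} \<times> {d. d dvd m}. c (p ^ i * d))"
    unfolding divisor_sum_def by (subst sum.reindex_bij_betw[symmetric]) (auto simp: case_prod_unfold)
  also have "\<dots> = (\<Sum>i\<le>k. c p ^ i) * divisor_sum m"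
    by (simp add: sum.cartesian_product[symmetric] c_mult c_power divisor_sum_def sum_product)
  finally show ?thesis .
qed

lemma geometric_sum_sign: "0 \<le> (\<Sum>i\<le>k. c p ^ i)" "even k \<Longrightarrow> 1 \<le> (\<Sum>i\<le>k. c p ^ i)"
proof -
  have "(\<Sum>i\<le>k. (-1::real) ^ i) = (if even k then 1 else 0)" by (induction k) auto
  moreover have "(\<Sum>i\<le>k. (0::real) ^ i) = 1" by (simp add: power_0_left if_distrib sum.If_cases)
  moreover have "c p = -1 \<or> c p = 0 \<or> c p = 1" using c_values[of p] by auto
  ultimately show "0 \<le> (\<Sum>i\<le>k. c p ^ i)" "even k \<Longrightarrow> 1 \<le> (\<Sum>i\<le>k. c p ^ i)"
    by (elim disjE; simp)+
qed

lemma prime_power_decomposition: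
  fixes n :: nat
  assumes "n > 1"
  obtains p k m where "prime p" "n = p ^ k * m" "\<not> p dvd m" "m > 0" "m < n"
proof -
  obtain p where p: "prime p" "p dvd n" using assms prime_factor_nat[of n] by auto
  obtain m where m: "n = p ^ multiplicity p n * m" "\<not> p dvd m"
    using multiplicity_decompose'[of n p] assms p(1) by (metis not_prime_unit not_one_less_zero)
  have "multiplicity p n > 0" using p assms by (simp add: prime_multiplicity_gt_zero_iff)
  then have "p ^ multiplicity p n > 1" by (rule one_less_power[OF prime_gt_1_nat[OF p(1)]])
  moreover have "m > 0" using m assms by (cases m) auto
  ultimately have "m < n" by (subst m(1)) simp
  then show ?thesis using that p(1) m \<open>m > 0\<close> by blast
qed

lemma divisor_sum_1: "divisor_sum 1 = 1"
  using c_1 by (simp add: divisor_sum_def)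

lemma divisor_sum_nonneg: "n > 0 \<Longrightarrow> 0 \<le> divisor_sum n"
proof (induction n rule: less_induct)
  case (less n)
  show ?case
  proof (cases "n = 1")
    case False
    then obtain p k m where "prime p" "n = p ^ k * m" "\<not> p dvd m" "m > 0" "m < n"
      using less.prems prime_power_decomposition[of n] by auto
    then show ?thesis
      using less.IH[of m] geometric_sum_sign(1)[where p = p and k = k] divisor_sum_prime_power[of p m k] by simp
  qed (use divisor_sum_1 in simp)
qed

lemma divisor_sum_square: "n > 0 \<Longrightarrow> 1 \<le> divisor_sum (n\<^sup>2)"
proof (induction n rule: less_induct)
  case (less n)
  show ?case
  proof (cases "n = 1")
    case False
    then obtain p k m where p: "prime p" "n = p ^ k * m" "\<not> p dvd m" "m > 0" "m < n"
      using less.prems prime_power_decomposition[of n] by auto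
    have "n\<^sup>2 = p ^ (2 * k) * m\<^sup>2" by (simp add: p(2) power_mult_distrib power_mult[symmetric] mult.commute)
    moreover have "\<not> p dvd m\<^sup>2" using p prime_dvd_power by blast
    ultimately have "divisor_sum (n\<^sup>2) = (\<Sum>i\<le>2 * k. c p ^ i) * divisor_sum (m\<^sup>2)"
      using divisor_sum_prime_power[of p "m\<^sup>2" "2 * k"] p by simp
    moreover have "1 * 1 \<le> (\<Sum>i\<le>2 * k. c p ^ i) * divisor_sum (m\<^sup>2)"
      using less.IH[of m] p geometric_sum_sign(2)[where p = p and k = "2 * k"] by (intro mult_mono) auto
    ultimately show ?thesis by simp
  qed (use divisor_sum_1 in simp)
qed

text \<open>Both sides sum \<open>c k * t^(k j)\<close> over the pairs with
  \<open>k j \<le> X\<close>. Cutting at \<open>X\<close> keeps everything finite, so no double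
  series has to be rearranged.\<close>

lemma lambert_rearrangement:
  fixes t :: real
  shows "(\<Sum>n\<in>{1..X}. divisor_sum n * t ^ n) = (\<Sum>k\<in>{1..X}. c k * (\<Sum>j\<in>{1..X div k}. t ^ (k * j)))"
proof -
  have "(\<Sum>n\<in>{1..X}. divisor_sum n * t ^ n) = (\<Sum>(n, k)\<in>(SIGMA n:{1..X}. {d. d dvd n}). c k * t ^ n)"
    by (subst sum.Sigma[symmetric]) (auto simp: divisor_sum_def sum_distrib_right)
  also have "\<dots> = (\<Sum>(k, j)\<in>(SIGMA k:{1..X}. {1..X div k}). c k * t ^ (k * j))"
  proof (rule sum.reindex_bij_witness[of _ "\<lambda>(k, j). (k * j, k)" "\<lambda>(n, k). (k, n div k)"])
    fix x assume "x \<in> (SIGMA n:{1..X}. {d. d dvd n})"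
    then obtain n k where x: "x = (n, k)" "1 \<le> n" "n \<le> X" "k dvd n" by auto
    then obtain j where j: "n = k * j" by auto
    have "k \<le> n" using x dvd_imp_le[of k n] by simp
    then have "k \<le> X" using x by linarith
    moreover have "k > 0" "j > 0" using x j by (auto intro: Nat.gr0I)
    moreover have "j \<le> X div k" using x j \<open>k > 0\<close> by (simp add: less_eq_div_iff_mult_less_eq mult.commute)
    ultimately show "(case x of (n, k) \<Rightarrow> (k, n div k)) \<in> (SIGMA k:{1..X}. {1..X div k})"
      and "(case (case x of (n, k) \<Rightarrow> (k, n div k)) of (k, j) \<Rightarrow> (k * j, k)) = x"
      and "(case (case x of (n, k) \<Rightarrow> (k, n div k)) of (k, j) \<Rightarrow> c k * t ^ (k * j)) =
        (case x of (n, k) \<Rightarrow> c k * t ^ n)"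
      using x(1) j by auto
  next
    fix y assume "y \<in> (SIGMA k:{1..X}. {1..X div k})"
    then obtain k j where y: "y = (k, j)" "1 \<le> k" "1 \<le> j" "j \<le> X div k" by auto
    then show "(case (case y of (k, j) \<Rightarrow> (k * j, k)) of (n, k) \<Rightarrow> (k, n div k)) = y" by auto
    show "(case y of (k, j) \<Rightarrow> (k * j, k)) \<in> (SIGMA n:{1..X}. {d. d dvd n})"
      using y by (auto simp: less_eq_div_iff_mult_less_eq mult.commute Suc_le_eq)
  qed
  also have "\<dots> = (\<Sum>k\<in>{1..X}. c k * (\<Sum>j\<in>{1..X div k}. t ^ (k * j)))"
    by (subst sum.Sigma[symmetric]) (auto simp: sum_distrib_left)
  finally show ?thesis .
qed

text \<open>All terms are nonnegative, and the \<open>M\<close> squares up to the square of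
  \<open>M\<close> contribute at least the smallest power each.\<close>

lemma divisor_sum_series_ge:
  fixes t :: real
  assumes "0 < t" "t < 1" "X \<ge> M\<^sup>2"
  shows "real M * t ^ (M\<^sup>2) \<le> (\<Sum>n\<in>{1..X}. divisor_sum n * t ^ n)"
proof -
  have "real M * t ^ (M\<^sup>2) = (\<Sum>m\<in>{1..M}. 1 * t ^ (M\<^sup>2))" by simp
  also have "\<dots> \<le> (\<Sum>m\<in>{1..M}. divisor_sum (m\<^sup>2) * t ^ (m\<^sup>2))"
    using assms by (intro sum_mono mult_mono power_decreasing divisor_sum_square divisor_sum_nonneg power_mono) auto
  also have "\<dots> = (\<Sum>n\<in>(\<lambda>m. m\<^sup>2) ` {1..M}. divisor_sum n * t ^ n)"
    by (subst sum.reindex) (auto simp: inj_on_def)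
  also have "\<dots> \<le> (\<Sum>n\<in>{1..X}. divisor_sum n * t ^ n)"
  proof (rule sum_mono2)
    show "(\<lambda>m. m\<^sup>2) ` {1..M} \<subseteq> {1..X}"
      using assms(3) by (auto intro: order_trans[OF power_mono])
  qed (use assms divisor_sum_nonneg in auto)
  finally show ?thesis .
qed

text \<open>The geometric series belonging to \<open>k\<close> is cut after the exponent
  \<open>k (X div k)\<close>; its remainder starts at an exponent beyond \<open>X\<close>, so each
  of the \<open>X\<close> remainders is at most \<open>t^X/(1 - t)\<close>.\<close>

lemma lambert_truncation:
  fixes t :: real
  assumes t: "0 < t" "t < 1"
  shows "\<bar>(\<Sum>k\<in>{1..X}. c k * (t ^ k / (1 - t ^ k))) - (\<Sum>n\<in>{1..X}. divisor_sum n * t ^ n)\<bar>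
    \<le> real X * t ^ X / (1 - t)"
proof -
  have "\<bar>c k * (t ^ k / (1 - t ^ k)) - c k * (\<Sum>j\<in>{1..X div k}. t ^ (k * j))\<bar> \<le> t ^ X / (1 - t)"
    if "k \<in> {1..X}" for k
  proof -
    define u J where "u = t ^ k" and "J = X div k"
    have u: "0 < u" "u \<le> t" using that t power_decreasing[of 1 k t] by (auto simp: u_def)
    have "(\<Sum>j\<in>{1..J}. u ^ j) = u * (\<Sum>j<J. u ^ j)"
      by (simp add: sum_distrib_left sum.atLeast1_atMost_eq)
    then have "(1 - u) * (\<Sum>j\<in>{1..J}. u ^ j) = u * ((1 - u) * (\<Sum>j<J. u ^ j))"
      by (simp add: mult_ac)
    also have "(1 - u) * (\<Sum>j<J. u ^ j) = 1 - u ^ J" by (simp add: one_diff_power_eq)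
    finally have "u / (1 - u) - (\<Sum>j\<in>{1..J}. u ^ j) = u * u ^ J / (1 - u)"
      using u t by (simp add: field_simps)
    moreover have "\<dots> \<le> t ^ X / (1 - t)"
    proof (rule frac_le)
      have "X \<le> k + k * J"
        unfolding J_def using that mod_less_divisor[of k X] mult_div_mod_eq[of k X]
        by (metis add.commute add_le_mono1 atLeastAtMost_iff less_imp_le less_le_trans zero_less_one)
      then have "t ^ (k + k * J) \<le> t ^ X" using t by (intro power_decreasing) auto
      then show "u * u ^ J \<le> t ^ X" by (simp add: u_def power_add power_mult)
    qed (use u t in auto)
    moreover have "0 \<le> u * u ^ J / (1 - u)" using u t by simp
    ultimately have "\<bar>u / (1 - u) - (\<Sum>j\<in>{1..J}. u ^ j)\<bar> \<le> t ^ X / (1 - t)"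
      by (metis abs_of_nonneg)
    moreover have "\<bar>c k\<bar> \<le> 1" using c_values[of k] by auto
    ultimately have "\<bar>c k\<bar> * \<bar>u / (1 - u) - (\<Sum>j\<in>{1..J}. u ^ j)\<bar> \<le> 1 * (t ^ X / (1 - t))"
      by (intro mult_mono) auto
    then show ?thesis
      by (simp add: u_def J_def abs_mult[symmetric] right_diff_distrib power_mult)
  qed
  then have "\<bar>\<Sum>k\<in>{1..X}. c k * (t ^ k / (1 - t ^ k)) - c k * (\<Sum>j\<in>{1..X div k}. t ^ (k * j))\<bar>
      \<le> (\<Sum>k\<in>{1..X}. t ^ X / (1 - t))"
    by (intro order_trans[OF sum_abs] sum_mono)
  then show ?thesis unfolding lambert_rearrangement by (simp add: sum_subtractf)
qed

end

context nonprincipal_char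
begin

lemma L_nonzero_real:
  assumes "\<forall>a. coprime a N \<longrightarrow> (\<phi> a)\<^sup>2 = 1"
  shows "suminf L_coeff \<noteq> 0"
proof
  assume L: "suminf L_coeff = 0"
  define c where "c = (\<lambda>a. Re (\<phi> a))"
  have vals: "\<phi> a \<in> {-1, 0, 1}" for a
    using assms zero[of a] power2_eq_1_iff[of "\<phi> a"] by auto
  have c_of: "\<phi> a = of_real (c a)" for a
    using vals[of a] by (auto simp: c_def)
  interpret sign_function c
  proof
    fix a b
    show "c (a * b) = c a * c b" using mult[of a b] unfolding c_of by (metis of_real_eq_iff of_real_mult)
    show "c 1 = 1" using one by (simp add: c_def)
    show "c a \<in> {-1, 0, 1}" using vals[of a] by (auto simp: c_def)
  qed
  have main: "real M * t ^ (M\<^sup>2) \<le> 2 * real N" if s: "0 < s" "s < 1" "t = s\<^sup>2" for M s t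
  proof -
    have t: "0 < t" "t < 1" using s by (auto simp: power_less_one_iff)
    define b where "b = (\<lambda>k. lambert_weight t (Suc k))"
    have dec: "b (Suc k) \<le> b k" for k
      using lambert_weight_decreasing[of s "Suc k"] s by (simp add: b_def)
    have lim: "b \<longlonglongrightarrow> 0"
      unfolding b_def using lambert_weight_tendsto_0[OF t] by (rule LIMSEQ_Suc)
    have "b 0 = 1" using t by (simp add: b_def lambert_weight_def field_simps)
    have "norm (\<Sum>k. \<phi> (Suc k) * of_real (b k)) \<le> 2 * real N * b 0"
      using norm_partial_sum_Suc_le dec lim by (rule norm_suminf_mult_decreasing_le)
    then have bound: "norm (\<Sum>k. \<phi> (Suc k) * of_real (b k)) \<le> 2 * real N" by (simp add: \<open>b 0 = 1\<close>)
    have sm: "(\<lambda>k. \<phi> (Suc k) * of_real (b k)) sums (\<Sum>k. \<phi> (Suc k) * of_real (b k))"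
      using summable_mult_decreasing[OF norm_partial_sum_Suc_le dec lim] by (rule summable_sums)
    have "L_coeff sums 0" using summable_sums[OF summable_L_coeff] L by simp
    \<comment> \<open>This is where the vanishing of the series enters: the part of the weights that
      is singular as \<open>t\<close> tends to 1 is a multiple of \<open>L_coeff\<close> and sums to
      0.\<close>
    then have "(\<lambda>k. L_coeff k * of_real (1 / (1 - t)) - \<phi> (Suc k) * of_real (b k)) sums
        (0 * of_real (1 / (1 - t)) - (\<Sum>k. \<phi> (Suc k) * of_real (b k)))"
      by (intro sums_diff sums_mult2 sm)
    moreover have "L_coeff k * of_real (1 / (1 - t)) - \<phi> (Suc k) * of_real (b k) =
        of_real (c (Suc k) * (t ^ Suc k / (1 - t ^ Suc k)))" for k
      by (simp add: L_coeff_def b_def lambert_weight_def c_of right_diff_distrib del: of_nat_Suc)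
    ultimately have "(\<lambda>k. of_real (c (Suc k) * (t ^ Suc k / (1 - t ^ Suc k)))) sums
        (- (\<Sum>k. \<phi> (Suc k) * of_real (b k)))" by simp
    then have "(\<lambda>k. c (Suc k) * (t ^ Suc k / (1 - t ^ Suc k))) sums Re (- (\<Sum>k. \<phi> (Suc k) * of_real (b k)))"
      using sums_Re by fastforce
    then have "(\<lambda>X. \<Sum>k<X. c (Suc k) * (t ^ Suc k / (1 - t ^ Suc k))) \<longlonglongrightarrow>
        Re (- (\<Sum>k. \<phi> (Suc k) * of_real (b k)))" by (simp add: sums_def)
    then have lim1: "(\<lambda>X. \<Sum>k\<in>{1..X}. c k * (t ^ k / (1 - t ^ k))) \<longlonglongrightarrow>
        Re (- (\<Sum>k. \<phi> (Suc k) * of_real (b k)))"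
      by (simp only: sum.atLeast1_atMost_eq One_nat_def)
    have "(\<lambda>X. real X * t ^ X * (1 / (1 - t))) \<longlonglongrightarrow> 0 * (1 / (1 - t))"
      using t by (intro tendsto_intros powser_times_n_limit_0) auto
    then have "(\<lambda>X. real X * t ^ X / (1 - t)) \<longlonglongrightarrow> 0" by simp
    then have lim2: "(\<lambda>X. (\<Sum>k\<in>{1..X}. c k * (t ^ k / (1 - t ^ k))) - (\<Sum>n\<in>{1..X}. divisor_sum n * t ^ n)) \<longlonglongrightarrow> 0"
      by (rule Lim_null_comparison[rotated]) (use lambert_truncation[OF t] in auto)
    have "(\<lambda>X. (\<Sum>k\<in>{1..X}. c k * (t ^ k / (1 - t ^ k))) - ((\<Sum>k\<in>{1..X}. c k * (t ^ k / (1 - t ^ k)))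
        - (\<Sum>n\<in>{1..X}. divisor_sum n * t ^ n))) \<longlonglongrightarrow> Re (- (\<Sum>k. \<phi> (Suc k) * of_real (b k))) - 0"
      by (intro tendsto_diff lim1 lim2)
    then have "(\<lambda>X. \<Sum>n\<in>{1..X}. divisor_sum n * t ^ n) \<longlonglongrightarrow> Re (- (\<Sum>k. \<phi> (Suc k) * of_real (b k)))"
      by simp
    then have "real M * t ^ (M\<^sup>2) \<le> Re (- (\<Sum>k. \<phi> (Suc k) * of_real (b k)))"
      by (rule LIMSEQ_le_const) (use divisor_sum_series_ge[OF t, of M] in blast)
    also have "\<dots> \<le> norm (- (\<Sum>k. \<phi> (Suc k) * of_real (b k)))" by (rule complex_Re_le_cmod)
    also have "\<dots> \<le> 2 * real N" using bound by simp
    finally show ?thesis .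
  qed
  \<comment> \<open>In the limit \<open>t = 1\<close> the bound reads \<open>M \<le> 2 N\<close>,
    which this \<open>M\<close> violates. The shift by 2 keeps \<open>s = 1 - 1/(k + 2)\<close>
    strictly between 0 and 1 for all \<open>k\<close>.\<close>
  define M where "M = 2 * N + 1"
  have "(\<lambda>k. real M * ((1 - 1 / real (k + 2))\<^sup>2) ^ (M\<^sup>2)) \<longlonglongrightarrow> real M * ((1 - 0)\<^sup>2) ^ (M\<^sup>2)"
    by (intro tendsto_intros LIMSEQ_ignore_initial_segment lim_1_over_n)
  then have "real M * ((1 - 0)\<^sup>2) ^ (M\<^sup>2) \<le> 2 * real N"
    by (rule LIMSEQ_le_const2) (intro exI[of _ 0] allI impI main[OF _ _ refl], auto)
  then show False by (simp add: M_def)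
qed

theorem L_nonzero: "suminf L_coeff \<noteq> 0"
  using L_nonzero_real L_nonzero_complex by blast

end

section \<open>Translation-invariant relations\<close>

text \<open>Asking for the vanishing at all units \<open>s\<close> makes the space invariant under
  translation. The zero sum over a period keeps the principal character out of it.\<close>

definition L_kernel :: "nat \<Rightarrow> (nat \<Rightarrow> complex) \<Rightarrow> bool" where
  "L_kernel N K \<longleftrightarrow> (\<forall>a. K (a + N) = K a) \<and> (\<forall>a. \<not> coprime a N \<longrightarrow> K a = 0) \<and>
     (\<Sum>a<N. K a) = 0 \<and> (\<forall>s. coprime s N \<longrightarrow> (\<lambda>k. K (s * Suc k) / of_nat (Suc k)) sums 0)"

lemma L_kernel_translate:
  assumes K: "L_kernel N K" and h: "coprime h N" and N: "N > 0"
  shows "L_kernel N (\<lambda>a. K (h * a))"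
  unfolding L_kernel_def
proof (intro conjI allI impI)
  have per: "\<And>a. K (a + N) = K a" using K by (simp add: L_kernel_def)
  show "K (h * (a + N)) = K (h * a)" for a
    by (rule periodic_cong[of K N, OF per]) (simp add: cong_def algebra_simps)
  show "K (h * a) = 0" if "\<not> coprime a N" for a
    using K that by (simp add: L_kernel_def)
  show "(\<Sum>a<N. K (h * a)) = 0"
    using K sum_mult_reindex[OF N h, of K] per by (simp add: L_kernel_def)
  show "(\<lambda>k. K (h * (s * Suc k)) / of_nat (Suc k)) sums 0" if "coprime s N" for s
  proof -
    have "coprime (h * s) N" using that h by simp
    then have "(\<lambda>k. K (h * s * Suc k) / of_nat (Suc k)) sums 0" using K unfolding L_kernel_def by blast
    then show ?thesis by (simp only: mult.assoc)
  qed
qed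

lemma L_kernel_scale:
  assumes "L_kernel N K"
  shows "L_kernel N (\<lambda>a. x * K a)"
  unfolding L_kernel_def
proof (intro conjI allI impI)
  show "(\<Sum>a<N. x * K a) = 0"
    using assms by (simp add: L_kernel_def sum_distrib_left[symmetric])
  fix s assume "coprime s N"
  then have "(\<lambda>k. K (s * Suc k) / of_nat (Suc k)) sums 0" using assms unfolding L_kernel_def by blast
  then have "(\<lambda>k. x * (K (s * Suc k) / of_nat (Suc k))) sums (x * 0)" by (rule sums_mult)
  then show "(\<lambda>k. x * K (s * Suc k) / of_nat (Suc k)) sums 0" by (simp only: times_divide_eq_right mult_zero_right)
qed (use assms in \<open>simp_all add: L_kernel_def\<close>)

lemma L_kernel_zero: "L_kernel N (\<lambda>_. 0)"
  by (simp add: L_kernel_def)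

lemma L_kernel_add:
  assumes "L_kernel N K" "L_kernel N K'"
  shows "L_kernel N (\<lambda>a. K a + K' a)"
  unfolding L_kernel_def
proof (intro conjI allI impI)
  show "(\<Sum>a<N. K a + K' a) = 0"
    using assms by (simp add: L_kernel_def sum.distrib)
  fix s assume "coprime s N"
  then have "(\<lambda>k. K (s * Suc k) / of_nat (Suc k)) sums 0" "(\<lambda>k. K' (s * Suc k) / of_nat (Suc k)) sums 0"
    using assms unfolding L_kernel_def by blast+
  then have "(\<lambda>k. K (s * Suc k) / of_nat (Suc k) + K' (s * Suc k) / of_nat (Suc k)) sums (0 + 0)" by (rule sums_add)
  then show "(\<lambda>k. (K (s * Suc k) + K' (s * Suc k)) / of_nat (Suc k)) sums 0"
    by (simp only: add_divide_distrib add_0)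
qed (use assms in \<open>simp_all add: L_kernel_def\<close>)

lemma L_kernel_sum:
  assumes "finite I" "\<And>i. i \<in> I \<Longrightarrow> L_kernel N (F i)"
  shows "L_kernel N (\<lambda>a. \<Sum>i\<in>I. F i a)"
  using assms by (induction I rule: finite_induct) (auto intro: L_kernel_zero L_kernel_add)

lemma sum_root_powers:
  assumes "M > 0"
  shows "(\<Sum>j<M. cis (2 * pi / real M) ^ (j * i)) = (if M dvd i then of_nat M else 0)"
proof -
  define w where "w = cis (2 * pi / real M) ^ i"
  have one_iff: "w = 1 \<longleftrightarrow> M dvd i"
  proof -
    have "w = cis (2 * pi * real i / real M)" by (simp add: w_def Complex.DeMoivre mult.commute)
    then have "w = 1 \<longleftrightarrow> (\<exists>x::int. 2 * pi * real i / real M = 2 * real_of_int x * pi)"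
      by (simp add: cis_conv_exp exp_eq_1 )
    also have "\<dots> \<longleftrightarrow> (\<exists>x::int. real i = real_of_int x * real M)"
      using assms by (simp add: field_simps)
    also have "\<dots> \<longleftrightarrow> (\<exists>x::int. int i = x * int M)"
      by (metis of_int_eq_iff of_int_mult of_int_of_nat_eq)
    also have "\<dots> \<longleftrightarrow> M dvd i" by (metis dvd_def int_dvd_int_iff mult.commute)
    finally show ?thesis .
  qed
  have "cis (2 * pi / real M) ^ M = 1" using assms by (simp add: Complex.DeMoivre)
  then have wM: "w ^ M = 1" unfolding w_def by (metis mult.commute power_mult power_one)
  have "(\<Sum>j<M. cis (2 * pi / real M) ^ (j * i)) = (\<Sum>j<M. w ^ j)"
    by (simp add: w_def power_mult[symmetric] mult.commute)
  also have "\<dots> = (if M dvd i then of_nat M else 0)"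
    using wM one_iff by (auto simp: geometric_sum)
  finally show ?thesis .
qed

text \<open>Translation by \<open>h\<close> has finite order on the space \<open>L_kernel N\<close>, so some component of \<open>K\<close> under
  the discrete Fourier transform along the powers of \<open>h\<close> is a nonzero eigenvector.\<close>

lemma L_kernel_eigenvector_step:
  assumes K: "L_kernel N K" "K a0 \<noteq> 0" and h: "coprime h N" and N: "N > 1"
    and S: "\<And>g. g \<in> S \<Longrightarrow> \<exists>x. \<forall>a. K (g * a) = x * K a"
  shows "\<exists>K'. L_kernel N K' \<and> (\<exists>a. K' a \<noteq> 0) \<and> (\<forall>g\<in>insert h S. \<exists>x. \<forall>a. K' (g * a) = x * K' a)"
proof -
  define M where "M = totient N"
  have M: "M > 0" using N by (simp add: M_def)
  define w where "w = cis (2 * pi / real M)"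
  have w: "w \<noteq> 0" "w ^ M = 1" using M by (auto simp: w_def Complex.DeMoivre)
  have per: "\<And>a. K (a + N) = K a" using K by (simp add: L_kernel_def)
  have hM: "K (h ^ M * a) = K a" for a
    using euler_theorem[OF h] by (intro periodic_cong[of K N, OF per]) (metis M_def cong_scalar_right mult_1)
  \<comment> \<open>\<open>F j\<close> is the component of \<open>K\<close> on which translation by
    \<open>h\<close> acts as multiplication by the inverse of \<open>w ^ j\<close>. The components
    add up to \<open>M\<close> times \<open>K\<close>. Translations commute, so each component
    inherits the eigenvalues for \<open>S\<close>.\<close>
  define F where "F = (\<lambda>j a. \<Sum>i<M. w ^ (j * i) * K (h ^ i * a))"
  have "(\<Sum>j<M. F j a0) = (\<Sum>i<M. (\<Sum>j<M. w ^ (j * i)) * K (h ^ i * a0))"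
    unfolding F_def sum_distrib_right by (rule sum.swap)
  also have "\<dots> = (\<Sum>i<M. (if i = 0 then of_nat M else 0) * K (h ^ i * a0))"
    unfolding w_def by (intro sum.cong refl arg_cong2[where f = "(*)"], subst sum_root_powers[OF M])
      (auto dest: dvd_imp_le)
  also have "\<dots> = of_nat M * K a0" using M by (simp add: if_distrib sum.If_cases if_distribR)
  finally have "(\<Sum>j<M. F j a0) \<noteq> 0" using M K by simp
  then obtain j where j: "F j a0 \<noteq> 0" by (meson sum.neutral)
  have "L_kernel N (F j)" unfolding F_def
    using K h N by (intro L_kernel_sum L_kernel_scale L_kernel_translate) auto
  moreover have "\<exists>x. \<forall>a. F j (g * a) = x * F j a" if g: "g \<in> S" for g
  proof -
    obtain x where "\<And>a. K (g * a) = x * K a" using S[OF g] by blast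
    then have "K (h ^ i * (g * a)) = x * K (h ^ i * a)" for i a by (metis mult.left_commute)
    then have "F j (g * a) = x * F j a" for a
      by (simp add: F_def sum_distrib_left mult_ac)
    then show ?thesis by blast
  qed
  moreover have "F j (h * a) = inverse (w ^ j) * F j a" for a
  proof -
    have "w ^ j * F j (h * a) = (\<Sum>i<M. w ^ (j * Suc i) * K (h ^ Suc i * a))"
      by (simp add: F_def sum_distrib_left power_add mult_ac)
    also have "\<dots> = F j a"
    proof -
      have "(\<Sum>i<M. w ^ (j * Suc i) * K (h ^ Suc i * a)) + w ^ (j * 0) * K (h ^ 0 * a) =
          (\<Sum>i<Suc M. w ^ (j * i) * K (h ^ i * a))"
        by (subst sum.lessThan_Suc_shift) simp
      also have "\<dots> = F j a + w ^ (j * M) * K (h ^ M * a)" by (simp add: F_def)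
      also have "w ^ (j * M) = 1" by (metis w(2) mult.commute power_mult power_one)
      finally show ?thesis using hM[of a] by simp
    qed
    finally show ?thesis using w by (simp add: field_simps)
  qed
  ultimately show ?thesis using j by (intro exI[of _ "F j"]) auto
qed

lemma L_kernel_common_eigenvector:
  assumes K: "L_kernel N K" "K a0 \<noteq> 0" and N: "N > 1" and S: "finite S" "\<And>h. h \<in> S \<Longrightarrow> coprime h N"
  shows "\<exists>K'. L_kernel N K' \<and> (\<exists>a. K' a \<noteq> 0) \<and> (\<forall>g\<in>S. \<exists>x. \<forall>a. K' (g * a) = x * K' a)"
  using S
proof (induction S rule: finite_induct)
  case empty
  then show ?case using K by auto
next
  case (insert h S)
  then obtain K' a where "L_kernel N K'" "K' a \<noteq> 0" "\<And>g. g \<in> S \<Longrightarrow> \<exists>x. \<forall>a. K' (g * a) = x * K' a"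
    by auto
  then show ?case using L_kernel_eigenvector_step[of N K' a h S] N insert.prems by auto
qed

theorem L_kernel_trivial:
  assumes K: "L_kernel N K" and N: "N > 1"
  shows "K a = 0"
proof (rule ccontr)
  assume "K a \<noteq> 0"
  then have "\<exists>K'. L_kernel N K' \<and> (\<exists>a. K' a \<noteq> 0) \<and>
      (\<forall>g\<in>{g. g < N \<and> coprime g N}. \<exists>x. \<forall>a. K' (g * a) = x * K' a)"
    by (intro L_kernel_common_eigenvector[OF K _ N]) auto
  then obtain E a0 where E: "L_kernel N E" "E a0 \<noteq> 0"
    and eig: "\<And>g. g < N \<Longrightarrow> coprime g N \<Longrightarrow> \<exists>x. \<forall>a. E (g * a) = x * E a"
    by blast
  have per: "\<And>a. E (a + N) = E a" and supp: "\<And>a. \<not> coprime a N \<Longrightarrow> E a = 0"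
    using E(1) by (auto simp: L_kernel_def)
  have "coprime a0 N" using supp E(2) by blast
  have eig': "\<exists>x. \<forall>a. E (g * a) = x * E a" if "coprime g N" for g
  proof -
    have "\<exists>x. \<forall>a. E (g mod N * a) = x * E a"
      using that N by (intro eig) auto
    then obtain x where x: "\<And>a. E (g mod N * a) = x * E a" by blast
    have "E (g * a) = E (g mod N * a)" for a
      by (rule periodic_cong[of E N, OF per]) (simp add: cong_def mod_mult_left_eq)
    then show ?thesis using x by auto
  qed
  have E1: "E 1 \<noteq> 0" using eig'[OF \<open>coprime a0 N\<close>] E(2) by (metis mult.right_neutral mult_zero_right)
  \<comment> \<open>The eigenvalue of translation by a unit \<open>a\<close> is
    \<open>E a / E 1\<close>, so normalising at 1 yields a multiplicative function.\<close>
  define \<phi> where "\<phi> = (\<lambda>a. E a / E 1)"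
  have mult: "\<phi> (a * b) = \<phi> a * \<phi> b" for a b
  proof (cases "coprime a N")
    case True
    then obtain x where x: "\<And>b. E (a * b) = x * E b" using eig' by blast
    have "E a = x * E 1" using x[of 1] by simp
    then show ?thesis using x[of b] E1 by (simp add: \<phi>_def)
  next
    case False
    then show ?thesis using supp[of a] supp[of "a * b"] by (simp add: \<phi>_def)
  qed
  have sum0: "(\<Sum>a<N. \<phi> a) = 0"
    using E(1) by (simp add: \<phi>_def L_kernel_def sum_divide_distrib[symmetric])
  \<comment> \<open>The principal character sums to the number of units, not to 0.\<close>
  have "\<exists>a. coprime a N \<and> \<phi> a \<noteq> 1"
  proof (rule ccontr)
    assume neg: "\<not> ?thesis"
    have "(\<Sum>a<N. \<phi> a) = (\<Sum>a | a < N \<and> coprime a N. \<phi> a)"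
      using supp by (intro sum.mono_neutral_right) (auto simp: \<phi>_def)
    also have "\<dots> = (\<Sum>a | a < N \<and> coprime a N. 1)" using neg by (intro sum.cong) auto
    also have "\<dots> = of_nat (card {a. a < N \<and> coprime a N})" by simp
    finally have "card {a. a < N \<and> coprime a N} = 0" using sum0 by simp
    moreover have "1 \<in> {a. a < N \<and> coprime a N}" using N by simp
    ultimately show False by (auto simp: card_eq_0_iff)
  qed
  then interpret nonprincipal_char N \<phi>
  proof unfold_locales
    show "N > 1" by (fact N)
    show "\<phi> (a * b) = \<phi> a * \<phi> b" for a b by (fact mult)
    show "\<phi> 1 = 1" using E1 by (simp add: \<phi>_def)
    show "\<phi> (a + N) = \<phi> a" for a by (simp add: \<phi>_def per)
    show "\<phi> a = 0" if "\<not> coprime a N" for a using supp[OF that] by (simp add: \<phi>_def)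
  qed
  have "(\<lambda>k. E (1 * Suc k) / of_nat (Suc k)) sums 0" 
    using E(1) coprime_1_left unfolding L_kernel_def by blast
  then have "(\<lambda>k. E (1 * Suc k) / of_nat (Suc k) / E 1) sums (0 / E 1)" by (rule sums_divide)
  moreover have "L_coeff = (\<lambda>k. E (1 * Suc k) / of_nat (Suc k) / E 1)"
    unfolding L_coeff_def[abs_def] by (simp add: \<phi>_def mult.commute del: of_nat_Suc)
  ultimately have "L_coeff sums 0" by (simp only: div_0)
  then show False using L_nonzero by (simp add: sums_iff)
qed

section \<open>Logarithms of cyclotomic numbers\<close>

lemma norm_sum_powers_le:
  fixes z :: complex
  assumes "norm z = 1" "z \<noteq> 1"
  shows "norm (\<Sum>k<m. z ^ Suc k) \<le> 2 / norm (1 - z)"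
proof -
  have "(\<Sum>k<m. z ^ Suc k) = z * ((1 - z ^ m) / (1 - z))"
    using assms(2) by (simp add: sum_distrib_left[symmetric] sum_gp_strict)
  then have "norm (\<Sum>k<m. z ^ Suc k) = norm (1 - z ^ m) / norm (1 - z)"
    using assms by (simp add: norm_mult norm_divide)
  also have "\<dots> \<le> 2 / norm (1 - z)"
    using norm_triangle_ineq4[of 1 "z ^ m"] assms by (intro divide_right_mono) (auto simp: norm_power)
  finally show ?thesis .
qed

text \<open>Abel's limit argument on the radius from 0 to \<open>z\<close>. Dirichlet's test is
  uniform in \<open>r\<close>, so the sum is continuous on the closed segment; it agrees with
  \<open>- Ln (1 - r z)\<close> for \<open>r < 1\<close>, and \<open>1 - r z\<close> avoids the
  branch cut up to and including \<open>r = 1\<close>.\<close>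

lemma log_series_unit_circle:
  fixes z :: complex
  assumes z: "norm z = 1" "z \<noteq> 1"
  shows "(\<lambda>k. z ^ Suc k / of_nat (Suc k)) sums (- Ln (1 - z))"
proof -
  define B where "B = 2 / norm (1 - z)"
  define b :: "real \<Rightarrow> nat \<Rightarrow> real" where "b = (\<lambda>r k. r ^ Suc k / real (Suc k))"
  define f where "f = (\<lambda>r. \<Sum>k. z ^ Suc k * of_real (b r k))"
  have dec: "b r (Suc k) \<le> b r k" if "r \<in> {0..1}" for r k
    unfolding b_def using that by (intro frac_le power_decreasing) auto
  have b_le: "0 \<le> b r k" "b r k \<le> 1 / real (Suc k)" if "r \<in> {0..1}" for r k
    unfolding b_def using that 
    by (auto intro!: divide_right_mono power_le_one simp del: power_Suc)
  have lim: "b r \<longlonglongrightarrow> 0" if "r \<in> {0..1}" for r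
    by (rule tendsto_sandwich[OF _ _ tendsto_const LIMSEQ_Suc[OF lim_1_over_n]])
      (use b_le[OF that] in auto)
  have sm: "summable (\<lambda>k. z ^ Suc k * of_real (b r k))" if "r \<in> {0..1}" for r
    using norm_sum_powers_le[OF z] dec[OF that] lim[OF that] by (rule summable_mult_decreasing)
  have tail: "norm (f r - (\<Sum>k<m. z ^ Suc k * of_real (b r k))) \<le> B * (1 / real (Suc m))"
    if r: "r \<in> {0..1}" for r m
  proof -
    have "f r - (\<Sum>k<m. z ^ Suc k * of_real (b r k)) = (\<Sum>k. z ^ Suc (k + m) * of_real (b r (k + m)))"
      using suminf_split_initial_segment[OF sm[OF r], of m] by (simp add: f_def)
    also have "(\<lambda>k. z ^ Suc (k + m) * of_real (b r (k + m))) = (\<lambda>k. z ^ m * z ^ Suc k * of_real (b r (k + m)))"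
      by (simp add: power_add fun_eq_iff mult_ac)
    also have "norm (\<Sum>k. z ^ m * z ^ Suc k * of_real (b r (k + m))) \<le> B * b r (0 + m)"
    proof (rule norm_suminf_mult_decreasing_le)
      show "norm (\<Sum>k<j. z ^ m * z ^ Suc k) \<le> B" for j
        using norm_sum_powers_le[OF z, of j] z
        unfolding sum_distrib_left[symmetric] norm_mult B_def by (simp add: norm_power)
      show "(\<lambda>k. b r (k + m)) \<longlonglongrightarrow> 0" by (rule LIMSEQ_ignore_initial_segment) (rule lim[OF r])
    qed (use dec[OF r] in simp)
    also have "\<dots> \<le> B * (1 / real (Suc m))"
      using b_le(2)[OF r, of m] by (intro mult_left_mono) (auto simp: B_def)
    finally show ?thesis .
  qed
  have unif: "uniform_limit {0..1} (\<lambda>m r. \<Sum>k<m. z ^ Suc k * of_real (b r k)) f sequentially"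
  proof (rule uniform_limitI)
    fix e :: real assume e: "e > 0"
    have "(\<lambda>m. B * (1 / real (Suc m))) \<longlonglongrightarrow> B * 0"
      by (intro tendsto_intros LIMSEQ_Suc lim_1_over_n)
    then have "\<forall>\<^sub>F m in sequentially. B * (1 / real (Suc m)) < e"
      using e by (intro order_tendstoD(2)) auto
    then show "\<forall>\<^sub>F m in sequentially. \<forall>r\<in>{0..1}. dist (\<Sum>k<m. z ^ Suc k * of_real (b r k)) (f r) < e"
    proof eventually_elim
      case (elim m)
      show ?case
      proof
        fix r :: real assume "r \<in> {0..1}"
        then show "dist (\<Sum>k<m. z ^ Suc k * of_real (b r k)) (f r) < e"
          using tail[of r m] elim by (simp add: dist_norm norm_minus_commute)
      qed
    qed
  qed
  have cont_f: "continuous_on {0..1} f"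
    by (rule uniform_limit_theorem[OF _ unif])
      (auto simp: b_def simp del: of_nat_Suc intro!: always_eventually continuous_intros)
  have f_eq: "f r = - Ln (1 - of_real r * z)" if r: "r \<in> {0..<1}" for r
  proof -
    have "norm (- (of_real r * z)) < 1" using r z by (simp add: norm_mult)
    from Ln_series'[OF this]
    have "(\<lambda>k. - ((of_real r * z) ^ k) / of_nat k) sums Ln (1 - of_real r * z)" by simp
    then have "(\<lambda>k. - ((of_real r * z) ^ Suc k) / of_nat (Suc k)) sums Ln (1 - of_real r * z)"
      by (subst sums_Suc_iff) simp
    then have "(\<lambda>k. - (- ((of_real r * z) ^ Suc k) / of_nat (Suc k))) sums - Ln (1 - of_real r * z)"
      by (rule sums_minus)
    then have "(\<lambda>k. z ^ Suc k * of_real (b r k)) sums - Ln (1 - of_real r * z)"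
      by (simp add: b_def power_mult_distrib mult_ac del: of_nat_Suc power_Suc)
    then show ?thesis by (simp add: f_def sums_iff)
  qed
  have cont_ln: "continuous_on {0..1} (\<lambda>r. - Ln (1 - of_real r * z))"
  proof (intro continuous_intros)
    fix r :: real assume r: "r \<in> {0..1}"
    show "1 - of_real r * z \<notin> \<real>\<^sub>\<le>\<^sub>0"
    proof
      assume "1 - of_real r * z \<in> \<real>\<^sub>\<le>\<^sub>0"
      then have "Im (of_real r * z) = 0" and ge: "1 \<le> r * Re z"
        by (auto simp: complex_nonpos_Reals_iff)
      have "Re z \<le> 1" using complex_Re_le_cmod[of z] z by simp
      moreover have "Re z > 0" using ge r by (metis atLeastAtMost_iff mult_nonneg_nonpos not_le not_one_le_zero order_trans)
      then have "r * Re z \<le> 1 * Re z" using r by (intro mult_right_mono) auto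
      ultimately have "Re z = 1" using ge by simp
      then show False using z by (simp add: complex_eq_iff cmod_def)
    qed
  qed
  have "closed {r \<in> {0..1}. f r - (- Ln (1 - of_real r * z)) = 0}"
    by (intro continuous_closed_preimage_constant continuous_on_diff cont_f cont_ln) simp
  moreover have "{0..<1} \<subseteq> {r \<in> {0..1}. f r - (- Ln (1 - of_real r * z)) = 0}"
    using f_eq by auto
  ultimately have "closure {0..<1} \<subseteq> {r \<in> {0..1}. f r - (- Ln (1 - of_real r * z)) = 0}"
    by (rule closure_minimal[rotated])
  moreover have "(1::real) \<in> closure {0..<1}" by simp
  ultimately have "f 1 - (- Ln (1 - of_real 1 * z)) = 0" by blast
  then have "f 1 = - Ln (1 - z)" by (simp add: eq_neg_iff_add_eq_0)
  then show ?thesis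
    using summable_sums[OF sm[of 1]] by (simp add: f_def b_def del: of_nat_Suc power_Suc)
qed

section \<open>The finite Fourier transform of a relation between logarithms\<close>

definition unit_root :: "nat \<Rightarrow> complex" where
  "unit_root n = cis (2 * pi / real n)"

lemma unit_root_power_self: "n > 0 \<Longrightarrow> unit_root n ^ n = 1"
  by (simp add: unit_root_def Complex.DeMoivre)

lemma norm_unit_root [simp]: "norm (unit_root n) = 1"
  by (simp add: unit_root_def)

lemma unit_root_power_cong:
  assumes "n > 0" "[a = b] (mod n)"
  shows "unit_root n ^ a = unit_root n ^ b"
proof -
  have "unit_root n ^ (a + n) = unit_root n ^ a" for a
    using unit_root_power_self[OF assms(1)] by (simp add: power_add)
  then show ?thesis using assms(2) by (rule periodic_cong[of "\<lambda>a. unit_root n ^ a"])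
qed

lemma unit_root_power_eq_1_iff:
  assumes "n > 0"
  shows "unit_root n ^ a = 1 \<longleftrightarrow> n dvd a"
proof
  assume 1: "unit_root n ^ a = 1"
  have "(\<Sum>j<n. unit_root n ^ (j * a)) = (\<Sum>j<n. 1)"
    using 1 by (intro sum.cong refl) (metis mult.commute power_mult power_one)
  then have "(if n dvd a then of_nat n else 0 :: complex) = of_nat n"
    using sum_root_powers[OF assms, of a] by (simp add: unit_root_def)
  then show "n dvd a" using assms by (auto split: if_splits)
next
  assume "n dvd a"
  then show "unit_root n ^ a = 1"
    using unit_root_power_self[OF assms] by (auto simp: power_mult)
qed

lemma unit_root_power_eq_iff:
  assumes "N > 0"
  shows "unit_root N ^ a = unit_root N ^ b \<longleftrightarrow> [a = b] (mod N)"
proof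
  assume "unit_root N ^ a = unit_root N ^ b"
  then have "unit_root N ^ (a + (N - 1) * b) = unit_root N ^ (b + (N - 1) * b)" by (simp add: power_add)
  also have "b + (N - 1) * b = N * b" using assms by (cases N) auto
  also have "unit_root N ^ (N * b) = 1" using unit_root_power_self[OF assms] by (simp add: power_mult)
  finally have "N dvd a + (N - 1) * b" using unit_root_power_eq_1_iff[OF assms] by blast
  then have "[a + (N - 1) * b = b + (N - 1) * b] (mod N)"
    unfolding \<open>b + (N - 1) * b = N * b\<close> by (simp add: cong_def dvd_eq_mod_eq_0)
  then show "[a = b] (mod N)" using cong_add_rcancel_nat by blast
qed (rule unit_root_power_cong[OF assms])

text \<open>Residues are natural numbers, so multiplication by \<open>n - 1\<close> plays the role
  of negation.\<close>

locale log_relation =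
  fixes n :: nat and c :: "nat \<Rightarrow> real"
  assumes n: "n > 1"
    and periodic: "\<And>a. c (a + n) = c a"
    and supp: "\<And>a. \<not> coprime a n \<Longrightarrow> c a = 0"
    and even: "\<And>a. c ((n - 1) * a) = c a"
    and log_sum: "\<And>s. coprime s n \<Longrightarrow> (\<Sum>a<n. c a * ln (norm (1 - unit_root n ^ (a * s)))) = 0"
begin

definition transform :: "nat \<Rightarrow> complex" where
  "transform l = (\<Sum>a<n. of_real (c a) * unit_root n ^ (a * l))"

lemma transform_cong: "[l = l'] (mod n) \<Longrightarrow> transform l = transform l'"
  unfolding transform_def using n
  by (intro sum.cong refl arg_cong2[where f = "(*)"] unit_root_power_cong cong_mult) auto

lemma transform_reindex:
  assumes "coprime h n"
  shows "(\<Sum>a<n. of_real (c (h * a)) * unit_root n ^ (h * a * l)) = transform l"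
proof -
  have "of_real (c (a + n)) * unit_root n ^ ((a + n) * l) = of_real (c a) * unit_root n ^ (a * l)" for a
    using n unit_root_power_cong[of n "(a + n) * l" "a * l"] by (simp add: periodic cong_def algebra_simps)
  then show ?thesis
    using sum_mult_reindex[of n h "\<lambda>a. of_real (c a) * unit_root n ^ (a * l)"] n assms
    by (simp add: transform_def)
qed

text \<open>Replacing \<open>a\<close> by its negative conjugates the roots of unity and leaves the
  even function \<open>c\<close> unchanged.\<close>

lemma cnj_transform: "cnj (transform l) = transform l"
proof -
  have cop: "coprime (n - 1) n" using n by (metis coprime_diff_one_left_nat zero_less_one less_trans)
  have conj: "unit_root n ^ ((n - 1) * a * l) = cnj (unit_root n ^ (a * l))" for a
  proof -
    have "unit_root n ^ ((n - 1) * a * l) * unit_root n ^ (a * l) = unit_root n ^ (n * (a * l))"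
      using n by (simp add: power_add[symmetric] algebra_simps diff_mult_distrib)
    also have "\<dots> = 1" using n unit_root_power_self[of n] by (simp add: power_mult)
    finally have "unit_root n ^ ((n - 1) * a * l) * unit_root n ^ (a * l) = 1" .
    moreover have "cnj (unit_root n ^ (a * l)) * unit_root n ^ (a * l) = 1"
      using complex_norm_square[of "unit_root n ^ (a * l)"] by (simp add: norm_power mult.commute)
    ultimately show ?thesis by (metis mult_cancel_right zero_neq_one mult_zero_right)
  qed
  have "transform l = (\<Sum>a<n. of_real (c a) * unit_root n ^ ((n - 1) * a * l))"
    using transform_reindex[OF cop, of l] by (simp only: even)
  also have "\<dots> = cnj (transform l)" unfolding conj by (simp add: transform_def)
  finally show ?thesis by simp
qed

lemma transform_inverse:
  assumes "g < n"
  shows "(\<Sum>l<n. transform l * unit_root n ^ (l * (n - g))) = of_nat n * of_real (c g)"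
proof -
  have "(\<Sum>l<n. transform l * unit_root n ^ (l * (n - g))) =
      (\<Sum>a<n. of_real (c a) * (\<Sum>l<n. unit_root n ^ (l * (a + (n - g)))))"
    unfolding transform_def sum_distrib_right sum_distrib_left
    by (subst sum.swap) (simp add: power_add algebra_simps)
  also have "\<dots> = (\<Sum>a<n. of_real (c a) * (if a = g then of_nat n else 0))"
  proof (intro sum.cong refl arg_cong2[where f = "(*)"])
    fix a assume "a \<in> {..<n}"
    then have a: "a < n" by simp
    have "n dvd a + (n - g) \<longleftrightarrow> a = g"
    proof
      assume "n dvd a + (n - g)"
      then obtain k where k: "a + (n - g) = n * k" by blast
      have "0 < n * k" "n * k < n * 2" using a assms by (simp_all add: k[symmetric])
      then have "k = 1" using mult_less_cancel1[of n k 2] by (cases k) auto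
      then show "a = g" using k assms by simp
    qed (use assms in simp)
    then show "(\<Sum>l<n. unit_root n ^ (l * (a + (n - g)))) = (if a = g then of_nat n else 0)"
      using sum_root_powers[of n "a + (n - g)"] n by (simp add: unit_root_def)
  qed
  also have "\<dots> = of_nat n * of_real (c g)" using assms by (simp add: if_distrib sum.If_cases)
  finally show ?thesis .
qed

text \<open>Fourier inversion at 0, where \<open>c\<close> vanishes because 0 is not a unit.\<close>

lemma sum_transform: "(\<Sum>l<n. transform l) = 0"
proof -
  have "(\<Sum>l<n. transform l) = (\<Sum>l<n. transform l * unit_root n ^ (l * (n - 0)))"
  proof (intro sum.cong refl)
    fix l
    have "unit_root n ^ (l * (n - 0)) = 1" using n unit_root_power_eq_1_iff[of n "l * n"] by simp
    then show "transform l = transform l * unit_root n ^ (l * (n - 0))" by simp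
  qed
  also have "\<dots> = 0" using transform_inverse[of 0] n supp[of 0] by simp
  finally show ?thesis .
qed

lemma not_dvd_coprime: "coprime k n \<Longrightarrow> \<not> n dvd k"
  using n by (auto simp: coprime_absorb_right)

text \<open>Summing the logarithm series over \<open>a\<close> identifies the sum as a combination
  of \<open>- Ln (1 - unit_root n ^ (a * s))\<close>. Its real part is the given relation; its
  imaginary part is 0 because \<open>transform\<close> is real.\<close>

lemma transform_L_zero:
  assumes s: "coprime s n"
  shows "(\<lambda>k. transform (s * Suc k) / of_nat (Suc k)) sums 0"
proof -
  define T where "T = (\<Sum>a<n. of_real (c a) * (- Ln (1 - unit_root n ^ (a * s))))"
  have term_sums: "(\<lambda>k. of_real (c a) * ((unit_root n ^ (a * s)) ^ Suc k / of_nat (Suc k))) sums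
      (of_real (c a) * (- Ln (1 - unit_root n ^ (a * s))))" for a
  proof (cases "coprime a n")
    case True
    then have "\<not> n dvd a * s" using s by (intro not_dvd_coprime) simp
    then have "unit_root n ^ (a * s) \<noteq> 1" using unit_root_power_eq_1_iff n by simp
    then show ?thesis by (intro sums_mult log_series_unit_circle) (simp_all add: norm_power)
  qed (simp add: supp)
  have "(\<lambda>k. \<Sum>a<n. of_real (c a) * ((unit_root n ^ (a * s)) ^ Suc k / of_nat (Suc k))) sums T"
    unfolding T_def by (intro sums_sum term_sums)
  then have T: "(\<lambda>k. transform (s * Suc k) / of_nat (Suc k)) sums T"
    unfolding transform_def sum_divide_distrib power_mult[symmetric] mult.assoc times_divide_eq_right .
  have "Re T = - (\<Sum>a<n. c a * ln (norm (1 - unit_root n ^ (a * s))))"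
  proof -
    have eq: "c a * Re (- Ln (1 - unit_root n ^ (a * s))) = - (c a * ln (norm (1 - unit_root n ^ (a * s))))" if "a < n" for a
    proof (cases "coprime a n")
      case True
      then have "\<not> n dvd a * s" using s by (intro not_dvd_coprime) simp
      then have "unit_root n ^ (a * s) \<noteq> 1" using unit_root_power_eq_1_iff n by simp
      then show ?thesis by simp
    qed (simp add: supp)
    have "Re T = (\<Sum>a<n. c a * Re (- Ln (1 - unit_root n ^ (a * s))))" by (simp add: T_def)
    also have "\<dots> = (\<Sum>a<n. - (c a * ln (norm (1 - unit_root n ^ (a * s)))))"
      by (intro sum.cong refl eq) simp
    finally show ?thesis by (simp only: sum_negf)
  qed
  then have "Re T = 0" using log_sum[OF s] by simp
  moreover have "(\<lambda>k. cnj (transform (s * Suc k) / of_nat (Suc k))) sums cnj T"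
    using T by (simp only: sums_cnj)
  then have "(\<lambda>k. transform (s * Suc k) / of_nat (Suc k)) sums cnj T"
    by (simp add: cnj_transform del: of_nat_Suc)
  then have "cnj T = T" using T sums_unique2 by blast
  then have "Im T = 0" by (simp add: complex_eq_iff)
  ultimately have "T = 0" by (simp add: complex_eq_iff)
  then show ?thesis using T by simp
qed

text \<open>The hypothesis confines \<open>transform\<close> to the units, the one clause of
  \<open>L_kernel\<close> that an arbitrary \<open>log_relation\<close> does not provide.\<close>

lemma coefficients_zero:
  assumes "\<And>q l. prime q \<Longrightarrow> q dvd n \<Longrightarrow> q dvd l \<Longrightarrow> transform l = 0"
  shows "c g = 0"
proof -
  have "transform l = 0" if "\<not> coprime l n" for l
  proof -
    have "gcd l n \<noteq> 1" using that coprime_iff_gcd_eq_1 by blast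
    then obtain q where "prime q" "q dvd gcd l n" using prime_factor_nat by blast
    then show ?thesis using assms by auto
  qed
  moreover have "transform (l + n) = transform l" for l
    by (rule transform_cong) (simp add: cong_def)
  ultimately have "L_kernel n transform"
    unfolding L_kernel_def using sum_transform transform_L_zero by blast
  then have "transform l = 0" for l using L_kernel_trivial n by blast
  then have "of_nat n * of_real (c (g mod n)) = (0::complex)"
    using transform_inverse[of "g mod n"] n by simp
  then have "c (g mod n) = 0" using n by simp
  then show ?thesis using periodic_mod_eq[of c n g, OF periodic] by simp
qed

text \<open>The relation of the translate at \<open>s\<close> is the relation of \<open>c\<close> at
  \<open>h' * s\<close>, with \<open>h'\<close> inverse to \<open>h\<close>; it is available because
  relations are assumed at every unit.\<close>

lemma difference_log_relation:
  assumes h: "coprime h n"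
  shows "log_relation n (\<lambda>a. c a - c (h * a))"
proof
  show "n > 1" by (fact n)
  show "c (a + n) - c (h * (a + n)) = c a - c (h * a)" for a
    using periodic_cong[of c n "h * (a + n)" "h * a", OF periodic] by (simp add: periodic cong_def algebra_simps)
  show "c a - c (h * a) = 0" if "\<not> coprime a n" for a using that supp by simp
  show "c ((n - 1) * a) - c (h * ((n - 1) * a)) = c a - c (h * a)" for a
    using even[of a] even[of "h * a"] by (simp add: mult.left_commute)
  fix s assume s: "coprime s n"
  obtain h' where h': "[h * h' = 1] (mod n)" using cong_solve_coprime_nat[OF h] by auto
  then have cop: "coprime h' n" by (metis cong_imp_coprime cong_sym coprime_1_left coprime_mult_left_iff)
  define f where "f = (\<lambda>b. c b * ln (norm (1 - unit_root n ^ (b * (h' * s)))))"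
  have "(\<Sum>a<n. c (h * a) * ln (norm (1 - unit_root n ^ (a * s)))) = (\<Sum>a<n. f (h * a))"
  proof (intro sum.cong refl)
    fix a
    have "[h * h' * (a * s) = 1 * (a * s)] (mod n)" using h' by (rule cong_scalar_right)
    then have "unit_root n ^ (h * a * (h' * s)) = unit_root n ^ (a * s)"
      using n by (intro unit_root_power_cong) (auto simp: mult_ac)
    then show "c (h * a) * ln (norm (1 - unit_root n ^ (a * s))) = f (h * a)" by (simp add: f_def)
  qed
  also have "\<dots> = (\<Sum>a<n. f a)"
  proof (rule sum_mult_reindex[OF _ h])
    fix a
    have "unit_root n ^ ((a + n) * (h' * s)) = unit_root n ^ (a * (h' * s))"
      using n by (intro unit_root_power_cong cong_scalar_right) (auto simp: cong_def)
    then show "f (a + n) = f a" by (simp add: f_def periodic)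
  qed (use n in simp)
  also have "\<dots> = 0" using log_sum[of "h' * s"] cop s by (simp add: f_def)
  finally show "(\<Sum>a<n. (c a - c (h * a)) * ln (norm (1 - unit_root n ^ (a * s)))) = 0"
    using log_sum[OF s] by (simp add: left_diff_distrib sum_subtractf)
qed

lemma transform_difference:
  assumes h: "coprime h n" "[h * h' = 1] (mod n)"
  shows "log_relation.transform n (\<lambda>a. c a - c (h * a)) l = transform l - transform (h' * l)"
proof -
  interpret diff: log_relation n "\<lambda>a. c a - c (h * a)" using h(1) by (rule difference_log_relation)
  have "(\<Sum>a<n. of_real (c (h * a)) * unit_root n ^ (a * l)) =
      (\<Sum>a<n. of_real (c (h * a)) * unit_root n ^ (h * a * (h' * l)))"
  proof (intro sum.cong refl)
    fix a
    have "[h * h' * (a * l) = 1 * (a * l)] (mod n)" using h(2) by (rule cong_scalar_right)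
    then have "unit_root n ^ (h * a * (h' * l)) = unit_root n ^ (a * l)"
      using n by (intro unit_root_power_cong) (auto simp: mult_ac)
    then show "of_real (c (h * a)) * unit_root n ^ (a * l) =
        of_real (c (h * a)) * unit_root n ^ (h * a * (h' * l))" by simp
  qed
  then show ?thesis
    using transform_reindex[OF h(1), of "h' * l"]
    by (simp add: diff.transform_def transform_def left_diff_distrib sum_subtractf)
qed

end

section \<open>Confining the transform to the units without losing a given coefficient\<close>

lemma inj_residue_shift:
  fixes m q r g :: nat
  assumes "m > 0" "coprime q r" "coprime g q" "q > 0"
  shows "inj_on (\<lambda>k. (1 + m * r * k) * g mod (m * q)) {..<q}"
proof (rule inj_onI)
  fix k k' assume k: "k \<in> {..<q}" "k' \<in> {..<q}"
    and "(1 + m * r * k) * g mod (m * q) = (1 + m * r * k') * g mod (m * q)"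
  then have "[(1 + m * r * k) * g = (1 + m * r * k') * g] (mod (m * q))" by (simp add: cong_def)
  then have "[g + m * (r * k * g) = g + m * (r * k' * g)] (mod (m * q))" by (simp add: algebra_simps)
  then have "[m * (r * k * g) = m * (r * k' * g)] (mod (m * q))" using cong_add_lcancel_nat by blast
  then have "[r * k * g = r * k' * g] (mod q)" using assms(1) by (simp add: cong_def mult.assoc)
  then have "[k * (r * g) = k' * (r * g)] (mod q)" by (simp add: mult_ac)
  moreover have "coprime (r * g) q" using assms by (simp add: coprime_commute)
  ultimately have "[k = k'] (mod q)" using cong_mult_rcancel_nat by blast
  then show "k = k'" using k by (simp add: cong_def)
qed

lemma cong_1_add_mult: "[1 + m * k = 1] (mod m)" for m k :: nat
  unfolding cong_def by (rule mod_mult_self2)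

context log_relation
begin

text \<open>The multipliers \<open>1 + m r k\<close> with \<open>k < q\<close> send \<open>g\<close> to pairwise distinct classes modulo \<open>m q\<close>, and
  at most one of them is not a unit modulo \<open>n\<close>; so one of at least six misses the at most five classes that
  the support of \<open>c\<close> meets.\<close>

lemma exists_avoiding_multiplier:
  assumes q: "prime q" "q > 5" and r: "coprime q r" and mqr: "m * q * r = n"
    and g: "coprime g n" "c g \<noteq> 0"
    and card: "card {a. a < n \<and> c a \<noteq> 0 \<and> [a = g] (mod m)} \<le> 5"
  shows "\<exists>h. coprime h n \<and> [h = 1] (mod (m * r)) \<and> (\<forall>a. [a = g] (mod (m * q)) \<longrightarrow> c (h * a) = 0)"
proof -
  define A where "A = {a. a < n \<and> c a \<noteq> 0 \<and> [a = g] (mod m)}"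
  define f where "f = (\<lambda>k. (1 + m * r * k) * g mod (m * q))"
  define S where "S = {k. k < q \<and> coprime (1 + m * r * k) n}"
  have pos: "m > 0" "r > 0" "q > 0" using mqr n by (auto intro: Nat.gr0I)
  have cop_q: "coprime (1 + m * r * k) n \<longleftrightarrow> \<not> q dvd 1 + m * r * k" for k
  proof
    assume "coprime (1 + m * r * k) n"
    moreover have "q dvd n" using mqr by auto
    ultimately show "\<not> q dvd 1 + m * r * k" using q(1) by (meson coprime_common_divisor not_prime_unit)
  next
    assume nd: "\<not> q dvd 1 + m * r * k"
    have "coprime (1 + m * r * k) (m * r)"
      by (rule coprimeI) (metis dvd_add_left_iff dvd_mult2)
    moreover have "coprime (1 + m * r * k) q"
      using prime_imp_coprime[OF q(1) nd] by (simp add: coprime_commute)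
    ultimately have "coprime (1 + m * r * k) (m * r * q)" by (metis coprime_mult_right_iff)
    moreover have "m * r * q = n" using mqr by (simp add: mult_ac)
    ultimately show "coprime (1 + m * r * k) n" by (simp only:)
  qed
  \<comment> \<open>If \<open>q\<close> divides some \<open>1 + m * r * k\<close>, then
    \<open>m * r\<close> is invertible modulo \<open>q\<close>, and \<open>k\<close> is determined
    modulo \<open>q\<close>.\<close>
  have "card ({..<q} - S) \<le> 1"
  proof (rule ccontr)
    assume "\<not> card ({..<q} - S) \<le> 1"
    then have "\<not> (\<forall>x\<in>{..<q} - S. \<forall>y\<in>{..<q} - S. x = y)"
      using card_le_Suc0_iff_eq[of "{..<q} - S"] by (metis One_nat_def finite_Diff finite_lessThan)
    then obtain x y where "x \<in> {..<q} - S" "y \<in> {..<q} - S" "x \<noteq> y" by blast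
    then have xy: "x < q" "y < q" "q dvd 1 + m * r * x" "q dvd 1 + m * r * y" "x \<noteq> y"
      using cop_q by (auto simp: S_def)
    have "\<not> q dvd m * r"
      using xy(3) q(1) by (metis dvd_add_left_iff dvd_mult2 nat_dvd_1_iff_1 not_prime_1)
    then have "coprime (m * r) q" using prime_imp_coprime[OF q(1)] coprime_commute by blast
    moreover have "[1 + m * r * x = 0] (mod q)" "[1 + m * r * y = 0] (mod q)"
      unfolding cong_0_iff by fact+
    then have "[1 + m * r * x = 1 + m * r * y] (mod q)" using cong_sym cong_trans by blast
    then have "[m * r * x = m * r * y] (mod q)" using cong_add_lcancel_nat by blast
    ultimately have "[x = y] (mod q)" using cong_mult_lcancel_nat by blast
    then show False using xy by (simp add: cong_def)
  qed
  moreover have "card ({..<q} - S) = q - card S"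
    by (subst card_Diff_subset) (auto simp: S_def)
  ultimately have "card S \<ge> q - 1" by simp
  \<comment> \<open>From \<open>q > 5\<close> alone \<open>q = 6\<close> would leave only five
    multipliers; primality gives \<open>q \<ge> 7\<close>.\<close>
  moreover have "odd q" using q prime_odd_nat by simp
  then have "q \<noteq> 6" by auto
  ultimately have "card S > 5" using q(2) by simp
  moreover have "inj_on f S"
    unfolding f_def
    by (rule inj_on_subset[OF inj_residue_shift]) (use pos r g mqr in \<open>auto simp: S_def\<close>)
  ultimately have "card (f ` S) > 5" by (simp add: card_image)
  have "finite A" by (simp add: A_def)
  then have "card ((\<lambda>a. a mod (m * q)) ` A) \<le> 5"
    using card card_image_le[of A "\<lambda>a. a mod (m * q)"] by (simp add: A_def)
  then have "\<not> f ` S \<subseteq> (\<lambda>a. a mod (m * q)) ` A"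
    using \<open>card (f ` S) > 5\<close> \<open>finite A\<close> card_mono[of "(\<lambda>a. a mod (m * q)) ` A" "f ` S"] by auto
  then obtain k where k: "k \<in> S" "f k \<notin> (\<lambda>a. a mod (m * q)) ` A" by blast
  define h where "h = 1 + m * r * k"
  \<comment> \<open>Since \<open>h \<equiv> 1\<close> modulo \<open>m\<close>, a nonzero value would
    put the residue of \<open>h * a\<close> into \<open>A\<close>, but its class modulo
    \<open>m * q\<close> is \<open>f k\<close>, which \<open>A\<close> misses.\<close>
  have "c (h * a) = 0" if a: "[a = g] (mod (m * q))" for a
  proof (rule ccontr)
    assume nz: "c (h * a) \<noteq> 0"
    define b where "b = h * a mod n"
    have cong: "[h * a = h * g] (mod (m * q))" using a by (rule cong_scalar_left)
    have bmod: "[b = h * a] (mod (m * q))"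
      using cong_modulus_mult_nat[of b "h * a" "m * q" r] mqr by (simp add: b_def cong_def)
    have "c b \<noteq> 0" using nz periodic_mod_eq[of c n "h * a", OF periodic] by (simp add: b_def)
    moreover have "b < n" using n by (simp add: b_def)
    moreover have "[b = g] (mod m)"
    proof -
      have "[b = h * g] (mod (m * q))" using bmod cong by (rule cong_trans)
      then have "[b = h * g] (mod m)" by (rule cong_modulus_mult_nat)
      moreover have "[h * g = 1 * g] (mod m)"
        unfolding h_def mult.assoc by (intro cong_scalar_right cong_1_add_mult)
      ultimately show ?thesis by (metis cong_trans mult_1)
    qed
    ultimately have "b \<in> A" by (simp add: A_def)
    moreover have "f k = b mod (m * q)"
      using cong_trans[OF bmod cong] by (simp add: f_def h_def cong_def)
    ultimately show False using k by blast
  qed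
  moreover have "coprime h n" using k by (simp add: S_def h_def)
  moreover have "[h = 1] (mod (m * r))" unfolding h_def by (rule cong_1_add_mult)
  ultimately show ?thesis by blast
qed

end

text \<open>\<open>S\<close> holds the primes still to be treated, \<open>V\<close> those already
  done, and \<open>m\<close> is \<open>n\<close> divided by the product of \<open>S\<close>. The
  support of \<open>c\<close> may double in each step, so only its part in the class of
  \<open>g\<close> modulo \<open>m\<close> is counted. Treating \<open>q\<close> refines that class
  to modulus \<open>m * q\<close>, where the subtracted translate is 0 and the count cannot
  grow.\<close>

lemma exists_fully_ramified:
  assumes "finite S" "\<And>q. q \<in> S \<Longrightarrow> prime q \<and> q > 5" "log_relation n c" "c g \<noteq> 0" "m * \<Prod>S = n"
    and "card {a. a < n \<and> c a \<noteq> 0 \<and> [a = g] (mod m)} \<le> 5"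
    and "\<And>q l. q \<in> V \<Longrightarrow> q dvd l \<Longrightarrow> log_relation.transform n c l = 0"
  shows "\<exists>c'. log_relation n c' \<and> c' g \<noteq> 0 \<and>
    (\<forall>q\<in>S \<union> V. \<forall>l. q dvd l \<longrightarrow> log_relation.transform n c' l = 0)"
  using assms
proof (induction S arbitrary: c m V rule: finite_induct)
  case empty
  then show ?case by auto
next
  case (insert q S)
  interpret log_relation n c by (fact insert.prems(2))
  define r where "r = \<Prod>S"
  have q: "prime q" "q > 5" using insert.prems(1) by auto
  have mqr: "m * q * r = n" using insert.prems(4) insert.hyps by (simp add: r_def mult.assoc)
  have "coprime q r" unfolding r_def
  proof (rule prod_coprime_right)
    fix p assume "p \<in> S"
    then show "coprime q p" using insert.prems(1)[of p] q insert.hyps by (intro primes_coprime) auto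
  qed
  moreover have "coprime g n" using supp insert.prems(3) by blast
  ultimately obtain h where h: "coprime h n" "[h = 1] (mod (m * r))"
    and avoid: "\<And>a. [a = g] (mod (m * q)) \<Longrightarrow> c (h * a) = 0"
    using exists_avoiding_multiplier[OF q _ mqr _ insert.prems(3) insert.prems(5)] by blast
  obtain h' where h': "[h * h' = 1] (mod n)" using cong_solve_coprime_nat[OF h(1)] by auto
  define c' where "c' = (\<lambda>a. c a - c (h * a))"
  interpret c': log_relation n c' unfolding c'_def using h(1) by (rule difference_log_relation)
  have tr: "c'.transform l = transform l - transform (h' * l)" for l
    unfolding c'_def by (rule transform_difference[OF h(1) h'])
  have vanish: "c'.transform l = 0" if pl: "p \<in> insert q V" "p dvd l" for p l
  proof (cases "p \<in> V")
    case True
    then show ?thesis using insert.prems(6)[of p l] insert.prems(6)[of p "h' * l"] pl by (simp add: tr)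
  next
    case False
    \<comment> \<open>As \<open>h'\<close> is 1 modulo \<open>n/q\<close>, multiplication by it
      fixes the multiples of \<open>q\<close> modulo \<open>n\<close>, and the two transforms
      cancel.\<close>
    then obtain k where k: "l = q * k" using pl by auto
    have "[h * h' = 1] (mod (m * r))" using h' mqr by (metis cong_modulus_mult_nat mult.assoc mult.commute)
    moreover have "[h * h' = 1 * h'] (mod (m * r))" using h(2) by (rule cong_scalar_right)
    ultimately have "[h' = 1] (mod (m * r))" by (metis cong_sym cong_trans mult_1)
    then have "[q * h' = q * 1] (mod (q * (m * r)))" by (simp add: cong_def)
    then have "[q * h' * k = q * 1 * k] (mod (q * (m * r)))" by (rule cong_scalar_right)
    moreover have "q * (m * r) = n" using mqr by (simp add: mult_ac)
    ultimately have "[h' * l = l] (mod n)" by (simp add: k mult_ac)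
    then show ?thesis using transform_cong[of "h' * l" l] by (simp add: tr)
  qed
  have "c' g \<noteq> 0" using avoid[of g] insert.prems(3) by (simp add: c'_def)
  moreover have "card {a. a < n \<and> c' a \<noteq> 0 \<and> [a = g] (mod (m * q))} \<le> 5"
  proof -
    have sub: "{a. a < n \<and> c' a \<noteq> 0 \<and> [a = g] (mod (m * q))} \<subseteq> {a. a < n \<and> c a \<noteq> 0 \<and> [a = g] (mod m)}"
      using avoid by (auto simp: c'_def dest: cong_modulus_mult_nat)
    then show ?thesis using insert.prems(5) card_mono[OF _ sub] by simp
  qed
  ultimately obtain c'' where "log_relation n c''" "c'' g \<noteq> 0"
    "\<forall>p\<in>S \<union> insert q V. \<forall>l. p dvd l \<longrightarrow> log_relation.transform n c'' l = 0"
    using insert.IH[of c' "m * q" "insert q V"] insert.prems(1) c'.log_relation_axioms mqr vanish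
    unfolding r_def by blast
  then show ?case by (intro exI[of _ c'']) auto
qed

text \<open>The prime \<open>p\<close> with \<open>p\<^sup>2\<close> dividing \<open>n\<close> still divides \<open>m\<close>, the quotient of \<open>n\<close> by its radical, so \<open>a\<close> and
  \<open>-a\<close> are never both congruent to \<open>g\<close> modulo \<open>m\<close>: five classes up to sign leave at most five residues.\<close>

theorem log_relation_trivial:
  assumes c: "log_relation n c" and nsq: "\<not> squarefree n" and odd: "odd n"
    and primes: "\<And>q. prime q \<Longrightarrow> q dvd n \<Longrightarrow> q > 5"
    and classes: "\<And>a. c a \<noteq> 0 \<Longrightarrow> \<exists>b\<in>B. [a = b] (mod n) \<or> n dvd a + b" and B: "finite B" "card B \<le> 5"
  shows "c g = 0"
proof (rule ccontr)
  interpret log_relation n c by (fact c)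
  assume g: "c g \<noteq> 0"
  define R where "R = \<Prod>(prime_factors n)"
  have "R dvd n"
  proof -
    have "R dvd (\<Prod>q\<in>prime_factors n. q ^ multiplicity q n)"
      unfolding R_def by (intro prod_dvd_prod dvd_power) (simp add: prime_factors_multiplicity)
    also have "\<dots> = n" using n prod_prime_factors[of n] by simp
    finally show ?thesis .
  qed
  then obtain m where m: "n = R * m" by blast
  obtain p where p: "prime p" "p\<^sup>2 dvd n"
    using nsq n squarefree_factorial_semiring[of n] by auto
  \<comment> \<open>The radical \<open>R\<close> uses up only one of the two factors
    \<open>p\<close> of \<open>n\<close>.\<close>
  have "p dvd m"
  proof -
    define X where "X = \<Prod>(prime_factors n - {p})"
    have "p dvd n" using p(2) by (meson dvd_trans dvd_power zero_less_numeral)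
    then have "p \<in> prime_factors n" using p(1) n by (auto simp: prime_factors_dvd)
    then have "R = p * X" unfolding R_def X_def by (subst prod.remove) auto
    then have "n = p * (X * m)" using m by (simp add: mult.assoc)
    then have "p * p dvd p * (X * m)" using p(2) by (simp add: power2_eq_square)
    then have "p dvd X * m" using p(1) by simp
    moreover have "coprime p X" unfolding X_def
      by (rule prod_coprime_right) (use p in \<open>auto intro: primes_coprime\<close>)
    ultimately show ?thesis by (simp add: coprime_dvd_mult_right_iff)
  qed
  have "p dvd n" using p by (meson dvd_trans dvd_power zero_less_numeral)
  have cop: "coprime a p" if "c a \<noteq> 0" for a
  proof -
    have "coprime a n" using that supp by blast
    then show ?thesis using \<open>p dvd n\<close> coprime_divisors[of a a p n] by simp
  qed
  have "\<exists>f. \<forall>a\<in>{a. a < n \<and> c a \<noteq> 0 \<and> [a = g] (mod m)}. f a \<in> B \<and> ([a = f a] (mod n) \<or> n dvd a + f a)"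
    by (intro bchoice ballI) (use classes in blast)
  then obtain f where f: "\<And>a. a < n \<Longrightarrow> c a \<noteq> 0 \<Longrightarrow> [a = g] (mod m) \<Longrightarrow>
      f a \<in> B \<and> ([a = f a] (mod n) \<or> n dvd a + f a)" by blast
  have "card {a. a < n \<and> c a \<noteq> 0 \<and> [a = g] (mod m)} \<le> card B"
  proof (rule card_inj_on_le)
    show "inj_on f {a. a < n \<and> c a \<noteq> 0 \<and> [a = g] (mod m)}"
    proof (rule inj_onI, clarify)
      fix a a' assume a: "a < n" "c a \<noteq> 0" "[a = g] (mod m)" and a': "a' < n" "c a' \<noteq> 0" "[a' = g] (mod m)"
        and eq: "f a = f a'"
      \<comment> \<open>Otherwise \<open>x\<close> would be congruent to its negative modulo
        \<open>p\<close>, so the odd prime \<open>p\<close> would divide the unit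
        \<open>x\<close>.\<close>
      have opposite: False if "[x = f a] (mod n)" "n dvd y + f a" "[x = g] (mod m)" "[y = g] (mod m)" "c x \<noteq> 0" for x y
      proof -
        have "[x + y = f a + y] (mod n)" using that(1) by (rule cong_add) simp
        moreover have "[f a + y = 0] (mod n)" using that(2) by (simp add: cong_0_iff add.commute)
        ultimately have "[x + y = 0] (mod n)" by (rule cong_trans)
        then have "[x + y = 0] (mod p)" using \<open>p dvd n\<close> by (rule cong_dvd_modulus_nat)
        moreover have "[x = y] (mod p)"
          by (intro cong_dvd_modulus_nat[OF cong_trans[OF that(3) cong_sym[OF that(4)]]] \<open>p dvd m\<close>)
        then have "[x + x = x + y] (mod p)" by (intro cong_add) auto
        ultimately have "[x + x = 0] (mod p)" using cong_trans by blast
        then have "p dvd 2 * x" by (simp add: cong_0_iff mult_2)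
        moreover have "coprime x p" using cop that(5) by blast
        ultimately have "p dvd 2" by (simp add: coprime_commute coprime_dvd_mult_left_iff)
        then have "p \<le> 2" by (auto dest: dvd_imp_le)
        moreover have "p > 5" using primes[OF p(1) \<open>p dvd n\<close>] .
        ultimately show False by simp
      qed
      have "[a = a'] (mod n)"
      proof -
        consider "[a = f a] (mod n)" "[a' = f a] (mod n)" | "n dvd a + f a" "n dvd a' + f a"
          using f[OF a] f[OF a'] opposite[of a a'] opposite[of a' a] a a' unfolding eq[symmetric] by blast
        then show ?thesis
        proof cases
          case 1
          then show ?thesis by (meson cong_sym cong_trans)
        next
          case 2
          then have "[a + f a = a' + f a] (mod n)" by (metis cong_0_iff cong_sym cong_trans)
          then show ?thesis using cong_add_rcancel_nat by blast
        qed
      qed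
      then show "a = a'" using a a' by (simp add: cong_def)
    qed
  qed (use f B in auto)
  then have card: "card {a. a < n \<and> c a \<noteq> 0 \<and> [a = g] (mod m)} \<le> 5" using B by simp
  obtain c' where c': "log_relation n c'" "c' g \<noteq> 0"
    "\<forall>q\<in>prime_factors n \<union> {}. \<forall>l. q dvd l \<longrightarrow> log_relation.transform n c' l = 0"
    using exists_fully_ramified[of "prime_factors n" n c g m "{}"] primes c g card m
    unfolding R_def by (auto simp: mult.commute)
  interpret c': log_relation n c' by (fact c'(1))
  have "c' g = 0"
    by (rule c'.coefficients_zero) (use c'(3) n in \<open>auto simp: prime_factors_dvd\<close>)
  then show False using c'(2) by contradiction
qed

section \<open>Conjugates of roots of unity\<close>

lemma prime_power_add:
  fixes u v :: "'a::comm_ring_1"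
  assumes "prime q"
  shows "\<exists>w. (u + v) ^ q = u ^ q + v ^ q + of_nat q * w"
proof -
  have q: "q > 0" using assms prime_gt_0_nat by blast
  have "(u + v) ^ q = (\<Sum>k\<le>q. of_nat (q choose k) * u ^ k * v ^ (q - k))"
    by (rule binomial_ring)
  also have "{..q} = insert 0 (insert q {1..<q})" using q by auto
  also have "(\<Sum>k\<in>\<dots>. of_nat (q choose k) * u ^ k * v ^ (q - k)) =
      v ^ q + u ^ q + (\<Sum>k\<in>{1..<q}. of_nat (q choose k) * u ^ k * v ^ (q - k))"
    using q by simp
  also have "(\<Sum>k\<in>{1..<q}. of_nat (q choose k) * u ^ k * v ^ (q - k)) =
      of_nat q * (\<Sum>k\<in>{1..<q}. of_nat ((q choose k) div q) * u ^ k * v ^ (q - k))"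
    unfolding sum_distrib_left
  proof (rule sum.cong)
    fix k assume "k \<in> {1..<q}"
    then have "q dvd (q choose k)" using assms by (intro dvd_choose_prime) auto
    then have "(of_nat (q choose k) :: 'a) = of_nat q * of_nat ((q choose k) div q)"
      by (metis dvd_mult_div_cancel of_nat_mult)
    then show "of_nat (q choose k) * u ^ k * v ^ (q - k) =
        of_nat q * (of_nat ((q choose k) div q) * u ^ k * v ^ (q - k))"
      by (simp add: mult.assoc)
  qed simp
  finally show ?thesis by (auto simp: add.commute)
qed

lemma prime_dvd_power_self_diff:
  fixes a :: int
  assumes "prime q"
  shows "int q dvd a ^ q - a"
proof -
  have nat_case: "int q dvd int b ^ q - int b" for b :: nat
  proof (induction b)
    case 0
    then show ?case using assms prime_gt_0_nat by (simp add: power_0_left)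
  next
    case (Suc b)
    obtain w where "(int b + 1) ^ q = int b ^ q + 1 ^ q + of_nat q * w"
      using prime_power_add[OF assms, of "int b" 1] by blast
    then have "int (Suc b) ^ q - int (Suc b) = (int b ^ q - int b) + int q * w"
      by (simp add: algebra_simps)
    then show ?case using Suc by (metis dvd_add dvd_triv_left)
  qed
  define b where "b = nat (a mod int q)"
  have b: "int b = a mod int q"
    using assms prime_gt_0_nat[of q] by (simp add: b_def)
  have "[a = int b] (mod int q)" by (simp add: b cong_def)
  then have "[a ^ q - a = int b ^ q - int b] (mod int q)"
    by (intro cong_diff cong_pow)
  then show ?thesis using nat_case[of b] cong_dvd_iff by blast
qed

text \<open>Modulo \<open>q\<close>, the power map is additive and fixes integer coefficients, so
  \<open>f(X^q)\<close> and the \<open>q\<close>-th power of \<open>f\<close> agree.\<close>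

lemma pcompose_monom_frobenius:
  fixes f :: "int poly"
  assumes "prime q"
  shows "\<exists>g. pcompose f (Polynomial.monom 1 q) = f ^ q + Polynomial.smult (int q) g"
proof (induction f)
  case 0
  then show ?case using assms prime_gt_0_nat by (auto simp: power_0_left intro!: exI[of _ 0])
next
  case (pCons a p)
  then obtain g where g: "pcompose p (Polynomial.monom 1 q) = p ^ q + Polynomial.smult (int q) g" by blast
  obtain w where w: "([:a:] + [:0, 1:] * p) ^ q = [:a:] ^ q + ([:0, 1:] * p) ^ q + of_nat q * w"
    using prime_power_add[OF assms] by blast
  obtain d where d: "a ^ q - a = int q * d"
    using prime_dvd_power_self_diff[OF assms, of a] by (auto simp: dvd_def)
  have X: "([:0, 1:] * p) ^ q = Polynomial.monom 1 q * p ^ q"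
    by (simp add: monom_altdef power_mult_distrib del: mult_pCons_left)
  have pc: "pCons a p = [:a:] + [:0, 1:] * p" by simp
  have "[:a:] ^ q = [:a ^ q:]" by (simp add: poly_const_pow)
  also have "a ^ q = a + int q * d" using d by simp
  finally have a: "[:a:] ^ q = [:a:] + Polynomial.smult (int q) [:d:]" by simp
  have qw: "of_nat q * w = Polynomial.smult (int q) w" by (simp add: of_nat_poly)
  have "pcompose (pCons a p) (Polynomial.monom 1 q) = [:a:] + Polynomial.monom 1 q * (p ^ q + Polynomial.smult (int q) g)"
    by (simp add: pcompose_pCons g)
  also have "\<dots> = (pCons a p) ^ q + Polynomial.smult (int q) (Polynomial.monom 1 q * g - [:d:] - w)"
    unfolding pc w a X qw
    by (simp add: algebra_simps smult_diff_right smult_add_right del: mult_pCons_left mult_pCons_right)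
  finally show ?case by blast
qed

definition int_poly_eval :: "int poly \<Rightarrow> complex \<Rightarrow> complex" where
  "int_poly_eval P z = poly (map_poly of_int P) z"

lemma int_poly_eval_0 [simp]: "int_poly_eval 0 z = 0"
  by (simp add: int_poly_eval_def)

lemma int_poly_eval_pCons [simp]: "int_poly_eval (pCons a P) z = of_int a + z * int_poly_eval P z"
  by (simp add: int_poly_eval_def map_poly_pCons)

lemma int_poly_eval_1 [simp]: "int_poly_eval 1 z = 1"
  by (simp add: int_poly_eval_def)

lemma int_poly_eval_add [simp]: "int_poly_eval (P + Q) z = int_poly_eval P z + int_poly_eval Q z"
  by (induction P Q rule: poly_induct2) (simp_all add: algebra_simps)

lemma int_poly_eval_minus [simp]: "int_poly_eval (- P) z = - int_poly_eval P z"
  by (induction P) simp_all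

lemma int_poly_eval_diff [simp]: "int_poly_eval (P - Q) z = int_poly_eval P z - int_poly_eval Q z"
  using int_poly_eval_add[of P "- Q" z] by simp

lemma int_poly_eval_smult [simp]: "int_poly_eval (Polynomial.smult a P) z = of_int a * int_poly_eval P z"
  by (induction P) (simp_all add: algebra_simps)

lemma int_poly_eval_mult [simp]: "int_poly_eval (P * Q) z = int_poly_eval P z * int_poly_eval Q z"
  by (induction P) (simp_all add: algebra_simps)

lemma int_poly_eval_power [simp]: "int_poly_eval (P ^ k) z = int_poly_eval P z ^ k"
  by (induction k) simp_all

lemma int_poly_eval_monom [simp]: "int_poly_eval (Polynomial.monom a k) z = of_int a * z ^ k"
  by (simp add: int_poly_eval_def map_poly_monom poly_monom)

lemma int_poly_eval_prod [simp]: "int_poly_eval (prod f S) z = (\<Prod>j\<in>S. int_poly_eval (f j) z)"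
  by (induction S rule: infinite_finite_induct) simp_all

lemma int_poly_eval_pcompose [simp]:
  "int_poly_eval (pcompose P Q) z = int_poly_eval P (int_poly_eval Q z)"
  by (induction P) (simp_all add: pcompose_pCons)

text \<open>Gauss's lemma: a primitive annihilator of least degree divides \<open>X^n - 1\<close>
  over the integers, so its leading coefficient is a unit. The last clause replaces
  irreducibility.\<close>

lemma int_monic_minimal_poly:
  fixes \<omega> :: complex
  assumes "\<omega> ^ n = 1" "n > 0"
  obtains f h :: "int poly" where "lead_coeff f = 1" "int_poly_eval f \<omega> = 0"
    "Polynomial.monom 1 n - 1 = f * h"
    "\<And>g. int_poly_eval g \<omega> = 0 \<Longrightarrow> degree g < degree f \<Longrightarrow> g = 0"
proof -
  let ?N = "Polynomial.monom 1 n - 1 :: int poly"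
  define Q where "Q = (\<lambda>f :: int poly. f \<noteq> 0 \<and> int_poly_eval f \<omega> = 0)"
  have "degree ?N = n" using assms(2)
    by (intro antisym degree_diff_le le_degree) (auto simp: degree_monom_eq)
  then have lcN: "lead_coeff ?N = 1" using assms(2) by simp
  then have "?N \<noteq> 0" by (metis leading_coeff_0_iff zero_neq_one)
  moreover have N\<omega>: "int_poly_eval ?N \<omega> = 0"
    using assms by simp
  ultimately have "Q ?N" by (simp add: Q_def)
  then obtain f0 where f0: "Q f0" and min: "\<And>g. Q g \<Longrightarrow> degree f0 \<le> degree g"
    using ex_has_least_nat[of Q ?N degree] by blast
  define f1 where "f1 = primitive_part f0"
  have f01: "f0 = Polynomial.smult (content f0) f1" by (simp add: f1_def)
  have "f0 \<noteq> 0" using f0 by (simp add: Q_def)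
  then have f1: "content f1 = 1" "f1 \<noteq> 0" "content f0 \<noteq> 0" by (auto simp: f1_def)
  have "int_poly_eval f0 \<omega> = 0" using f0 by (simp add: Q_def)
  then have f1\<omega>: "int_poly_eval f1 \<omega> = 0"
    by (subst (asm) f01) (use f1 in simp)
  have deg: "degree f1 = degree f0" by (simp add: f1_def)
  have small: "g = 0" if "int_poly_eval g \<omega> = 0" "degree g < degree f1" for g
    using min[of g] that deg by (auto simp: Q_def)
  \<comment> \<open>Division with remainder over the integers costs a factor \<open>a\<close>; since
    \<open>f1\<close> is primitive, comparing contents shows that \<open>a\<close> divides the
    quotient and can be cancelled.\<close>
  obtain a k where ak: "a \<noteq> 0" "Polynomial.smult a ?N = f1 * k + pseudo_mod ?N f1"
    using pseudo_mod(1)[OF f1(2), of ?N] by blast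
  have "int_poly_eval (pseudo_mod ?N f1) \<omega> = int_poly_eval (Polynomial.smult a ?N - f1 * k) \<omega>"
    using ak(2) by simp
  also have "\<dots> = 0" using N\<omega> f1\<omega> by (simp del: int_poly_eval_diff add: int_poly_eval_diff[of "Polynomial.smult a ?N"])
  finally have "pseudo_mod ?N f1 = 0"
    using small pseudo_mod(2)[OF f1(2), of ?N] by blast
  with ak have ak2: "Polynomial.smult a ?N = f1 * k" by simp
  then have "normalize a * content ?N = content k"
    using f1(1) by (metis content_mult content_smult mult_1)
  then have "a dvd content k" by (metis dvd_normalize_iff dvd_triv_left normalize_dvd_iff)
  then obtain h where h: "k = Polynomial.smult a h"
    by (metis const_poly_dvd_iff_dvd_content dvdE mult_pCons_left add_0 add.right_neutral mult_zero_left pCons_0_0)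
  then have "Polynomial.smult a ?N = Polynomial.smult a (f1 * h)" using ak2 by simp
  then have N: "?N = f1 * h" using ak(1) by (metis smult_cancel)
  define u where "u = lead_coeff f1"
  have "u dvd 1" using lcN unfolding N lead_coeff_mult u_def by (metis dvd_triv_left)
  then have u: "u * u = 1" by (auto simp: zdvd1_eq abs_if split: if_splits)
  show ?thesis
  proof (rule that[of "Polynomial.smult u f1" "Polynomial.smult u h"])
    show "lead_coeff (Polynomial.smult u f1) = 1" using u f1(2) by (simp add: u_def)
    show "int_poly_eval (Polynomial.smult u f1) \<omega> = 0" using f1\<omega> by simp
    show "?N = Polynomial.smult u f1 * Polynomial.smult u h" using u by (simp add: N)
    show "g = 0" if "int_poly_eval g \<omega> = 0" "degree g < degree (Polynomial.smult u f1)" for g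
      using small that by (metis degree_smult_eq degree_0 not_less_zero smult_eq_0_iff)
  qed
qed

text \<open>With \<open>f\<close> the minimal polynomial of \<open>\<omega>\<close> and \<open>X^n - 1 = f h\<close>, Frobenius gives \<open>f(\<omega>^q) \<in> q\<int>[\<omega>]\<close>. If
  \<open>f(\<omega>^q) \<noteq> 0\<close>, then \<open>h(\<omega>^q) = 0\<close>, and differentiating \<open>X^n - 1\<close> at \<open>\<omega>^q\<close> yields \<open>n \<in> q\<int>[\<omega>]\<close>, hence
  \<open>q\<close> divides \<open>n\<close>.\<close>

lemma int_poly_root_of_unity_prime_power:
  fixes \<omega> :: complex
  assumes \<omega>: "\<omega> ^ n = 1" and n: "n > 0" and q: "prime q" "\<not> q dvd n"
    and P: "int_poly_eval P \<omega> = 0"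
  shows "int_poly_eval P (\<omega> ^ q) = 0"
proof -
  obtain f h :: "int poly" where f: "lead_coeff f = 1" "int_poly_eval f \<omega> = 0"
    and N: "Polynomial.monom 1 n - 1 = f * h"
    and small: "\<And>g. int_poly_eval g \<omega> = 0 \<Longrightarrow> degree g < degree f \<Longrightarrow> g = 0"
    using int_monic_minimal_poly[OF \<omega> n] by blast
  have f0: "f \<noteq> 0" using f by auto
  have degf: "degree f > 0"
  proof (rule ccontr)
    assume "\<not> degree f > 0"
    then obtain c where "f = [:c:]" by (meson degree_eq_zeroE not_gr_zero)
    then show False using f by simp
  qed
  \<comment> \<open>Pseudo-division by a monic polynomial is ordinary division.\<close>
  have reduce: "\<exists>k r. g = f * k + r \<and> (r = 0 \<or> degree r < degree f)" for g
    using pseudo_divmod[OF f0, of g] f(1) by (metis power_one smult_1_left surj_pair)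
  have "int_poly_eval f (\<omega> ^ q) = 0"
  proof (rule ccontr)
    assume nz: "int_poly_eval f (\<omega> ^ q) \<noteq> 0"
    obtain g where g: "pcompose f (Polynomial.monom 1 q) = f ^ q + Polynomial.smult (int q) g"
      using pcompose_monom_frobenius[OF q(1)] by blast
    have "int_poly_eval (pcompose f (Polynomial.monom 1 q)) \<omega> = of_nat q * int_poly_eval g \<omega>"
      unfolding g using f(2) q(1) by (simp add: power_0_left prime_gt_0_nat)
    then have fq: "int_poly_eval f (\<omega> ^ q) = of_nat q * int_poly_eval g \<omega>"
      by simp
    have wq: "(\<omega> ^ q) ^ n = 1" using \<omega> by (metis mult.commute power_mult power_one)
    have "int_poly_eval (Polynomial.monom 1 n - 1) (\<omega> ^ q) = 0" using wq by simp
    then have hq: "int_poly_eval h (\<omega> ^ q) = 0" using nz unfolding N by simp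
    have "pderiv (Polynomial.monom 1 n - 1) = pderiv f * h + f * pderiv h"
      unfolding N by (simp add: pderiv_mult algebra_simps)
    then have "Polynomial.smult (int n) (Polynomial.monom 1 (n - 1)) = pderiv f * h + f * pderiv h"
      by (simp add: pderiv_diff pderiv_monom smult_monom)
    then have "int_poly_eval (Polynomial.smult (int n) (Polynomial.monom 1 (n - 1))) (\<omega> ^ q) =
        int_poly_eval (pderiv f * h + f * pderiv h) (\<omega> ^ q)" by simp
    then have "of_nat n * (\<omega> ^ q) ^ (n - 1) =
        of_nat q * int_poly_eval g \<omega> * int_poly_eval (pderiv h) (\<omega> ^ q)"
      using hq fq by simp
    \<comment> \<open>The extra factor \<open>\<omega> ^ q\<close> completes the power to
      \<open>(\<omega> ^ q) ^ n = 1\<close>.\<close>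
    then have "of_nat n * ((\<omega> ^ q) ^ (n - 1) * \<omega> ^ q) =
        of_nat q * int_poly_eval g \<omega> * int_poly_eval (pderiv h) (\<omega> ^ q) * \<omega> ^ q"
      by (metis mult.assoc)
    also have "(\<omega> ^ q) ^ (n - 1) * \<omega> ^ q = 1"
      using wq n by (metis power_minus_mult)
    finally have "of_nat n = int_poly_eval
        (Polynomial.smult (int q) (g * pcompose (pderiv h) (Polynomial.monom 1 q) * Polynomial.monom 1 q)) \<omega>"
      by (simp add: mult.assoc)
    moreover obtain k r where "g * pcompose (pderiv h) (Polynomial.monom 1 q) * Polynomial.monom 1 q = f * k + r"
      and r: "r = 0 \<or> degree r < degree f" using reduce by blast
    ultimately have "of_nat n = int_poly_eval (Polynomial.smult (int q) (f * k + r)) \<omega>" by simp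
    \<comment> \<open>After reduction modulo \<open>f\<close>, the degree is too small for a nonzero
      annihilator, so divisibility of \<open>n\<close> by \<open>q\<close> can be read off the
      constant coefficients.\<close>
    then have "int_poly_eval ([:int n:] - Polynomial.smult (int q) r) \<omega> = 0"
      using f(2) by simp
    moreover have "degree ([:int n:] - Polynomial.smult (int q) r) < degree f"
      using r degf by (intro degree_diff_less) (auto simp: )
    ultimately have "[:int n:] - Polynomial.smult (int q) r = 0" by (rule small)
    then have "Polynomial.coeff ([:int n:] - Polynomial.smult (int q) r) 0 = 0" by simp
    then have "int n = int q * Polynomial.coeff r 0" by simp
    then have "q dvd n" by (metis dvd_triv_left of_nat_dvd_iff)
    then show False using q(2) by simp
  qed
  moreover obtain k r where kr: "P = f * k + r" and r: "r = 0 \<or> degree r < degree f"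
    using reduce by blast
  moreover have "r = 0"
    using small[of r] r P f(2) unfolding kr by auto
  ultimately show ?thesis by simp
qed

text \<open>This stands in for the Galois action: \<open>s\<close> is a product of primes not
  dividing \<open>n\<close>, and each prime moves the root one step further. Every integer
  polynomial relation for \<omega> thus passes to its conjugates.\<close>

lemma int_poly_root_of_unity_coprime_power:
  fixes \<omega> :: complex
  assumes "\<omega> ^ n = 1" "n > 0" "coprime s n" "int_poly_eval P \<omega> = 0" "s > 0"
  shows "int_poly_eval P (\<omega> ^ s) = 0"
  using assms(5,3)
proof (induction s rule: prime_divisors_induct)
  case (factor q s)
  then have "int_poly_eval P (\<omega> ^ s) = 0" "\<not> q dvd n" 
    by (auto simp: coprime_absorb_left)
  moreover have "(\<omega> ^ s) ^ n = 1" using assms(1) by (metis mult.commute power_mult power_one)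
  ultimately have "int_poly_eval P ((\<omega> ^ s) ^ q) = 0"
    using int_poly_root_of_unity_prime_power assms(2) factor(1) by blast
  then show ?case by (metis power_mult mult.commute)
qed (use assms in auto)

section \<open>Tangents\<close>

lemma den_of_rat_pi: "den (of_rat q * pi) = snd (quotient_of q)"
proof -
  have "(THE r. of_rat q * pi / pi = of_rat r) = q" by (rule the_equality) auto
  then show ?thesis by (simp add: den_def)
qed

lemma cis_double_root_of_unity:
  assumes N: "odd N" "N > 1" and x: "x \<in> G" "0 < x" and den: "den x \<in> {int N, 2 * int N}"
  obtains a :: nat and \<epsilon> :: int where "coprime a N" "\<epsilon> \<in> {1, -1}" "cis (2 * x) = of_int \<epsilon> * unit_root N ^ a"
proof -
  obtain q where q: "x = of_rat q * pi" using x(1) by (auto simp: G_def)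
  obtain u d where ud: "quotient_of q = (u, d)" by (cases "quotient_of q")
  have d: "d > 0" "coprime u d" "q = of_int u / of_int d"
    using quotient_of_denom_pos[OF ud] quotient_of_coprime[OF ud] quotient_of_div[OF ud] by auto
  have xq: "x = real_of_int u / real_of_int d * pi" unfolding q d(3) by (simp add: of_rat_divide)
  have "u > 0" using x(2) d(1) unfolding xq by (simp add: zero_less_mult_iff zero_less_divide_iff)
  define v where "v = nat u"
  have v: "u = int v" using \<open>u > 0\<close> by (simp add: v_def)
  have "d = int N \<or> d = 2 * int N" using den den_of_rat_pi[of q] by (simp add: q ud)
  then show ?thesis
  proof
    assume dN: "d = int N"
    have "cis (2 * x) = cis (real v * (2 * pi / real N))"
      unfolding xq v dN by (rule arg_cong[of _ _ cis]) simp
    also have "\<dots> = unit_root N ^ v" by (simp add: unit_root_def Complex.DeMoivre)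
    finally have "cis (2 * x) = of_int 1 * unit_root N ^ v" by simp
    moreover have "coprime v N" using d(2) unfolding v dN by simp
    ultimately show ?thesis using that[of v 1] by simp
  next
    assume dN: "d = 2 * int N"
    then have cop: "coprime v (2 * N)" using d(2) unfolding v by (metis coprime_int_iff of_nat_mult of_nat_numeral)
    then have "odd v" by simp
    then obtain a where a: "v + N = 2 * a" using N(1) by (metis even_add evenE)
    have "coprime v N" using cop by simp
    then have "coprime (2 * a) N" unfolding a[symmetric] by (metis gcd_add1 coprime_iff_gcd_eq_1)
    then have "coprime a N" by simp
    \<comment> \<open>Since \<open>v\<close> and \<open>N\<close> are odd, \<open>cis (\<pi> v/N)\<close> is minus the \<open>N\<close>-th root of unity \<open>cis (\<pi> (v + N)/N)\<close>.\<close>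
    have "cis (2 * x) = - cis (real a * (2 * pi / real N))"
    proof -
      have "real (v + N) = real (2 * a)" unfolding a ..
      then have ra: "real a = (real v + real N) / 2" by simp
      then have "real a * (2 * pi / real N) = 2 * x + pi"
        unfolding ra xq v dN using N by (simp add: field_simps)
      then show ?thesis by (simp add: cis_mult[symmetric])
    qed
    also have "\<dots> = of_int (-1) * unit_root N ^ a" by (simp add: unit_root_def Complex.DeMoivre)
    finally show ?thesis using that[of a "-1"] \<open>coprime a N\<close> by simp
  qed
qed

lemma i_tan_eq:
  assumes "cos x \<noteq> 0"
  shows "cis (2 * x) + 1 \<noteq> 0" "\<i> * of_real (tan x) = (cis (2 * x) - 1) / (cis (2 * x) + 1)"
proof -
  have "cis (2 * x) + 1 = 2 * of_real (cos x) * cis x" "cis (2 * x) - 1 = 2 * \<i> * of_real (sin x) * cis x"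
    unfolding complex_eq_iff
    using cos_double_cos[of x] cos_double_sin[of x] sin_double[of x]
    by (simp_all add: power2_eq_square mult_ac)
  then show "cis (2 * x) + 1 \<noteq> 0" "\<i> * of_real (tan x) = (cis (2 * x) - 1) / (cis (2 * x) + 1)"
    using assms by (simp_all add: tan_def)
qed

text \<open>All \<open>cis (2 * x)\<close> lie in the open upper half plane, where \<open>x\<close>
  is determined. There \<open>- cis (- (2 * y))\<close> is the point of the complementary angle
  \<open>pi / 2 - y\<close>, while the last two candidates lie in the lower half plane.\<close>

lemma cis_double_eq_iff:
  assumes "0 < x" "x < pi / 2" "0 < y" "y < pi / 2"
  shows "cis (2 * x) = cis (2 * y) \<longleftrightarrow> x = y" and "cis (2 * x) = - cis (- (2 * y)) \<longleftrightarrow> x + y = pi / 2"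
    and "cis (2 * x) \<noteq> - cis (2 * y)" and "cis (2 * x) \<noteq> cis (- (2 * y))"
proof -
  have inj: "cis (2 * x) = cis (2 * y) \<longleftrightarrow> x = y" if "0 < x" "x < pi / 2" "0 < y" "y < pi / 2" for x y
  proof
    assume "cis (2 * x) = cis (2 * y)"
    then have "cos (2 * x) = cos (2 * y)" by (simp add: complex_eq_iff)
    then show "x = y" using cos_inj_pi[of "2 * x" "2 * y"] that by simp
  qed simp
  show "cis (2 * x) = cis (2 * y) \<longleftrightarrow> x = y" using assms by (rule inj)
  have "- cis (- (2 * y)) = cis (2 * (pi / 2 - y))"
    by (simp add: complex_eq_iff right_diff_distrib)
  then show "cis (2 * x) = - cis (- (2 * y)) \<longleftrightarrow> x + y = pi / 2"
    using inj[of x "pi / 2 - y"] assms by auto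
  have "sin (2 * x) > 0" "sin (2 * y) > 0" using assms by (auto intro: sin_gt_zero)
  then show "cis (2 * x) \<noteq> - cis (2 * y)" "cis (2 * x) \<noteq> cis (- (2 * y))"
    by (auto simp: complex_eq_iff)
qed

text \<open>\<open>T i j\<close> is 1 for equal and -1 for complementary angles. Since
  \<open>T 0 0 = 1\<close>, the equation at 0 forces at least two of the four angles to equal
  \<open>x 0\<close>.\<close>

lemma pairing_from_counting:
  fixes x :: "nat \<Rightarrow> real" and H :: real
  defines "T \<equiv> \<lambda>i j. of_bool (x i = x j) - of_bool (x i + x j = H) :: int"
  assumes rel: "\<And>i. i \<in> {0..4} \<Longrightarrow> 2 * T i 0 = (\<Sum>j\<in>{1..4}. T i j)"
    and H: "\<And>i. i \<in> {0..4} \<Longrightarrow> x i + x i \<noteq> H"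
  obtains i j k l where "{1..4} = {i, j, k, l}" "distinct [i, j, k, l]"
    "x i = x 0" "x j = x 0" "x k + x l = H" "x k \<le> x l"
proof -
  define S where "S = {j \<in> {1..4::nat}. x j = x 0}"
  have "2 * T 0 0 = (\<Sum>j\<in>{1..4}. T 0 j)" by (rule rel) simp
  moreover have "T 0 0 = 1" using H[of 0] by (simp add: T_def)
  moreover have "(\<Sum>j\<in>{1..4}. T 0 j) \<le> (\<Sum>j\<in>{1..4}. of_bool (j \<in> S))"
    by (intro sum_mono) (auto simp: T_def S_def)
  moreover have "(\<Sum>j\<in>{1..4}. of_bool (j \<in> S) :: int) = int (card S)"
    by (simp add: S_def Int_def)
  ultimately have "card S \<ge> 2" by simp
  then obtain S' where "S' \<subseteq> S" "card S' = 2" by (meson obtain_subset_with_card_n)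
  then obtain i j where ij: "i \<in> S" "j \<in> S" "i \<noteq> j" by (auto simp: card_2_iff)
  have "card ({1..4} - {i, j}) = 2" using ij by (subst card_Diff_subset) (auto simp: S_def)
  then obtain k l where kl: "{1..4} - {i, j} = {k, l}" "k \<noteq> l" by (auto simp: card_2_iff)
  have "i \<in> {1..4}" "j \<in> {1..4}" using ij by (auto simp: S_def)
  then have all1: "{1..4} = {i, j, k, l}" using kl by blast
  have "k \<in> {1..4} - {i, j}" "l \<in> {1..4} - {i, j}" unfolding kl by simp_all
  then have all2: "distinct [i, j, k, l]" and k: "k \<in> {0..4}" "0 \<in> {0..4::nat}" using ij kl by auto
  note all = all1 all2
  have x: "x i = x 0" "x j = x 0" using ij by (auto simp: S_def)
  have sum4: "(\<Sum>m\<in>{1..4}. T p m) = T p i + T p j + T p k + T p l" for p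
    unfolding all(1) using all(2) by simp
  \<comment> \<open>In the equation at \<open>k\<close> the terms of \<open>i\<close> and
    \<open>j\<close> cancel \<open>2 * T k 0\<close>, and \<open>T k k = 1\<close>; what remains is
    \<open>T k l = -1\<close>.\<close>
  have "x k + x l = H"
    using rel[OF k(1)] rel[OF k(2)] H[OF k(1)] H[OF k(2)] x unfolding sum4
    by (auto simp: T_def of_bool_def split: if_splits)
  then show ?thesis
    using that[of i j k l] that[of i j l k] all x
    by (cases "x k \<le> x l") (auto simp: insert_commute add.commute)
qed

text \<open>\<open>rel\<close> is the tangent identity with denominators cleared, an integer
  polynomial relation for \<open>unit_root N\<close>. The plus sign arises because the left side of
  the identity contains two factors \<open>\<i>\<close> and the right side four.\<close>

locale tangent_relation =
  fixes N :: nat and a :: "nat \<Rightarrow> nat" and \<epsilon> :: "nat \<Rightarrow> int"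
  assumes N: "odd N" "N > 1"
    and cop: "\<And>j. j \<in> {0..4} \<Longrightarrow> coprime (a j) N"
    and sign: "\<And>j. j \<in> {0..4} \<Longrightarrow> \<epsilon> j \<in> {1, -1}"
    and rel: "(of_int (\<epsilon> 0) * unit_root N ^ a 0 - 1)\<^sup>2 * (\<Prod>j\<in>{1..4}. of_int (\<epsilon> j) * unit_root N ^ a j + 1) +
      (of_int (\<epsilon> 0) * unit_root N ^ a 0 + 1)\<^sup>2 * (\<Prod>j\<in>{1..4}. of_int (\<epsilon> j) * unit_root N ^ a j - 1) = 0"
begin

definition z :: "nat \<Rightarrow> nat \<Rightarrow> complex" where
  "z s j = of_int (\<epsilon> j) * unit_root N ^ (a j * s)"

lemma conjugate_rel:
  assumes "coprime s N"
  shows "(z s 0 - 1)\<^sup>2 * (\<Prod>j\<in>{1..4}. z s j + 1) + (z s 0 + 1)\<^sup>2 * (\<Prod>j\<in>{1..4}. z s j - 1) = 0"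
proof -
  define P where "P = (Polynomial.monom (\<epsilon> 0) (a 0) - 1)\<^sup>2 * (\<Prod>j\<in>{1..4}. Polynomial.monom (\<epsilon> j) (a j) + 1) +
    (Polynomial.monom (\<epsilon> 0) (a 0) + 1)\<^sup>2 * (\<Prod>j\<in>{1..4}. Polynomial.monom (\<epsilon> j) (a j) - 1)"
  have "s > 0" using assms N by (auto intro: Nat.gr0I)
  have "int_poly_eval P (unit_root N) = 0" using rel by (simp add: P_def)
  then have "int_poly_eval P (unit_root N ^ s) = 0"
    using int_poly_root_of_unity_coprime_power[of "unit_root N" N s P] unit_root_power_self[of N] assms N \<open>s > 0\<close>
    by simp
  then show ?thesis by (simp add: P_def z_def power_mult[symmetric] mult.commute)
qed

definition log_dist :: "nat \<Rightarrow> real" where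
  "log_dist k = ln (norm (1 - unit_root N ^ k))"

lemma log_dist_cong: "[k = l] (mod N) \<Longrightarrow> log_dist k = log_dist l"
  using unit_root_power_cong[of N k l] N by (simp add: log_dist_def)

lemma not_dvd_double_coprime:
  assumes "coprime k N"
  shows "\<not> N dvd k" "\<not> N dvd 2 * k"
proof -
  have "coprime (2 * k) N" using assms N(1) by simp
  then show "\<not> N dvd k" "\<not> N dvd 2 * k"
    using assms N(2) by (auto simp: coprime_absorb_right simp del: coprime_mult_left_iff)
qed

lemma unit_root_power_nonreal:
  assumes "coprime k N"
  shows "1 - unit_root N ^ k \<noteq> 0" "1 + unit_root N ^ k \<noteq> 0"
proof -
  have "unit_root N ^ k \<noteq> 1" "unit_root N ^ (2 * k) \<noteq> 1"
    using not_dvd_double_coprime[OF assms] N unit_root_power_eq_1_iff by auto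
  moreover have "unit_root N ^ (2 * k) = (unit_root N ^ k)\<^sup>2" by (simp add: power_mult[symmetric] mult.commute)
  ultimately show "1 - unit_root N ^ k \<noteq> 0" "1 + unit_root N ^ k \<noteq> 0"
    by (auto simp: add_eq_0_iff)
qed

lemma z_nonzero:
  assumes "j \<in> {0..4}" "coprime s N"
  shows "z s j - 1 \<noteq> 0" "z s j + 1 \<noteq> 0"
proof -
  have "coprime (a j * s) N" using assms cop by simp
  then have nz: "1 - unit_root N ^ (a j * s) \<noteq> 0" "1 + unit_root N ^ (a j * s) \<noteq> 0"
    by (rule unit_root_power_nonreal)+
  have "y - 1 = - (1 - y)" "- y - 1 = - (1 + y)" "y + 1 = 1 + y" "- y + 1 = 1 - y" for y :: complex
    by simp_all
  note eqs = this
  have "z s j = unit_root N ^ (a j * s) \<or> z s j = - (unit_root N ^ (a j * s))"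
    using sign[OF assms(1)] by (auto simp: z_def)
  then show "z s j - 1 \<noteq> 0" "z s j + 1 \<noteq> 0"
    using nz eqs by (metis neg_equal_0_iff_equal)+
qed

text \<open>For \<open>\<epsilon> j = -1\<close> the two norms change places, which is why the sign
  appears as a factor.\<close>

lemma log_z:
  assumes "j \<in> {0..4}" "coprime s N"
  shows "ln (norm (z s j - 1)) - ln (norm (z s j + 1)) =
    of_int (\<epsilon> j) * (2 * log_dist (a j * s) - log_dist (a j * (2 * s)))"
proof -
  define y where "y = unit_root N ^ (a j * s)"
  have "coprime (a j * s) N" using assms cop by simp
  then have nz: "1 - y \<noteq> 0" "1 + y \<noteq> 0" unfolding y_def by (rule unit_root_power_nonreal)+
  have "unit_root N ^ (a j * (2 * s)) = y\<^sup>2" by (simp add: y_def power_mult[symmetric] mult_ac)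
  then have "log_dist (a j * (2 * s)) = ln (norm ((1 - y) * (1 + y)))"
    by (simp add: log_dist_def power2_eq_square algebra_simps)
  also have "\<dots> = ln (norm (1 - y)) + ln (norm (1 + y))" using nz by (simp add: norm_mult ln_mult)
  finally have "2 * log_dist (a j * s) - log_dist (a j * (2 * s)) = ln (norm (1 - y)) - ln (norm (1 + y))"
    by (simp add: log_dist_def y_def)
  moreover have "norm (y - 1) = norm (1 - y)" "norm (y + 1) = norm (1 + y)"
      "norm (- y - 1) = norm (1 + y)" "norm (- y + 1) = norm (1 - y)"
    using norm_minus_commute[of y 1] norm_minus_commute[of "- y" 1] by (simp_all add: add.commute)
  ultimately show ?thesis using sign[OF assms(1)] by (auto simp: z_def y_def[symmetric])
qed

text \<open>The exponents of the tangents in the relation, 2 against four times 1 on the other side,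
  combined with the signs from \<open>log_z\<close>.\<close>

definition weight :: "nat \<Rightarrow> real" where
  "weight j = (if j = 0 then 2 else - 1) * of_int (\<epsilon> j)"

lemma sum_weight: "(\<Sum>j\<in>{0..4}. weight j * f j) =
    2 * of_int (\<epsilon> 0) * f 0 - (\<Sum>j\<in>{1..4}. of_int (\<epsilon> j) * f j)"
proof -
  have "{0..4::nat} = insert 0 {1..4}" by auto
  then have "(\<Sum>j\<in>{0..4}. weight j * f j) = weight 0 * f 0 + (\<Sum>j\<in>{1..4}. weight j * f j)" by simp
  moreover have "(\<Sum>j\<in>{1..4}. weight j * f j) = (\<Sum>j\<in>{1..4}. - (of_int (\<epsilon> j) * f j))"
    by (intro sum.cong) (auto simp: weight_def)
  ultimately show ?thesis by (simp add: weight_def sum_negf)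
qed

definition weighted_log :: "nat \<Rightarrow> real" where
  "weighted_log s = (\<Sum>j\<in>{0..4}. weight j * log_dist (a j * s))"

lemma weighted_log_double:
  assumes s: "coprime s N"
  shows "weighted_log (2 * s) = 2 * weighted_log s"
proof -
  define D where "D = (\<lambda>j. ln (norm (z s j - 1)) - ln (norm (z s j + 1)))"
  have nz: "norm (z s j - 1) > 0" "norm (z s j + 1) > 0" if "j \<in> {0..4}" for j
    using z_nonzero[OF that s] by simp_all
  have "(z s 0 - 1)\<^sup>2 * (\<Prod>j\<in>{1..4}. z s j + 1) = - ((z s 0 + 1)\<^sup>2 * (\<Prod>j\<in>{1..4}. z s j - 1))"
    using conjugate_rel[OF s] by (simp add: eq_neg_iff_add_eq_0)
  then have "norm ((z s 0 - 1)\<^sup>2 * (\<Prod>j\<in>{1..4}. z s j + 1)) = norm ((z s 0 + 1)\<^sup>2 * (\<Prod>j\<in>{1..4}. z s j - 1))"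
    by (metis norm_minus_cancel)
  then have "ln (norm (z s 0 - 1) ^ 2 * (\<Prod>j\<in>{1..4}. norm (z s j + 1))) =
      ln (norm (z s 0 + 1) ^ 2 * (\<Prod>j\<in>{1..4}. norm (z s j - 1)))"
    by (simp only: norm_mult norm_power prod_norm)
  moreover have "(\<Prod>j\<in>{1..4}. norm (z s j + 1)) > 0" "(\<Prod>j\<in>{1..4}. norm (z s j - 1)) > 0"
    using nz by (auto intro!: prod_pos)
  moreover have "ln (A ^ 2 * X) = 2 * ln A + ln X" if "A > 0" "X > 0" for A X :: real
    using that by (simp add: ln_mult ln_realpow)
  ultimately have "2 * ln (norm (z s 0 - 1)) + ln (\<Prod>j\<in>{1..4}. norm (z s j + 1)) =
      2 * ln (norm (z s 0 + 1)) + ln (\<Prod>j\<in>{1..4}. norm (z s j - 1))"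
    using nz[of 0] by simp
  moreover have "ln (\<Prod>j\<in>{1..4}. norm (z s j + 1)) = (\<Sum>j\<in>{1..4}. ln (norm (z s j + 1)))"
    "ln (\<Prod>j\<in>{1..4}. norm (z s j - 1)) = (\<Sum>j\<in>{1..4}. ln (norm (z s j - 1)))"
    using nz by (auto intro!: ln_prod)
  ultimately have "2 * D 0 = (\<Sum>j\<in>{1..4}. D j)"
    by (simp add: D_def sum_subtractf)
  moreover have D: "D j = of_int (\<epsilon> j) * (2 * log_dist (a j * s) - log_dist (a j * (2 * s)))" if "j \<in> {0..4}" for j
    unfolding D_def using log_z[OF that s] .
  have "(\<Sum>j\<in>{1..4}. D j) = (\<Sum>j\<in>{1..4}. of_int (\<epsilon> j) * (2 * log_dist (a j * s) - log_dist (a j * (2 * s))))"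
    by (intro sum.cong D) auto
  ultimately have "(\<Sum>j\<in>{0..4}. weight j * (2 * log_dist (a j * s) - log_dist (a j * (2 * s)))) = 0"
    unfolding sum_weight using D[of 0] by simp
  then show ?thesis
    by (simp add: weighted_log_def right_diff_distrib sum_subtractf sum_distrib_left mult_ac)
qed

text \<open>Doubling \<open>totient N\<close> times returns to the same residue, but multiplies the
  value by \<open>2 ^ totient N\<close>.\<close>

lemma weighted_log_zero:
  assumes s: "coprime s N"
  shows "weighted_log s = 0"
proof -
  have pow: "weighted_log (2 ^ k * s) = 2 ^ k * weighted_log s" for k
  proof (induction k)
    case (Suc k)
    have "coprime (2 ^ k * s) N" using s N(1) by simp
    then show ?case using weighted_log_double[of "2 ^ k * s"] Suc by (simp add: mult.assoc)
  qed simp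
  have "[2 ^ totient N = 1] (mod N)" using N(1) by (intro euler_theorem) simp
  then have "weighted_log (2 ^ totient N * s) = weighted_log s"
    unfolding weighted_log_def
    by (intro sum.cong refl arg_cong2[where f = "(*)"] log_dist_cong cong_scalar_left)
      (metis cong_scalar_right mult_1)
  then have "2 ^ totient N * weighted_log s = weighted_log s" using pow by simp
  moreover have "(2::real) ^ totient N > 1" using N by (intro one_less_power) auto
  ultimately show ?thesis by auto
qed

text \<open>The function \<open>c\<close> of the overview. Spreading each weight over
  \<open>a j\<close> and its negative makes it even, which is harmless because
  \<open>log_dist\<close> takes the same value on both.\<close>

definition pair_coeff :: "nat \<Rightarrow> real" where
  "pair_coeff b = (\<Sum>j\<in>{0..4}. weight j * (of_bool ([b = a j] (mod N)) + of_bool (N dvd b + a j)))"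

lemma log_relation_pair_coeff: "log_relation N pair_coeff"
proof
  show "N > 1" by (fact N)
  show "pair_coeff (b + N) = pair_coeff b" for b
  proof -
    have "[b + N = a j] (mod N) \<longleftrightarrow> [b = a j] (mod N)" "N dvd b + N + a j \<longleftrightarrow> N dvd b + a j" for j
      using dvd_add_left_iff[of N N "b + a j"] by (simp_all add: cong_def add_ac)
    then show ?thesis by (simp add: pair_coeff_def)
  qed
  show "pair_coeff b = 0" if b: "\<not> coprime b N" for b
  proof -
    have "\<not> [b = a j] (mod N) \<and> \<not> N dvd b + a j" if j: "j \<in> {0..4}" for j
    proof (intro conjI notI)
      assume "[b = a j] (mod N)"
      then show False using b cop[OF j] cong_imp_coprime cong_sym by blast
    next
      assume "N dvd b + a j"
      moreover have "coprime b N" if dvd: "N dvd b + a j"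
      proof (rule coprimeI)
        fix d assume "d dvd b" "d dvd N"
        then have "d dvd a j" using dvd by (meson dvd_add_right_iff dvd_trans)
        then show "d dvd 1" using \<open>d dvd N\<close> cop[OF j] by (meson coprime_common_divisor)
      qed
      ultimately show False using b by blast
    qed
    then show ?thesis by (simp add: pair_coeff_def)
  qed
  have neg: "[(N - 1) * b + b = 0] (mod N)" for b
    using N(2) by (simp add: cong_def diff_mult_distrib)
  have neg_iff: "[(N - 1) * b = c] (mod N) \<longleftrightarrow> N dvd b + c" for b c
  proof
    assume "[(N - 1) * b = c] (mod N)"
    then have "[(N - 1) * b + b = c + b] (mod N)" by (rule cong_add) simp
    then show "N dvd b + c" using neg[of b] by (metis add.commute cong_0_iff cong_sym cong_trans)
  next
    assume "N dvd b + c"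
    then have "[(N - 1) * b + b = c + b] (mod N)"
      using neg[of b] by (metis add.commute cong_0_iff cong_sym cong_trans)
    then show "[(N - 1) * b = c] (mod N)" using cong_add_rcancel_nat by blast
  qed
  show "pair_coeff ((N - 1) * b) = pair_coeff b" for b
  proof -
    have "[(N - 1) * b = a j] (mod N) \<longleftrightarrow> N dvd b + a j" for j by (rule neg_iff)
    moreover have "N dvd (N - 1) * b + a j \<longleftrightarrow> [b = a j] (mod N)" for j
    proof -
      have "N dvd (N - 1) * b + a j \<longleftrightarrow> [(N - 1) * b + a j = (N - 1) * b + b] (mod N)"
        using neg[of b] by (metis cong_0_iff cong_sym cong_trans)
      also have "\<dots> \<longleftrightarrow> [a j = b] (mod N)" by (rule cong_add_lcancel_nat)
      finally show ?thesis by (simp add: cong_sym_eq)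
    qed
    ultimately show ?thesis by (simp add: pair_coeff_def add.commute)
  qed
  show "(\<Sum>b<N. pair_coeff b * ln (norm (1 - unit_root N ^ (b * s)))) = 0" if s: "coprime s N" for s
  proof -
    have single: "(\<Sum>b<N. of_bool ([b = c] (mod N)) * log_dist (b * s)) = log_dist (c * s)" for c
    proof -
      have "(\<Sum>b<N. of_bool ([b = c] (mod N)) * log_dist (b * s)) =
          (\<Sum>b<N. if b = c mod N then log_dist (b * s) else 0)"
        by (intro sum.cong) (auto simp: cong_def)
      also have "\<dots> = log_dist (c mod N * s)" using N by simp
      also have "\<dots> = log_dist (c * s)" by (intro log_dist_cong cong_scalar_right) (simp add: cong_def)
      finally show ?thesis .
    qed
    have neg_log: "log_dist ((N - 1) * c * s) = log_dist (c * s)" for c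
    proof -
      have "unit_root N ^ ((N - 1) * c * s) * unit_root N ^ (c * s) = unit_root N ^ ((N - 1) * (c * s) + c * s)"
        by (simp add: power_add mult.assoc)
      also have "\<dots> = 1" using neg[of "c * s"] N unit_root_power_eq_1_iff[of N] by (simp add: cong_0_iff)
      finally have "1 - unit_root N ^ (c * s) = - (unit_root N ^ (c * s)) * (1 - unit_root N ^ ((N - 1) * c * s))"
        by (simp add: algebra_simps)
      then have "norm (1 - unit_root N ^ (c * s)) = norm (1 - unit_root N ^ ((N - 1) * c * s))"
        by (simp add: norm_mult norm_power)
      then show ?thesis by (simp only: log_dist_def)
    qed
    have neg_iff': "N dvd b + c \<longleftrightarrow> [b = (N - 1) * c] (mod N)" for b c
      using neg_iff[of c b] by (simp add: cong_sym_eq add.commute)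
    \<comment> \<open>Each \<open>j\<close> contributes its logarithm twice, once for either sign of
      the residue.\<close>
    have "(\<Sum>b<N. pair_coeff b * log_dist (b * s)) =
        (\<Sum>j\<in>{0..4}. weight j * ((\<Sum>b<N. of_bool ([b = a j] (mod N)) * log_dist (b * s)) +
          (\<Sum>b<N. of_bool ([b = (N - 1) * a j] (mod N)) * log_dist (b * s))))"
      unfolding pair_coeff_def sum_distrib_right neg_iff'
      by (subst sum.swap) (simp only: sum.distrib sum_distrib_left distrib_left distrib_right mult.assoc)
    also have "\<dots> = 2 * weighted_log s"
      unfolding single neg_log by (simp add: weighted_log_def sum_distrib_left mult_ac)
    finally show ?thesis using weighted_log_zero[OF s] by (simp add: log_dist_def)
  qed
qed

lemma pair_coeff_zero:
  assumes "\<not> squarefree N" "\<And>p. prime p \<Longrightarrow> p dvd N \<Longrightarrow> p > 5"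
  shows "pair_coeff b = 0"
proof (rule log_relation_trivial[OF log_relation_pair_coeff assms(1) N(1) assms(2)])
  show "\<exists>b'\<in>a ` {0..4}. [b = b'] (mod N) \<or> N dvd b + b'" if "pair_coeff b \<noteq> 0" for b
  proof (rule ccontr)
    assume "\<not> ?thesis"
    then have "pair_coeff b = 0" by (simp add: pair_coeff_def)
    then show False using that by simp
  qed
  show "card (a ` {0..4}) \<le> 5" using card_image_le[of "{0..4::nat}" a] by simp
qed auto

end

theorem theorem11p11:
  fixes n :: int and x :: "nat \<Rightarrow> real"
  assumes "n \<ge> 9" and "odd n" and "\<not> squarefree n"
    and "\<And>p. prime p \<Longrightarrow> p dvd n \<Longrightarrow> p > 5"
    and "\<And>i. i \<in> {0..4} \<Longrightarrow> x i \<in> G"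
    and "(tan (x 0))\<^sup>2 = tan (x 1) * tan (x 2) * tan (x 3) * tan (x 4)"
    and "\<And>i. i \<in> {0..4} \<Longrightarrow> 0 < x i \<and> x i < pi / 2"
    and "\<And>i. i \<in> {0..4} \<Longrightarrow> den (x i) \<in> {n, 2 * n}"
  shows "\<exists>\<sigma> (s::rat) (t::rat). \<sigma> permutes {1..4::nat} \<and>
    0 < s \<and> s < 1/2 \<and> 0 < t \<and> t \<le> 1/4 \<and>
    x 0 = of_rat s * pi \<and> x (\<sigma> 1) = of_rat s * pi \<and> x (\<sigma> 2) = of_rat s * pi \<and>
    x (\<sigma> 3) = of_rat t * pi \<and> x (\<sigma> 4) = of_rat (1/2 - t) * pi"
proof -
  define N where "N = nat n"
  have n: "n = int N" using assms(1) by (simp add: N_def)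
  have N: "odd N" "N > 1" using assms(1,2) unfolding n by auto
  have "\<forall>i\<in>{0..4}. \<exists>a \<epsilon>. coprime a N \<and> (\<epsilon> = 1 \<or> \<epsilon> = - 1) \<and> cis (2 * x i) = of_int \<epsilon> * unit_root N ^ a"
  proof
    fix i :: nat assume i: "i \<in> {0..4}"
    show "\<exists>a \<epsilon>. coprime a N \<and> (\<epsilon> = 1 \<or> \<epsilon> = - 1) \<and> cis (2 * x i) = of_int \<epsilon> * unit_root N ^ a"
      using cis_double_root_of_unity[OF N assms(5)[OF i], of thesis] assms(7)[OF i] assms(8)[OF i]
      unfolding n by (metis cis_double_root_of_unity[OF N assms(5)[OF i]] insert_iff empty_iff)
  qed
  then obtain a \<epsilon> where a: "\<And>i. i \<in> {0..4} \<Longrightarrow> coprime (a i) N"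
    and \<epsilon>: "\<And>i. i \<in> {0..4} \<Longrightarrow> \<epsilon> i = 1 \<or> \<epsilon> i = - 1"
    and cis: "\<And>i. i \<in> {0..4} \<Longrightarrow> cis (2 * x i) = of_int (\<epsilon> i) * unit_root N ^ a i"
    by metis
  have range: "0 < x i" "x i < pi / 2" if "i \<in> {0..4}" for i using assms(7)[OF that] by auto
  have tan: "cis (2 * x i) + 1 \<noteq> 0" "\<i> * of_real (tan (x i)) = (cis (2 * x i) - 1) / (cis (2 * x i) + 1)"
    if "i \<in> {0..4}" for i
    using i_tan_eq[of "x i"] cos_gt_zero_pi[of "x i"] range[OF that] by auto
  have four: "{1..4} = {1, 2, 3, 4::nat}" by auto
  have "(of_int (\<epsilon> 0) * unit_root N ^ a 0 - 1)\<^sup>2 * (\<Prod>j\<in>{1..4}. of_int (\<epsilon> j) * unit_root N ^ a j + 1) +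
      (of_int (\<epsilon> 0) * unit_root N ^ a 0 + 1)\<^sup>2 * (\<Prod>j\<in>{1..4}. of_int (\<epsilon> j) * unit_root N ^ a j - 1) = 0"
  proof -
    have "(\<i> * of_real (tan (x 0)))\<^sup>2 = - of_real ((tan (x 0))\<^sup>2)" by (simp add: power_mult_distrib)
    also have "\<dots> = - (\<Prod>j\<in>{1..4}. \<i> * of_real (tan (x j)))"
      unfolding assms(6) four by (simp add: mult_ac)
    finally have "((cis (2 * x 0) - 1) / (cis (2 * x 0) + 1))\<^sup>2 =
        - (\<Prod>j\<in>{1..4}. (cis (2 * x j) - 1) / (cis (2 * x j) + 1))"
      using tan(2) by simp
    moreover have "(\<Prod>j\<in>{1..4}. cis (2 * x j) + 1) \<noteq> 0" using tan(1) by simp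
    ultimately have "(cis (2 * x 0) - 1)\<^sup>2 * (\<Prod>j\<in>{1..4}. cis (2 * x j) + 1) +
        (cis (2 * x 0) + 1)\<^sup>2 * (\<Prod>j\<in>{1..4}. cis (2 * x j) - 1) = 0"
      using tan(1)[of 0] by (simp add: prod_dividef power_divide field_simps)
    then show ?thesis using cis by simp
  qed
  then interpret tangent_relation N a \<epsilon>
    using N a \<epsilon> by unfold_locales auto
  have primes: "p > 5" if "prime p" "p dvd N" for p
    using assms(4)[of "int p"] that unfolding n by simp
  have nsq: "\<not> squarefree N"
  proof
    assume sq: "squarefree N"
    have "squarefree n" unfolding squarefree_def
    proof (intro allI impI)
      fix y :: int assume "y\<^sup>2 dvd n"
      moreover have "y\<^sup>2 = int ((nat \<bar>y\<bar>)\<^sup>2)" by simp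
      ultimately have "(nat \<bar>y\<bar>)\<^sup>2 dvd N" unfolding n by (simp only: int_dvd_int_iff)
      then have "nat \<bar>y\<bar> dvd 1" using sq by (simp only: squarefree_def)
      then show "y dvd 1" by simp
    qed
    then show False using assms(3) by contradiction
  qed
  \<comment> \<open>Translation between exponents and angles. Since \<open>N\<close> is odd, -1 is
    not an \<open>N\<close>-th root of unity, so sign and root of unity can be read off
    \<open>cis (2 * x i)\<close> separately.\<close>
  have same: "[a i = a j] (mod N) \<longleftrightarrow> x i = x j" "x i = x j \<Longrightarrow> \<epsilon> i = \<epsilon> j"
    "N dvd a i + a j \<longleftrightarrow> x i + x j = pi / 2" "x i + x j = pi / 2 \<Longrightarrow> \<epsilon> i = - \<epsilon> j"
    if i: "i \<in> {0..4}" and j: "j \<in> {0..4}" for i j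
  proof -
    note cis_cases = cis_double_eq_iff[OF range[OF i] range[OF j]]
    define u v where "u = unit_root N ^ a i" and "v = unit_root N ^ a j"
    have zi: "cis (2 * x i) = of_int (\<epsilon> i) * u" and zj: "cis (2 * x j) = of_int (\<epsilon> j) * v"
      using cis i j by (simp_all add: u_def v_def)
    have uN: "u ^ N = 1" "v ^ N = 1"
      using unit_root_power_self[of N] N unfolding u_def v_def by (metis less_trans mult.commute power_mult power_one zero_less_one)+
    have "norm v = 1" by (simp add: v_def norm_power)
    then have v: "norm v = 1" "v \<noteq> 0" by auto
    have "cnj v * v = 1" using complex_norm_square[of v] v by (simp add: mult.commute)
    have "cis (- (2 * x j)) = cnj (cis (2 * x j))" by (simp add: complex_eq_iff)
    then have zj': "cis (- (2 * x j)) = of_int (\<epsilon> j) * cnj v" by (simp add: zj)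
    have uv: "[a i = a j] (mod N) \<longleftrightarrow> u = v" "N dvd a i + a j \<longleftrightarrow> u * v = 1"
      using N unit_root_power_eq_iff[of N] unit_root_power_eq_1_iff[of N "a i + a j"] by (simp_all add: u_def v_def power_add)
    have e: "\<epsilon> i = \<epsilon> j \<or> \<epsilon> i = - \<epsilon> j" "\<epsilon> j = 1 \<or> \<epsilon> j = - 1" using \<epsilon>[OF i] \<epsilon>[OF j] by auto
    have eq: "\<epsilon> i = \<epsilon> j \<and> u = v" if "x i = x j"
    proof -
      have "of_int (\<epsilon> i) * u = of_int (\<epsilon> j) * v" using zi zj that by simp
      then have "\<epsilon> i = \<epsilon> j \<and> u = v \<or> u = - v" using e by auto
      moreover have "u \<noteq> - v" using uN N(1) by auto
      ultimately show ?thesis by blast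
    qed
    have opp: "\<epsilon> i = - \<epsilon> j \<and> u * v = 1" if "x i + x j = pi / 2"
    proof -
      have "of_int (\<epsilon> i) * u = - (of_int (\<epsilon> j) * cnj v)" using cis_cases(2) that zi zj' by simp
      then have "of_int (\<epsilon> i) * (u * v) = - of_int (\<epsilon> j) * (cnj v * v)"
        by (metis mult.assoc mult_minus_left)
      moreover have "u * v = - 1" if "- (u * v) = 1" using that by (metis minus_minus)
      ultimately have "\<epsilon> i = - \<epsilon> j \<and> u * v = 1 \<or> u * v = - 1"
        using e \<open>cnj v * v = 1\<close> by auto
      moreover have "u * v \<noteq> - 1"
      proof
        assume "u * v = - 1"
        then have "(u * v) ^ N = - 1" using N(1) by simp
        then show False using uN by (simp add: power_mult_distrib)
      qed
      ultimately show ?thesis by blast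
    qed
    have eq': "x i = x j" if "u = v"
      using cis_cases(1,3) zi zj e that by auto
    have opp': "x i + x j = pi / 2" if "u * v = 1"
    proof -
      have "u = cnj v" using that \<open>cnj v * v = 1\<close> v(2) by (metis mult_cancel_right)
      then show ?thesis using cis_cases(2,4) zi zj' e by auto
    qed
    show "[a i = a j] (mod N) \<longleftrightarrow> x i = x j" "x i = x j \<Longrightarrow> \<epsilon> i = \<epsilon> j"
      "N dvd a i + a j \<longleftrightarrow> x i + x j = pi / 2" "x i + x j = pi / 2 \<Longrightarrow> \<epsilon> i = - \<epsilon> j"
      unfolding uv using eq eq' opp opp' by blast+
  qed
  define T where "T = (\<lambda>i j. of_bool (x i = x j) - of_bool (x i + x j = pi / 2) :: int)"
  \<comment> \<open>Such an angle would be complementary to itself, making its sign its own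
    opposite.\<close>
  have not_half: "x i + x i \<noteq> pi / 2" if "i \<in> {0..4}" for i
    using same(4)[OF that that] \<epsilon>[OF that] by auto
  \<comment> \<open>This is \<open>pair_coeff (a i) = 0\<close> multiplied by
    \<open>\<epsilon> i\<close>. The product \<open>\<epsilon> i * \<epsilon> j\<close> is 1 for
    equal and -1 for complementary angles, which accounts for the minus sign in
    \<open>T\<close>.\<close>
  have count: "2 * T i 0 = (\<Sum>j\<in>{1..4}. T i j)" if i: "i \<in> {0..4}" for i
  proof -
    have T: "of_int (\<epsilon> i) * (of_int (\<epsilon> j) * (of_bool ([a i = a j] (mod N)) + of_bool (N dvd a i + a j))) =
        (of_int (T i j) :: real)" if j: "j \<in> {0..4}" for j
      using same[OF i j] \<epsilon>[OF i] \<epsilon>[OF j] not_half[OF i] by (auto simp: T_def of_bool_def)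
    have "0 = of_int (\<epsilon> i) * pair_coeff (a i)"
      using pair_coeff_zero[OF nsq primes, of "a i"] by simp
    also have "\<dots> = 2 * of_int (T i 0) - (\<Sum>j\<in>{1..4}. of_int (T i j))"
      unfolding pair_coeff_def sum_weight right_diff_distrib sum_distrib_left
      by (intro arg_cong2[where f = "(-)"] sum.cong refl T) (use T[of 0] in simp_all)
    finally have "real_of_int (2 * T i 0) = real_of_int (\<Sum>j\<in>{1..4}. T i j)" by simp
    then show ?thesis by (simp only: of_int_eq_iff)
  qed
  obtain i j k l where ijkl: "{1..4} = {i, j, k, l}" "distinct [i, j, k, l]"
    and xs: "x i = x 0" "x j = x 0" "x k + x l = pi / 2" "x k \<le> x l"
    using pairing_from_counting[of x "pi / 2", OF count[unfolded T_def] not_half] by blast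
  have "k \<in> {0..4}" using ijkl(1) by (metis atLeastAtMost_iff insertCI le0)
  obtain s where s: "x 0 = of_rat s * pi" using assms(5)[of 0] by (auto simp: G_def)
  obtain t where t: "x k = of_rat t * pi" using assms(5)[OF \<open>k \<in> {0..4}\<close>] by (auto simp: G_def)
  define \<sigma> where "\<sigma> = (\<lambda>m::nat. if m = 1 then i else if m = 2 then j else if m = 3 then k else if m = 4 then l else m)"
  have "bij_betw \<sigma> {1..4} {1..4}"
  proof (rule bij_betw_imageI)
    show "inj_on \<sigma> {1..4}" unfolding four using ijkl(2) by (auto simp: inj_on_def \<sigma>_def)
    have "\<sigma> ` {1..4} = {i, j, k, l}" unfolding four by (auto simp: \<sigma>_def)
    then show "\<sigma> ` {1..4} = {1..4}" by (simp only: ijkl(1))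
  qed
  then have "\<sigma> permutes {1..4}" by (rule bij_imp_permutes) (auto simp: \<sigma>_def)
  moreover have "0 < s" "s < 1/2"
  proof -
    have "0 < real_of_rat s" "real_of_rat s < real_of_rat (1/2)" using range[of 0] s by (auto simp: zero_less_mult_iff of_rat_divide)
    then show "0 < s" "s < 1/2" by (simp_all only: zero_less_of_rat_iff of_rat_less)
  qed
  moreover have "0 < t" "t \<le> 1/4"
  proof -
    have "x k \<le> (1/4) * pi" using xs(3,4) by linarith
    then have "real_of_rat t \<le> 1/4" unfolding t by (simp only: mult_le_cancel_right_pos[OF pi_gt_zero])
    then have "real_of_rat t \<le> real_of_rat (1/4)" by (simp add: of_rat_divide)
    moreover have "0 < real_of_rat t" using range(1)[OF \<open>k \<in> {0..4}\<close>] t by (simp add: zero_less_mult_iff)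
    ultimately show "0 < t" "t \<le> 1/4" by (simp_all only: zero_less_of_rat_iff of_rat_less_eq)
  qed
  moreover have "x l = of_rat (1/2 - t) * pi"
    using xs(3) t by (simp add: of_rat_diff of_rat_divide left_diff_distrib)
  ultimately show ?thesis using s t xs by (intro exI[of _ \<sigma>] exI[of _ s] exI[of _ t]) (simp add: \<sigma>_def)
qed

end
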